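(* Let $\xi=(\xi_t)_{t\ge 0}$ be a real-valued Lévy process with Lévy exponent $\Phi$, i.e. $\mathbb{E}(e^{\lambda\xi_t})=e^{-t\Phi(\lambda)}$. Assume: (1) (Cramér's condition) there exists $\chi>0$ such that $\Phi(\chi)=0$; (2) there exists $\epsilon>0$ such that $\Phi>-\infty$ on the interval $[0,\chi+\epsilon]$; (3) the law of $\xi_1$ is not arithmetic. Then the exponential functional $A_\infty:=\int_0^\infty e^{\xi_s}\,ds$ is well defined (almost surely finite), and there exists a constant $C>0$ such that $$\mathbb{P}(A_\infty>t)\sim C\,t^{-\chi}\qquad\text{as } t\to+\infty .$$
   Context: For real $\lambda$, the Lévy exponent $\Phi(\lambda)\in[-\infty,\infty)$ is defined by $\mathbb{E}(e^{\lambda\xi_t})=e^{-t\Phi(\lambda)}$, with $\Phi(\lambda)=-\infty$ when $\mathbb{E}(e^{\lambda\xi_1})=+\infty$. Lévy processes start at $0$. The law of a real random variable $Z$ is arithmetic if $\mathbb{P}(Z\in\lambda\mathbb{Z})=1$ for some real $\lambda$. The notation $f(t)\sim h(t)$ means $f(t)/h(t)\to1$. The paper remarks that Cramér's condition can only happen if $-\infty\le\mathbb{E}(\xi_1)<0$. *)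

theory Defs
  imports "HOL-Probability.Probability" "HOL-Library.Landau_Symbols"
begin

definition cadlag :: "(real \<Rightarrow> real) \<Rightarrow> bool" where
  "cadlag f \<longleftrightarrow>
     (\<forall>t\<ge>0. (f \<longlongrightarrow> f t) (at_right t)) \<and>
     (\<forall>t>0. \<exists>l. (f \<longlongrightarrow> l) (at_left t))"

text \<open>
  Time is the half-line of nonnegative reals; the values of \<open>\<xi>\<close> at negative times are irrelevant.
  Every path, not only almost every one, is required to be cadlag.
\<close>

locale levy_process = prob_space M for M :: "'a measure" +
  fixes \<xi> :: "real \<Rightarrow> 'a \<Rightarrow> real"
  assumes random_variable_at: "t \<ge> 0 \<Longrightarrow> random_variable borel (\<xi> t)"
    and starts_at_0: "AE \<omega> in M. \<xi> 0 \<omega> = 0"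
    and indep_increments:
      "\<lbrakk>0 \<le> \<tau> 0; \<And>i. i < n \<Longrightarrow> \<tau> i \<le> \<tau> (Suc i)\<rbrakk> \<Longrightarrow>
         indep_vars (\<lambda>_. borel) (\<lambda>i \<omega>. \<xi> (\<tau> (Suc i)) \<omega> - \<xi> (\<tau> i) \<omega>) {..<n::nat}"
    and stationary_increments:
      "\<lbrakk>s \<ge> 0; h \<ge> 0\<rbrakk> \<Longrightarrow>
         distr M borel (\<lambda>\<omega>. \<xi> (s + h) \<omega> - \<xi> s \<omega>) = distr M borel (\<xi> h)"
    and cadlag_paths: "\<omega> \<in> space M \<Longrightarrow> cadlag (\<lambda>t. \<xi> t \<omega>)"

text \<open>
  The sign convention is \<open>E (exp (l * \<xi> t)) = exp (- t * \<Phi> l)\<close>, so that \<open>\<Phi> l = -\<infinity>\<close> encodes an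
  infinite exponential moment. The value is read off at \<open>t = 1\<close>; the identity at all \<open>t > 0\<close> is
  the lemma \<open>nn_integral_exp_levy\<close> below.
\<close>

definition levy_exponent :: "'a measure \<Rightarrow> (real \<Rightarrow> 'a \<Rightarrow> real) \<Rightarrow> real \<Rightarrow> ereal" where
  "levy_exponent M \<xi> l =
     (if integrable M (\<lambda>\<omega>. exp (l * \<xi> 1 \<omega>))
      then ereal (- ln (\<integral>\<omega>. exp (l * \<xi> 1 \<omega>) \<partial>M)) else -\<infinity>)"

text \<open>The case \<open>l = 0\<close> is included: a law concentrated at \<open>0\<close> is arithmetic.\<close>

definition arithmetic_law :: "real measure \<Rightarrow> bool" where
  "arithmetic_law N \<longleftrightarrow> (\<exists>l::real. measure N (range (\<lambda>k::int. l * of_int k)) = 1)"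

definition exp_functional :: "(real \<Rightarrow> 'a \<Rightarrow> real) \<Rightarrow> 'a \<Rightarrow> ennreal" where
  "exp_functional \<xi> \<omega> = (\<integral>\<^sup>+ s\<in>{0..}. ennreal (exp (\<xi> s \<omega>)) \<partial>lborel)"

lemma additive_bounded_below_linear:
  fixes g :: "real \<Rightarrow> real"
  assumes add: "\<And>s t. s \<ge> 0 \<Longrightarrow> t \<ge> 0 \<Longrightarrow> g (s + t) = g s + g t"
    and d: "d > 0" and bd: "\<And>t. 0 \<le> t \<Longrightarrow> t \<le> d \<Longrightarrow> g t \<ge> B"
    and t: "t \<ge> 0"
  shows "g t = t * g 1"
proof -
  define h where "h s = g s - s * g 1" for s
  have hadd: "h (s + u) = h s + h u" if "s \<ge> 0" "u \<ge> 0" for s u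
    using add[OF that] by (simp add: h_def algebra_simps)
  have h0: "h 0 = 0" using hadd[of 0 0] by simp
  have hn: "h (real n * s) = real n * h s" if "s \<ge> 0" for n s
  proof (induction n)
    case (Suc n)
    have "h (real (Suc n) * s) = h (real n * s + s)" by (simp add: algebra_simps)
    also have "\<dots> = h (real n * s) + h s" using that by (intro hadd) auto
    finally show ?case using Suc by (simp add: algebra_simps)
  qed (simp add: h0)
  have h1: "h 1 = 0" by (simp add: h_def)
  obtain m :: nat where m: "m > 0" "1 / real m \<le> d"
    using d real_arch_inverse[of d] by (auto simp: inverse_eq_divide intro: less_imp_le)
  have hm: "h (1 / real m) = 0" using hn[of "1 / real m" m] m h1 by simp
  define B' where "B' = B - d * \<bar>g 1\<bar>"
  have bd': "h u \<ge> B'" if "0 \<le> u" "u \<le> d" for u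
  proof -
    have "u * g 1 \<le> u * \<bar>g 1\<bar>" using that by (intro mult_left_mono) auto
    also have "\<dots> \<le> d * \<bar>g 1\<bar>" using that by (intro mult_right_mono) auto
    finally show ?thesis using bd[OF that] by (simp add: h_def B'_def)
  qed
  have bdall: "h u \<ge> B'" if u: "u \<ge> 0" for u
  proof -
    define k where "k = nat \<lfloor>u * real m\<rfloor>"
    have k: "real k \<le> u * real m" "u * real m < real k + 1"
      using u by (auto simp: k_def)
    define r where "r = u - real k * (1 / real m)"
    have "r * real m = u * real m - real k" using m by (simp add: r_def field_simps)
    then have "0 \<le> r * real m" "r * real m \<le> 1" using k by linarith+
    then have r: "0 \<le> r" "r \<le> 1 / real m"
      using m by (auto simp: pos_le_divide_eq zero_le_mult_iff)
    have "h u = h (real k * (1 / real m) + r)" by (simp add: r_def)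
    also have "\<dots> = h (real k * (1 / real m)) + h r" using r by (intro hadd) auto
    also have "h (real k * (1 / real m)) = 0" using hn[of "1 / real m" k] hm by simp
    finally show ?thesis using bd'[of r] r m by auto
  qed
  have pos: "h u \<ge> 0" if u: "u \<ge> 0" for u
  proof (rule ccontr)
    assume "\<not> h u \<ge> 0"
    then have neg: "- h u > 0" by simp
    obtain n :: nat where n: "- B' < real n * (- h u)" using reals_Archimedean3[OF neg] by blast
    have "B' \<le> h (real n * u)" using u by (intro bdall) auto
    also have "\<dots> = real n * h u" using u by (rule hn)
    finally show False using n by simp
  qed
  obtain K :: nat where K: "t \<le> real K" using real_arch_simple by blast
  have "h t + h (real K - t) = h (t + (real K - t))" using t K by (intro hadd[symmetric]) auto
  also have "\<dots> = 0" using hn[of 1 K] h1 by simp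
  finally have "h t = 0" using pos[of t] pos[of "real K - t"] t K by auto
  then show ?thesis by (simp add: h_def)
qed

context levy_process
begin

lemma nn_integral_exp_increment:
  assumes "s \<ge> 0" "h \<ge> 0"
  shows "(\<integral>\<^sup>+\<omega>. ennreal (exp (l * (\<xi> (s + h) \<omega> - \<xi> s \<omega>))) \<partial>M) =
    (\<integral>\<^sup>+\<omega>. ennreal (exp (l * \<xi> h \<omega>)) \<partial>M)"
proof -
  note [measurable] = random_variable_at[OF assms(1)] random_variable_at[OF assms(2)]
    random_variable_at[of "s + h"]
  have [measurable]: "\<xi> (s + h) \<in> borel_measurable M" using assms by (intro random_variable_at) auto
  have "(\<integral>\<^sup>+\<omega>. ennreal (exp (l * (\<xi> (s + h) \<omega> - \<xi> s \<omega>))) \<partial>M) =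
      (\<integral>\<^sup>+x. ennreal (exp (l * x)) \<partial>distr M borel (\<lambda>\<omega>. \<xi> (s + h) \<omega> - \<xi> s \<omega>))"
    by (subst nn_integral_distr) auto
  also have "\<dots> = (\<integral>\<^sup>+\<omega>. ennreal (exp (l * \<xi> h \<omega>)) \<partial>M)"
    unfolding stationary_increments[OF assms] by (subst nn_integral_distr) auto
  finally show ?thesis .
qed

lemma nn_integral_exp_add:
  assumes s: "s \<ge> 0" and h: "h \<ge> 0"
  shows "(\<integral>\<^sup>+\<omega>. ennreal (exp (l * \<xi> (s + h) \<omega>)) \<partial>M) =
    (\<integral>\<^sup>+\<omega>. ennreal (exp (l * \<xi> s \<omega>)) \<partial>M) * (\<integral>\<^sup>+\<omega>. ennreal (exp (l * \<xi> h \<omega>)) \<partial>M)"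
proof -
  define t where "t = (\<lambda>i::nat. if i = 0 then 0 else if i = 1 then s else s + h)"
  define Y where "Y = (\<lambda>(i::nat) \<omega>. ennreal (exp (l * (\<xi> (t (Suc i)) \<omega> - \<xi> (t i) \<omega>))))"
  have "indep_vars (\<lambda>_. borel) (\<lambda>i \<omega>. \<xi> (t (Suc i)) \<omega> - \<xi> (t i) \<omega>) {..<2::nat}"
    using s h by (intro indep_increments) (auto simp: t_def)
  then have ind: "indep_vars (\<lambda>_. borel) Y {..<2}"
    unfolding Y_def by (rule indep_vars_compose2[where Y = "\<lambda>_ x. ennreal (exp (l * x))"]) auto
  have "(\<integral>\<^sup>+\<omega>. ennreal (exp (l * \<xi> (s + h) \<omega>)) \<partial>M) = (\<integral>\<^sup>+\<omega>. (\<Prod>i<2. Y i \<omega>) \<partial>M)"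
    using starts_at_0
    by (intro nn_integral_cong_AE)
       (auto simp: Y_def t_def numeral_2_eq_2 ennreal_mult[symmetric] exp_add[symmetric]
          algebra_simps elim!: eventually_mono)
  also have "\<dots> = (\<Prod>i<2. \<integral>\<^sup>+\<omega>. Y i \<omega> \<partial>M)"
    using ind by (intro indep_vars_nn_integral) auto
  also have "\<dots> = (\<integral>\<^sup>+\<omega>. Y 0 \<omega> \<partial>M) * (\<integral>\<^sup>+\<omega>. Y 1 \<omega> \<partial>M)"
    by (simp add: numeral_2_eq_2)
  also have "(\<integral>\<^sup>+\<omega>. Y 0 \<omega> \<partial>M) = (\<integral>\<^sup>+\<omega>. ennreal (exp (l * \<xi> s \<omega>)) \<partial>M)"
    using nn_integral_exp_increment[of 0 s l] s by (simp add: Y_def t_def)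
  also have "(\<integral>\<^sup>+\<omega>. Y 1 \<omega> \<partial>M) = (\<integral>\<^sup>+\<omega>. ennreal (exp (l * \<xi> h \<omega>)) \<partial>M)"
    using nn_integral_exp_increment[of s h l] s h by (simp add: Y_def t_def)
  finally show ?thesis .
qed

lemma nn_integral_exp_levy:
  assumes t: "t > 0"
  shows "(\<integral>\<^sup>+\<omega>. ennreal (exp (l * \<xi> t \<omega>)) \<partial>M) =
    (case levy_exponent M \<xi> l of ereal x \<Rightarrow> ennreal (exp (- t * x)) | _ \<Rightarrow> \<infinity>)"
proof -
  define N where "N t = (\<integral>\<^sup>+\<omega>. ennreal (exp (l * \<xi> t \<omega>)) \<partial>M)" for t
  have meas: "(\<lambda>\<omega>. ennreal (exp (l * \<xi> t \<omega>))) \<in> borel_measurable M" if "t \<ge> 0" for t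
    using random_variable_at[OF that] by measurable
  have measr: "(\<lambda>\<omega>. exp (l * \<xi> t \<omega>)) \<in> borel_measurable M" if "t \<ge> 0" for t
    using random_variable_at[OF that] by measurable
  have add: "N (s + h) = N s * N h" if "s \<ge> 0" "h \<ge> 0" for s h
    unfolding N_def by (rule nn_integral_exp_add[OF that])
  have pos: "N t \<noteq> 0" if "t \<ge> 0" for t
  proof
    assume "N t = 0"
    then have "AE \<omega> in M. False"
      unfolding N_def using nn_integral_0_iff_AE[OF meas[OF that]] by (simp add: ennreal_eq_0_iff)
    then show False by simp
  qed
  have N0: "N 0 = 1"
  proof -
    have "N 0 = (\<integral>\<^sup>+\<omega>. 1 \<partial>M)"
      unfolding N_def using starts_at_0 by (intro nn_integral_cong_AE) (auto elim!: eventually_mono)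
    then show ?thesis by (simp add: emeasure_space_1)
  qed
  have mono_fin: "N u < \<infinity>" if "N s < \<infinity>" "0 \<le> u" "u \<le> s" for s u
  proof (rule ccontr)
    assume "\<not> N u < \<infinity>"
    then have "N u = \<infinity>" by (simp add: top.not_eq_extremum[symmetric])
    moreover have "N s = N u * N (s - u)" using add[of u "s - u"] that by simp
    ultimately have "N s = \<infinity>" using pos[of "s - u"] that by (simp add: ennreal_top_mult)
    then show False using that by simp
  qed
  have mult_fin: "N (real n * s) < \<infinity>" if "N s < \<infinity>" "0 \<le> s" for n s
  proof (induction n)
    case (Suc n)
    have "N (real (Suc n) * s) = N (real n * s + s)" by (simp add: algebra_simps)
    also have "\<dots> = N (real n * s) * N s" using that by (intro add) auto
    also have "\<dots> < \<infinity>" using Suc that by (simp add: ennreal_mult_less_top)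
    finally show ?case .
  qed (simp add: N0)
  have fin: "N u < \<infinity>" if "N s < \<infinity>" "0 < s" "0 \<le> u" for s u
  proof -
    obtain n :: nat where "u < real n * s" using reals_Archimedean3[OF \<open>0 < s\<close>] by blast
    then show ?thesis using mono_fin[OF mult_fin[of s n], of u] that by auto
  qed
  have int1: "integrable M (\<lambda>\<omega>. exp (l * \<xi> 1 \<omega>)) \<longleftrightarrow> N 1 < \<infinity>"
    using measr[of 1] by (simp add: integrable_iff_bounded N_def)
  show ?thesis
  proof (cases "N 1 < \<infinity>")
    case False
    then have "N t = \<infinity>" using fin[of t 1] t by (auto simp: top.not_eq_extremum[symmetric])
    then show ?thesis using False int1 by (simp add: levy_exponent_def N_def)
  next
    case True
    then have finite: "N u < \<infinity>" if "u \<ge> 0" for u using fin[of 1 u] that by simp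
    define g where "g u = ln (enn2real (N u))" for u
    have rpos: "enn2real (N u) > 0" if "u \<ge> 0" for u
      using pos[OF that] finite[OF that] by (simp add: enn2real_positive_iff zero_less_iff_neq_zero)
    have gadd: "g (s + u) = g s + g u" if "s \<ge> 0" "u \<ge> 0" for s u
      using rpos[of s] rpos[of u] that
      by (simp add: g_def add enn2real_mult ln_mult)
    have "\<exists>d>0. \<forall>u. 0 \<le> u \<and> u \<le> d \<longrightarrow> N u \<ge> ennreal (1/2)"
    proof (rule ccontr)
      assume "\<not> ?thesis"
      then have "\<forall>n. \<exists>u. 0 \<le> u \<and> u \<le> 1 / real (Suc n) \<and> N u < ennreal (1/2)"
        by (metis not_le of_nat_0_less_iff zero_less_Suc zero_less_divide_1_iff)
      then obtain u where u: "\<And>n. 0 \<le> u n" "\<And>n. u n \<le> 1 / real (Suc n)"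
        "\<And>n. N (u n) < ennreal (1/2)" by metis
      have upos: "u n > 0" for n
      proof (rule ccontr)
        assume "\<not> u n > 0"
        then have "N (u n) = 1" using u(1)[of n] N0 by (simp add: antisym)
        moreover have "ennreal (1/2) < 1" by (subst ennreal_less_one_iff) simp
        ultimately show False using u(3)[of n] by simp
      qed
      have u0: "u \<longlonglongrightarrow> 0"
      proof (rule tendsto_sandwich[OF _ _ tendsto_const])
        show "(\<lambda>n. 1 / real (Suc n)) \<longlonglongrightarrow> 0"
          using LIMSEQ_inverse_real_of_nat by (simp add: inverse_eq_divide)
      qed (use u in auto)
      then have ur: "filterlim u (at_right 0) sequentially"
        using upos by (auto simp: filterlim_at intro!: always_eventually less_imp_neq[symmetric])
      have lim: "(\<lambda>n. ennreal (exp (l * \<xi> (u n) \<omega>))) \<longlonglongrightarrow> ennreal (exp (l * \<xi> 0 \<omega>))"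
        if "\<omega> \<in> space M" for \<omega>
      proof -
        have "((\<lambda>t. \<xi> t \<omega>) \<longlongrightarrow> \<xi> 0 \<omega>) (at_right 0)"
          using cadlag_paths[OF that] by (auto simp: cadlag_def)
        from filterlim_compose[OF this ur] show ?thesis by (intro tendsto_intros)
      qed
      have "1 = (\<integral>\<^sup>+\<omega>. ennreal (exp (l * \<xi> 0 \<omega>)) \<partial>M)" using N0 by (simp add: N_def)
      also have "\<dots> = (\<integral>\<^sup>+\<omega>. liminf (\<lambda>n. ennreal (exp (l * \<xi> (u n) \<omega>))) \<partial>M)"
        by (intro nn_integral_cong lim_imp_Liminf[symmetric] lim) auto
      also have "\<dots> \<le> liminf (\<lambda>n. N (u n))"
        unfolding N_def using u(1) by (intro nn_integral_liminf meas) auto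
      also have "\<dots> \<le> liminf (\<lambda>n::nat. ennreal (1/2))"
        by (intro Liminf_mono always_eventually allI less_imp_le u(3))
      also have "\<dots> = ennreal (1/2)" by (simp add: Liminf_const)
      also have "\<dots> < 1" by (subst ennreal_less_one_iff) simp
      finally show False by simp
    qed
    then obtain d where d: "d > 0" "\<And>u. 0 \<le> u \<Longrightarrow> u \<le> d \<Longrightarrow> N u \<ge> ennreal (1/2)" by auto
    have gb: "g u \<ge> ln (1/2)" if "0 \<le> u" "u \<le> d" for u
    proof -
      have "enn2real (ennreal (1/2)) \<le> enn2real (N u)"
        using d(2)[OF that] finite[OF that(1)] by (intro enn2real_mono) auto
      then have "1/2 \<le> enn2real (N u)" by (subst (asm) enn2real_ennreal) simp_all
      then show ?thesis unfolding g_def using rpos[OF that(1)] by (subst ln_le_cancel_iff) auto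
    qed
    have "g t = t * g 1"
      using additive_bounded_below_linear[of g d "ln (1/2)" t] gadd d(1) gb t by auto
    then have "enn2real (N t) = exp (t * g 1)"
      using rpos[of t] t by (metis exp_ln g_def less_imp_le)
    then have 1: "N t = ennreal (exp (t * g 1))"
      using finite[of t] t by (metis ennreal_enn2real less_imp_le infinity_ennreal_def)
    have "(\<integral>\<omega>. exp (l * \<xi> 1 \<omega>) \<partial>M) = enn2real (N 1)"
      unfolding N_def using measr[of 1] by (intro integral_eq_nn_integral) auto
    then have "levy_exponent M \<xi> l = ereal (- g 1)"
      using True int1 by (simp add: levy_exponent_def g_def)
    then show ?thesis using 1 by (simp add: N_def)
  qed
qed

end

end

theory Submission
  imports Defs "HOL-Complex_Analysis.Complex_Analysis" "HOL-Real_Asymp.Real_Asymp"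
begin

text \<open>Independence is available only for finitely many increments, whereas the restarted
  integral sees uncountably many times; the passage through dyadic samples bridges this gap. The
  identity for powers of \<open>A\<close> is first usable only where \<open>A\<close> is known to be
  finite, so it is applied to a horizon [0, T). There the remainder at time u has the shrinking
  horizon T - u, and its moment of order p - 1 explodes as u tends to T. For 0 < p < 1 a small-time
  estimate of order (T - u) powr (p - 1) keeps the integral bounded uniformly in T, which gives
  finiteness of \<open>A\<close>.

  The factor \<open>m (s - 1)\<close> is analytic for 0 < Re s < \<theta> + 1, one unit further than
  \<open>m s\<close>, so the pole comes only from the zero of 1 - E (exp (s * \<xi> 1)) at \<theta>.
  That zero is simple because the convex function l -> E (exp (l * \<xi> 1)) has positive slope at
  \<theta>. The resulting constant is C = E (A powr (\<theta> - 1)) / E (\<xi> 1 * exp (\<theta> *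
  \<xi> 1)): the factor s of the functional equation cancels against the 1 / s in the transform of
  the tail.\<close>

text \<open>
  Write \<open>A\<close> for the exponential functional and \<open>A\<^sub>u\<close> for its part after time \<open>u\<close>. Substituting
  \<open>r = A\<^sub>u\<close> gives \<open>A powr s = s * \<integral> exp (\<xi> u) * A\<^sub>u powr (s - 1) du\<close> on every path, and \<open>A\<^sub>u\<close> is
  \<open>exp (\<xi> u)\<close> times an independent copy of \<open>A\<close>. Hence the Mellin transform \<open>m s = E (A powr s)\<close>
  satisfies \<open>m s = s * m (s - 1) * \<integral> E (exp (s * \<xi> u)) du\<close> for \<open>0 < Re s < \<theta>\<close>, with an integral that
  equals \<open>1 / (1 - E (exp (s * \<xi> 1)))\<close> times a function analytic beyond \<open>Re s = \<theta>\<close>. For real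
  \<open>s\<close> this identity also shows, starting from the negative moments, that \<open>A\<close> is finite and has all
  moments of order below \<open>\<theta>\<close>. As the law of \<open>\<xi> 1\<close> is not arithmetic, \<open>m\<close> extends continuously
  to the line \<open>Re s = \<theta>\<close> except for a simple pole at \<open>\<theta>\<close>, and a Wiener-Ikehara theorem for
  \<open>exp (\<theta> * x) * P (A > exp x)\<close> yields the tail.
\<close>

section \<open>Exponential transforms and the Riemann-Lebesgue lemma\<close>

lemma nn_integral_exp_halfline:
  fixes a :: real
  assumes "a > 0"
  shows "(\<integral>\<^sup>+u\<in>{0..}. ennreal (exp (- a * u)) \<partial>lborel) = ennreal (1 / a)"
proof -
  have "((\<lambda>x. exp (- a * x)) has_integral exp (- a * 0) / a) {0..}"
    using assms by (rule has_integral_exp_minus_to_infinity)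
  then have "((\<lambda>x. if x \<in> {0..} then exp (- a * x) else 0) has_integral 1 / a) UNIV"
    by (simp only: has_integral_restrict_UNIV mult_zero_right exp_zero)
  also have "(\<lambda>x. if x \<in> {0..} then exp (- a * x) else 0) = (\<lambda>x. indicator {0..} x * exp (- a * x))"
    by (auto simp: fun_eq_iff indicator_def)
  finally have "(\<integral>\<^sup>+x. ennreal (indicator {0..} x * exp (- a * x)) \<partial>lborel) = ennreal (1 / a)"
    using assms by (intro nn_integral_has_integral_lborel) auto
  moreover have "(\<integral>\<^sup>+u\<in>{0..}. ennreal (exp (- a * u)) \<partial>lborel) = (\<integral>\<^sup>+x. ennreal (indicator {0..} x * exp (- a * x)) \<partial>lborel)"
    by (intro nn_integral_cong) (auto split: split_indicator)
  ultimately show ?thesis by simp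
qed

lemma integrable_exp_halfline:
  assumes "e > 0"
  shows "integrable lborel (\<lambda>z::real. indicator {0<..} z * exp (- e * z))"
proof (rule integrableI_bounded)
  have "(\<integral>\<^sup>+z. ennreal (norm (indicator {0<..} z * exp (- e * z))) \<partial>lborel) \<le> (\<integral>\<^sup>+z\<in>{0..}. ennreal (exp (- e * z)) \<partial>lborel)"
    by (intro nn_integral_mono) (auto split: split_indicator)
  also have "\<dots> < \<infinity>" using assms by (subst nn_integral_exp_halfline) auto
  finally show "(\<integral>\<^sup>+z. ennreal (norm (indicator {0<..} z * exp (- e * z))) \<partial>lborel) < \<infinity>" .
qed measurable

lemma norm_exp_minus_one_le:
  fixes z :: complex
  shows "norm (exp z - 1) \<le> norm z * exp (norm z)"
proof -
  have "norm (exp z - exp 0) \<le> exp (norm z) * norm (z - 0)"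
  proof (rule field_differentiable_bound[where S = "cball 0 (norm z)" and f' = exp])
    show "norm (exp w) \<le> exp (norm z)" if "w \<in> cball 0 (norm z)" for w :: complex
      using that abs_Re_le_cmod[of w] by auto
  qed (auto intro!: derivative_eq_intros)
  then show ?thesis by (simp add: mult.commute)
qed

lemma exp_mult_le_add:
  fixes a b c x :: real
  assumes "a \<le> c" "c \<le> b"
  shows "exp (c * x) \<le> exp (a * x) + exp (b * x)"
proof (cases "x \<ge> 0")
  case True
  then have "c * x \<le> b * x" using assms by (intro mult_right_mono) auto
  then have "exp (c * x) \<le> exp (b * x)" by simp
  then show ?thesis by (smt (verit) exp_gt_zero)
next
  case False
  then have "c * x \<le> a * x" using assms by (intro mult_right_mono_neg) auto
  then have "exp (c * x) \<le> exp (a * x)" by simp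
  then show ?thesis by (smt (verit) exp_gt_zero)
qed

lemma integrable_exp_between:
  fixes X :: "'a \<Rightarrow> real"
  assumes [measurable]: "X \<in> borel_measurable N"
    and a: "integrable N (\<lambda>x. exp (a * X x))" and b: "integrable N (\<lambda>x. exp (b * X x))"
    and s: "a \<le> Re s" "Re s \<le> b"
  shows "integrable N (\<lambda>x. exp (s * of_real (X x)))"
proof (rule Bochner_Integration.integrable_bound[OF Bochner_Integration.integrable_add[OF a b]])
  show "AE x in N. norm (exp (s * of_real (X x))) \<le> norm (exp (a * X x) + exp (b * X x))"
  proof (intro AE_I2)
    fix x
    have "norm (exp (s * of_real (X x))) = exp (Re s * X x)" by simp
    also have "\<dots> \<le> exp (a * X x) + exp (b * X x)" by (rule exp_mult_le_add[OF s])
    finally show "norm (exp (s * of_real (X x))) \<le> norm (exp (a * X x) + exp (b * X x))" by simp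
  qed
qed measurable

text \<open>Dominated convergence for the difference quotients. Differentiation costs a factor of
  order |X| * exp (r * |X|), which the two endpoint moments absorb because s lies strictly between a
  and b. The lemma gives holomorphy of \<open>\<phi>1\<close>, \<open>local_transform\<close> and
  \<open>Mellin\<close> alike.\<close>

lemma exp_transform_has_field_derivative:
  fixes X :: "'a \<Rightarrow> real"
  assumes [measurable]: "X \<in> borel_measurable N"
    and a: "integrable N (\<lambda>x. exp (a * X x))" and b: "integrable N (\<lambda>x. exp (b * X x))"
    and s: "a < Re s" "Re s < b"
  shows "integrable N (\<lambda>x. of_real (X x) * exp (s * of_real (X x)))"
    and "((\<lambda>s. \<integral>x. exp (s * of_real (X x)) \<partial>N) has_field_derivative
      (\<integral>x. of_real (X x) * exp (s * of_real (X x)) \<partial>N)) (at s)"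
proof -
  \<comment> \<open>There is room 2 * r on either side of Re s: one r pays for |X| \<le> exp (r *
    |X|) / r, the other for the increment h of s with norm h \<le> r.\<close>
  define r where "r = min (Re s - a) (b - Re s) / 2"
  have r: "r > 0" "a \<le> Re s - 2 * r" "Re s + 2 * r \<le> b" using s by (auto simp: r_def)
  define W where "W x = (exp (a * X x) + exp (b * X x)) / r" for x
  have W: "integrable N W" using a b unfolding W_def by auto
  have key: "\<bar>X x\<bar> * exp (r * \<bar>X x\<bar>) * exp (Re s * X x) \<le> W x" for x
  proof -
    have "r * \<bar>X x\<bar> \<le> exp (r * \<bar>X x\<bar>)" using exp_ge_add_one_self[of "r * \<bar>X x\<bar>"] by linarith
    then have "\<bar>X x\<bar> \<le> exp (r * \<bar>X x\<bar>) / r" using r by (simp add: field_simps)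
    then have "\<bar>X x\<bar> * exp (r * \<bar>X x\<bar>) * exp (Re s * X x) \<le>
        exp (r * \<bar>X x\<bar>) / r * exp (r * \<bar>X x\<bar>) * exp (Re s * X x)"
      by (intro mult_right_mono) auto
    also have "\<dots> = exp (2 * r * \<bar>X x\<bar> + Re s * X x) / r"
      by (simp add: exp_add[symmetric] algebra_simps)
    also have "\<dots> \<le> W x"
    proof (cases "X x \<ge> 0")
      case True
      then have "2 * r * \<bar>X x\<bar> + Re s * X x = (Re s + 2 * r) * X x" by (simp add: algebra_simps)
      then show ?thesis using exp_mult_le_add[of a "Re s + 2 * r" b "X x"] r
        by (simp add: W_def divide_right_mono)
    next
      case False
      then have "2 * r * \<bar>X x\<bar> + Re s * X x = (Re s - 2 * r) * X x" by (simp add: algebra_simps)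
      then show ?thesis using exp_mult_le_add[of a "Re s - 2 * r" b "X x"] r
        by (simp add: W_def divide_right_mono)
    qed
    finally show ?thesis .
  qed
  have W0: "W x \<ge> 0" for x using r by (simp add: W_def add_nonneg_nonneg)
  have bnd0: "norm (of_real (X x) * exp (s * of_real (X x))) \<le> W x" for x
  proof -
    have "\<bar>X x\<bar> * 1 * exp (Re s * X x) \<le> \<bar>X x\<bar> * exp (r * \<bar>X x\<bar>) * exp (Re s * X x)"
      using r by (intro mult_mono) auto
    then show ?thesis using key[of x] by (simp add: norm_mult)
  qed
  show "integrable N (\<lambda>x. of_real (X x) * exp (s * of_real (X x)))"
    by (rule Bochner_Integration.integrable_bound[OF W])
       (use bnd0 W0 in \<open>auto intro!: AE_I2 simp: abs_of_nonneg\<close>)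
  have int: "integrable N (\<lambda>x. exp (z * of_real (X x)))" if "a \<le> Re z" "Re z \<le> b" for z
    by (rule integrable_exp_between[OF _ a b that]) measurable
  show "((\<lambda>s. \<integral>x. exp (s * of_real (X x)) \<partial>N) has_field_derivative
      (\<integral>x. of_real (X x) * exp (s * of_real (X x)) \<partial>N)) (at s)"
    unfolding has_field_derivative_iff tendsto_at_iff_sequentially
  proof (intro allI impI)
    fix Z :: "nat \<Rightarrow> complex"
    assume Z: "\<forall>i. Z i \<in> UNIV - {s}" "Z \<longlonglongrightarrow> s"
    then have "eventually (\<lambda>n. dist (Z n) s < r) sequentially" using r by (simp add: tendstoD)
    then obtain n0 where n0: "\<And>n. n \<ge> n0 \<Longrightarrow> dist (Z n) s < r" by (auto simp: eventually_sequentially)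
    define f where "f n x = (exp (Z (n + n0) * of_real (X x)) - exp (s * of_real (X x))) / (Z (n + n0) - s)" for n x
    have *: "(\<lambda>n. \<integral>x. f n x \<partial>N) \<longlonglongrightarrow> (\<integral>x. of_real (X x) * exp (s * of_real (X x)) \<partial>N)"
    proof (rule integral_dominated_convergence[OF _ _ W])
      show "AE x in N. (\<lambda>n. f n x) \<longlonglongrightarrow> of_real (X x) * exp (s * of_real (X x))"
      proof (intro AE_I2)
        fix x
        have "((\<lambda>z. exp (z * of_real (X x))) has_field_derivative of_real (X x) * exp (s * of_real (X x))) (at s)"
          by (auto intro!: derivative_eq_intros)
        then have "((\<lambda>z. (exp (z * of_real (X x)) - exp (s * of_real (X x))) / (z - s)) \<circ> (\<lambda>n. Z (n + n0)))
            \<longlonglongrightarrow> of_real (X x) * exp (s * of_real (X x))"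
          unfolding has_field_derivative_iff tendsto_at_iff_sequentially
          using Z(1) LIMSEQ_ignore_initial_segment[OF Z(2), of n0]
          by (elim allE[of _ "\<lambda>n. Z (n + n0)"]) simp
        then show "(\<lambda>n. f n x) \<longlonglongrightarrow> of_real (X x) * exp (s * of_real (X x))"
          by (simp add: f_def o_def)
      qed
      show "AE x in N. norm (f n x) \<le> W x" for n
      proof (intro AE_I2)
        fix x
        define h where "h = Z (n + n0) - s"
        have h: "h \<noteq> 0" "norm h \<le> r" using Z n0[of "n + n0"] by (auto simp: h_def dist_norm)
        have "exp (Z (n + n0) * of_real (X x)) = exp (s * of_real (X x) + h * of_real (X x))"
          by (simp add: h_def algebra_simps)
        then have "f n x = exp (s * of_real (X x)) * (exp (h * of_real (X x)) - 1) / h"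
          by (simp add: f_def h_def exp_add right_diff_distrib)
        then have "norm (f n x) = exp (Re s * X x) * norm (exp (h * of_real (X x)) - 1) / norm h"
          by (simp add: norm_mult norm_divide)
        also have "\<dots> \<le> exp (Re s * X x) * (norm (h * of_real (X x)) * exp (norm (h * of_real (X x)))) / norm h"
          by (intro divide_right_mono mult_left_mono norm_exp_minus_one_le) auto
        also have "\<dots> = exp (Re s * X x) * (\<bar>X x\<bar> * exp (norm h * \<bar>X x\<bar>))"
          using h by (simp add: norm_mult)
        also have "\<dots> \<le> exp (Re s * X x) * (\<bar>X x\<bar> * exp (r * \<bar>X x\<bar>))"
          using h by (intro mult_left_mono) (auto intro!: mult_right_mono)
        also have "\<dots> \<le> W x" using key[of x] by (simp add: mult_ac)
        finally show "norm (f n x) \<le> W x" .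
      qed
    qed (unfold f_def, measurable)
    have "(\<integral>x. f n x \<partial>N) = ((\<integral>x. exp (Z (n + n0) * of_real (X x)) \<partial>N) - (\<integral>x. exp (s * of_real (X x)) \<partial>N)) / (Z (n + n0) - s)" for n
    proof -
      have "\<bar>Re (Z (n + n0)) - Re s\<bar> < r"
        using n0[of "n + n0"] abs_Re_le_cmod[of "Z (n + n0) - s"] by (auto simp: dist_norm)
      then show ?thesis unfolding f_def using r s by (subst Bochner_Integration.integral_diff[symmetric]) (auto intro!: int)
    qed
    then have "(\<lambda>n. ((\<integral>x. exp (Z (n + n0) * of_real (X x)) \<partial>N) - (\<integral>x. exp (s * of_real (X x)) \<partial>N)) / (Z (n + n0) - s))
      \<longlonglongrightarrow> (\<integral>x. of_real (X x) * exp (s * of_real (X x)) \<partial>N)" using * by simp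
    then show "((\<lambda>z. ((\<integral>x. exp (z * of_real (X x)) \<partial>N) - (\<integral>x. exp (s * of_real (X x)) \<partial>N)) / (z - s)) \<circ> Z)
      \<longlonglongrightarrow> (\<integral>x. of_real (X x) * exp (s * of_real (X x)) \<partial>N)"
      unfolding o_def by (rule LIMSEQ_offset)
  qed
qed

lemma integrable_pair_bound:
  fixes F :: "'a \<times> 'b \<Rightarrow> 'c::{banach, second_countable_topology}"
  assumes "sigma_finite_measure N2"
    and F[measurable]: "F \<in> borel_measurable (N1 \<Otimes>\<^sub>M N2)"
    and a: "integrable N1 a" and b: "integrable N2 b"
    and nonneg: "\<And>x. a x \<ge> (0::real)" "\<And>y. b y \<ge> (0::real)"
    and bound: "\<And>x y. norm (F (x, y)) \<le> a x * b y"
  shows "integrable (N1 \<Otimes>\<^sub>M N2) F"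
proof (rule integrableI_bounded[OF F])
  interpret sigma_finite_measure N2 by fact
  have [measurable]: "a \<in> borel_measurable N1" "b \<in> borel_measurable N2" using a b by auto
  have "(\<integral>\<^sup>+x. ennreal (norm (F x)) \<partial>(N1 \<Otimes>\<^sub>M N2)) = (\<integral>\<^sup>+x. \<integral>\<^sup>+y. ennreal (norm (F (x, y))) \<partial>N2 \<partial>N1)"
    by (subst nn_integral_fst[symmetric]) auto
  also have "\<dots> \<le> (\<integral>\<^sup>+x. \<integral>\<^sup>+y. ennreal (a x) * ennreal (b y) \<partial>N2 \<partial>N1)"
    using bound nonneg by (intro nn_integral_mono) (auto simp: ennreal_mult[symmetric] intro!: ennreal_leI)
  also have "\<dots> = (\<integral>\<^sup>+x. ennreal (a x) \<partial>N1) * (\<integral>\<^sup>+y. ennreal (b y) \<partial>N2)"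
    by (simp add: nn_integral_cmult nn_integral_multc)
  also have "\<dots> < \<infinity>"
    using a b nonneg by (simp add: nn_integral_eq_integral ennreal_mult_less_top)
  finally show "(\<integral>\<^sup>+x. ennreal (norm (F x)) \<partial>(N1 \<Otimes>\<^sub>M N2)) < \<infinity>" .
qed

text \<open>Translating by half a period changes the sign of the exponential.\<close>

lemma Riemann_Lebesgue_continuous:
  fixes f :: "real \<Rightarrow> complex"
  assumes cont: "continuous_on UNIV f" and supp: "\<And>t. t \<notin> {-c..c} \<Longrightarrow> f t = 0"
  shows "((\<lambda>y. LBINT t. f t * exp (- (\<i> * of_real (t * y)))) \<longlongrightarrow> 0) at_top"
proof -
  have [measurable]: "f \<in> borel_measurable borel" using cont by (rule borel_measurable_continuous_onI)
  have "bounded (f ` {-c..c})"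
    using cont by (intro compact_imp_bounded compact_continuous_image) (auto intro: continuous_on_subset)
  then obtain B where B: "\<And>t. t \<in> {-c..c} \<Longrightarrow> norm (f t) \<le> B" unfolding bounded_iff by blast
  define B' where "B' = max B 0"
  have bnd: "norm (f t) \<le> B' * indicator {-c..c} t" for t
    using B[of t] supp[of t] by (auto simp: B'_def indicator_def)
  have bnd': "norm (f t) \<le> B'" for t
    using B[of t] supp[of t] by (cases "t \<in> {-c..c}") (auto simp: B'_def)
  have icc0: "integrable lborel (indicator {-c..c} :: real \<Rightarrow> real)" for c :: real
    by (intro integrable_real_indicator) (auto simp: emeasure_lborel_Icc_eq)
  define e where "e y t = exp (- (\<i> * of_real (t * y)))" for y t :: real
  have [measurable]: "e y \<in> borel_measurable borel" for y unfolding e_def by measurable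
  have ne: "norm (e y t) = 1" for y t by (simp add: e_def)
  have fi: "integrable lborel (\<lambda>t. f t * e y t)" for y
    by (rule Bochner_Integration.integrable_bound[OF integrable_mult_right[OF icc0[of c]], of _ B'])
      (use bnd in \<open>auto simp: norm_mult ne B'_def intro!: AE_I2\<close>)
  have fi2: "integrable lborel (\<lambda>t. f (d + t) * e y t)" for y d
  proof -
    have "integrable lborel (\<lambda>t. f (d + 1 * t) * e y (d + 1 * t))"
      using fi by (subst lborel_integrable_real_affine_iff[where c = 1]) auto
    then have "integrable lborel (\<lambda>t. (f (d + t) * e y (d + t)) * exp (\<i> * of_real (d * y)))"
      by (intro integrable_mult_left) simp
    then show ?thesis by (simp add: e_def exp_add[symmetric] exp_minus algebra_simps)
  qed
  have eq: "2 * (LBINT t. f t * e y t) = (LBINT t. (f t - f (pi / y + t)) * e y t)" if "y > 0" for y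
  proof -
    have sh: "e y (pi / y + t) = - e y t" for t
    proof -
      have "- (\<i> * of_real ((pi / y + t) * y)) = - (\<i> * of_real (t * y)) - \<i> * of_real pi"
        using that by (simp add: field_simps)
      then show ?thesis unfolding e_def by (simp only: exp_diff exp_pi_i') simp
    qed
    have "(LBINT t. f t * e y t) = (LBINT t. f (pi / y + t) * e y (pi / y + t))"
      using lborel_integral_real_affine[of 1 "\<lambda>t. f t * e y t" "pi / y"] by simp
    then have *: "(LBINT t. f t * e y t) = - (LBINT t. f (pi / y + t) * e y t)" by (simp add: sh)
    have "(LBINT t. (f t - f (pi / y + t)) * e y t) = (LBINT t. f t * e y t) - (LBINT t. f (pi / y + t) * e y t)"
      by (subst Bochner_Integration.integral_diff[symmetric, OF fi fi2]) (simp add: algebra_simps)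
    then show ?thesis using * by simp
  qed
  \<comment> \<open>The dominating function lives on an interval wider by 1, since the translate of
    \<open>f\<close> by \<open>pi / y\<close> leaves {-c..c} but moves by less than 1 once y is
    large.\<close>
  have lim: "((\<lambda>y. LBINT t. (f t - f (pi / y + t)) * e y t) \<longlongrightarrow> (\<integral>(t::real). (0::complex) \<partial>lborel)) at_top"
  proof (rule integral_dominated_convergence_at_top[where w = "\<lambda>t. (2 * B') * indicator {-(c+1)..c+1} t"])
    show "integrable lborel (\<lambda>t. (2 * B') * indicator {-(c+1)..c+1} t)"
      by (intro integrable_mult_right icc0)
    have pl: "((\<lambda>y. pi / y) \<longlongrightarrow> 0) at_top" by real_asymp
    show "AE t in lborel. ((\<lambda>y. (f t - f (pi / y + t)) * e y t) \<longlongrightarrow> 0) at_top"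
    proof (intro AE_I2)
      fix t
      have "((\<lambda>y. f t - f (pi / y + t)) \<longlongrightarrow> f t - f (0 + t)) at_top"
        by (intro tendsto_intros isCont_tendsto_compose[of _ f] pl) (use cont in \<open>auto simp: continuous_on_eq_continuous_at\<close>)
      then show "((\<lambda>y. (f t - f (pi / y + t)) * e y t) \<longlongrightarrow> 0) at_top"
        by (subst tendsto_norm_zero_iff[symmetric]) (simp add: norm_mult ne tendsto_norm_zero)
    qed
    have "eventually (\<lambda>y. \<bar>pi / y\<bar> < 1) at_top"
      using tendstoD[OF pl, of 1] by simp
    then show "\<forall>\<^sub>F y in at_top. AE t in lborel. norm ((f t - f (pi / y + t)) * e y t) \<le> (2 * B') * indicator {-(c+1)..c+1} t"
    proof eventually_elim
      case (elim y)
      show ?case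
      proof (intro AE_I2)
        fix t
        have "norm (f t) \<le> B' * indicator {-(c+1)..c+1} t"
          using bnd'[of t] supp[of t] by (auto simp: indicator_def)
        moreover have "norm (f (pi / y + t)) \<le> B' * indicator {-(c+1)..c+1} t"
        proof (cases "t \<in> {-(c+1)..c+1}")
          case False
          moreover have "- 1 < pi / y \<and> pi / y < 1" using elim unfolding abs_less_iff by linarith
          ultimately have "pi / y + t \<notin> {-c..c}" by auto
          then show ?thesis using supp False by simp
        qed (use bnd'[of "pi / y + t"] in simp)
        ultimately show "norm ((f t - f (pi / y + t)) * e y t) \<le> (2 * B') * indicator {-(c+1)..c+1} t"
          using norm_triangle_ineq4[of "f t" "f (pi / y + t)"] by (simp add: norm_mult ne)
      qed
    qed
  qed measurable
  then have "((\<lambda>y. (LBINT t. (f t - f (pi / y + t)) * e y t) / 2) \<longlongrightarrow> 0 / 2) at_top"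
    by (intro tendsto_divide) auto
  moreover have "\<forall>\<^sub>F y in at_top. (LBINT t. (f t - f (pi / y + t)) * e y t) / 2 = (LBINT t. f t * e y t)"
    using eventually_gt_at_top[of 0] by eventually_elim (simp flip: eq)
  ultimately have "((\<lambda>y. LBINT t. f t * e y t) \<longlongrightarrow> 0 / 2) at_top"
    by (rule Lim_transform_eventually)
  then show ?thesis by (simp add: e_def)
qed

section \<open>The Fejer kernel\<close>

text \<open>The Fourier side of the Fejer kernel. Its compact support confines the boundary values
  of \<open>D\<close> to a bounded segment of the critical line, where continuity supplies both
  boundedness and the Riemann-Lebesgue lemma.\<close>

definition triangle :: "real \<Rightarrow> real" where
  "triangle t = max 0 (1 - \<bar>t\<bar>)"

text \<open>The value of the kernel at \<open>0\<close> is the junk value \<open>0\<close>; it only matters up to null sets.\<close>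

definition fejer :: "real \<Rightarrow> real" where
  "fejer x = 2 * (1 - cos x) / x\<^sup>2"

lemma measurable_triangle [measurable]: "triangle \<in> borel_measurable borel"
  unfolding triangle_def by measurable

lemma measurable_fejer [measurable]: "fejer \<in> borel_measurable borel"
  unfolding fejer_def by measurable

lemma continuous_on_triangle [continuous_intros]:
  "continuous_on A f \<Longrightarrow> continuous_on A (\<lambda>x. triangle (f x))"
  unfolding triangle_def by (intro continuous_intros)

lemma triangle_bounds: "0 \<le> triangle t" "triangle t \<le> indicator {-1..1} t"
  by (auto simp: triangle_def indicator_def)

lemma integrable_triangle: "integrable lborel triangle"
proof (rule Bochner_Integration.integrable_bound)
  show "integrable lborel (indicator {-1..1} :: real \<Rightarrow> real)"
    by (intro integrable_real_indicator) auto
qed (use triangle_bounds in \<open>auto intro!: AE_I2\<close>)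

lemma fejer_bounds: "0 \<le> fejer x" "fejer x \<le> 1" "fejer x \<le> 8 * inverse (1 + x\<^sup>2)"
proof -
  show "0 \<le> fejer x" by (simp add: fejer_def)
  have "1 - cos x \<le> x\<^sup>2 / 2"
  proof -
    have "1 - cos x = 2 * (sin (x / 2))\<^sup>2" using cos_double_sin[of "x / 2"] by simp
    moreover have "(sin (x / 2))\<^sup>2 \<le> (x / 2)\<^sup>2"
      using abs_sin_x_le_abs_x[of "x / 2"] by (subst abs_le_square_iff[symmetric])
    ultimately show ?thesis by (simp add: power_divide)
  qed
  then show 1: "fejer x \<le> 1" by (cases "x = 0") (auto simp: fejer_def field_simps)
  show "fejer x \<le> 8 * inverse (1 + x\<^sup>2)"
  proof (cases "\<bar>x\<bar> \<le> 1")
    case True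
    then have "1 + x\<^sup>2 \<le> 2" by (simp add: abs_square_le_1)
    then have "1 \<le> 8 * inverse (1 + x\<^sup>2)" by (simp add: field_simps add_pos_nonneg)
    then show ?thesis using 1 by linarith
  next
    case False
    then have x: "x\<^sup>2 > 1" by (simp add: abs_square_le_1 not_le[symmetric])
    have "2 * (1 - u) \<le> 4" if "-1 \<le> u" for u :: real using that by simp
    from this[OF cos_ge_minus_one, of x]
    have "fejer x \<le> 4 / x\<^sup>2" unfolding fejer_def by (rule divide_right_mono) simp
    also have "\<dots> \<le> 8 * inverse (1 + x\<^sup>2)" using x by (simp add: divide_simps add_pos_pos)
    finally show ?thesis .
  qed
qed

lemma integrable_fejer: "integrable lborel fejer"
proof (rule Bochner_Integration.integrable_bound)
  show "integrable lborel (\<lambda>x::real. 8 * inverse (1 + x\<^sup>2))"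
    using integrable_inverse_1_plus_square by (simp add: set_integrable_def)
qed (use fejer_bounds in \<open>auto intro!: AE_I2\<close>)

lemma fejer_pos: "0 < \<bar>x\<bar> \<Longrightarrow> \<bar>x\<bar> \<le> 1 \<Longrightarrow> fejer x > 0"
proof -
  assume x: "0 < \<bar>x\<bar>" "\<bar>x\<bar> \<le> 1"
  have "cos 0 > cos \<bar>x\<bar>" using x pi_gt3 by (intro cos_monotone_0_pi) auto
  then show ?thesis using x by (simp add: fejer_def)
qed

text \<open>Integration by parts on each side of 0, recorded as the explicit antiderivatives
  \<open>F1\<close> and \<open>F2\<close>. With c = i * x the terms in 1 / c cancel and the boundary
  values add up to (exp c + exp (- c) - 2) / c^2.\<close>

lemma fejer_eq_fourier_triangle:
  assumes x: "x \<noteq> 0"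
  shows "(LBINT t. of_real (triangle t) * exp (\<i> * of_real (t * x))) = complex_of_real (fejer x)"
proof -
  define c where "c = \<i> * complex_of_real x"
  have c: "c \<noteq> 0" using x by (simp add: c_def)
  define f1 where "f1 z = (1 + z) * exp (c * z)" for z
  define f2 where "f2 z = (1 - z) * exp (c * z)" for z
  define F1 where "F1 z = (1 + z) * exp (c * z) * inverse c - exp (c * z) * inverse (c\<^sup>2)" for z
  define F2 where "F2 z = (1 - z) * exp (c * z) * inverse c + exp (c * z) * inverse (c\<^sup>2)" for z
  have "(F1 has_field_derivative f1 z) (at z)" for z
    unfolding F1_def f1_def
    using c by (auto intro!: derivative_eq_intros simp: field_simps power2_eq_square)
  then have "((\<lambda>t. F1 (of_real t)) has_vector_derivative f1 (of_real t)) (at t within A)" for t A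
    by (intro has_vector_derivative_real_field has_vector_derivative_at_within) auto
  then have I1: "has_bochner_integral lborel (\<lambda>t. indicator {-1..0} t *\<^sub>R f1 (of_real t)) (F1 (of_real 0) - F1 (of_real (-1)))"
    by (intro has_bochner_integral_FTC_Icc) (auto simp: f1_def intro!: continuous_intros)
  have "(F2 has_field_derivative f2 z) (at z)" for z
    unfolding F2_def f2_def
    using c by (auto intro!: derivative_eq_intros simp: field_simps power2_eq_square)
  then have "((\<lambda>t. F2 (of_real t)) has_vector_derivative f2 (of_real t)) (at t within A)" for t A
    by (intro has_vector_derivative_real_field has_vector_derivative_at_within) auto
  then have I2: "has_bochner_integral lborel (\<lambda>t. indicator {0..1} t *\<^sub>R f2 (of_real t)) (F2 (of_real 1) - F2 (of_real 0))"
    by (intro has_bochner_integral_FTC_Icc) (auto simp: f2_def intro!: continuous_intros)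
  have "(LBINT t. of_real (triangle t) * exp (\<i> * of_real (t * x))) =
      (LBINT t. indicator {-1..0} t *\<^sub>R f1 (of_real t) + indicator {0..1} t *\<^sub>R f2 (of_real t))"
  proof (rule integral_cong_AE)
    show "AE t in lborel. of_real (triangle t) * exp (\<i> * of_real (t * x)) =
        indicator {-1..0} t *\<^sub>R f1 (of_real t) + indicator {0..1} t *\<^sub>R f2 (of_real t)"
      using AE_lborel_singleton[of 0]
      by eventually_elim (auto simp: triangle_def f1_def f2_def c_def indicator_def max_def mult_ac)
  qed (unfold f1_def f2_def, measurable)
  also have "\<dots> = (F1 (of_real 0) - F1 (of_real (-1))) + (F2 (of_real 1) - F2 (of_real 0))"
    by (intro has_bochner_integral_integral_eq has_bochner_integral_add I1 I2)
  also have "\<dots> = (exp c + exp (- c) - 2) / c\<^sup>2"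
    using c by (simp add: F1_def F2_def field_simps)
  also have "exp c + exp (- c) = 2 * of_real (cos x)"
    by (simp add: c_def cos_of_real[symmetric] cos_exp_eq)
  also have "(2 * of_real (cos x) - 2) / c\<^sup>2 = of_real (fejer x)"
    using x by (simp add: c_def fejer_def power_mult_distrib field_simps)
  finally show ?thesis .
qed

section \<open>A Wiener-Ikehara theorem\<close>

text \<open>Serves to remove the damping factor in \<open>integrable_smoothing\<close>, where only
  the damped integrals are known to be finite.\<close>

lemma Fatou_integrable:
  fixes f :: "nat \<Rightarrow> 'a \<Rightarrow> real"
  assumes [measurable]: "g \<in> borel_measurable N"
    and f: "\<And>n. integrable N (f n)" and nn: "\<And>n x. f n x \<ge> 0" "\<And>x. g x \<ge> 0"
    and lim: "\<And>x. (\<lambda>n. f n x) \<longlonglongrightarrow> g x"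
    and bd: "\<And>n. (\<integral>x. f n x \<partial>N) \<le> B"
  shows "integrable N g"
proof (rule integrableI_bounded)
  have "(\<integral>\<^sup>+x. ennreal (norm (g x)) \<partial>N) = (\<integral>\<^sup>+x. liminf (\<lambda>n. ennreal (f n x)) \<partial>N)"
    using nn by (intro nn_integral_cong lim_imp_Liminf[symmetric]) (auto intro!: tendsto_ennrealI lim)
  also have "\<dots> \<le> liminf (\<lambda>n. \<integral>\<^sup>+x. ennreal (f n x) \<partial>N)"
    using f by (intro nn_integral_liminf) auto
  also have "\<dots> \<le> liminf (\<lambda>n::nat. ennreal B)"
    using f nn bd by (intro Liminf_mono always_eventually allI) (simp add: nn_integral_eq_integral ennreal_leI)
  also have "\<dots> < \<infinity>" by (simp add: Liminf_const)
  finally show "(\<integral>\<^sup>+x. ennreal (norm (g x)) \<partial>N) < \<infinity>" .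
qed simp

text \<open>\<open>D\<close> is the two-sided Laplace transform of \<open>g\<close> after the pole C
  / s at 0 has been subtracted, and it extends continuously to Re s = 0. The bound \<open>e0\<close>
  controls \<open>g\<close> near minus infinity, where exp (- e * z) grows. The Tauberian condition
  \<open>slow\<close> says that exp (- \<theta> * x) * g x is nonincreasing.\<close>

locale wiener_ikehara =
  fixes g :: "real \<Rightarrow> real" and D :: "complex \<Rightarrow> complex" and C \<theta> e0 :: real
  assumes measurable_g [measurable]: "g \<in> borel_measurable borel"
    and nonneg: "g x \<ge> 0"
    and pos: "C > 0" "e0 > 0" "\<theta> > 0"
    and slow: "h \<ge> 0 \<Longrightarrow> g (x + h) \<le> exp (\<theta> * h) * g x"
    and integrable_laplace: "0 < e \<Longrightarrow> e < e0 \<Longrightarrow> integrable lborel (\<lambda>z. g z * exp (- e * z))"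
    and laplace: "0 < Re s \<Longrightarrow> Re s < e0 \<Longrightarrow>
      (LBINT z. of_real (g z - C * indicator {0<..} z) * exp (- s * of_real z)) = D s"
    and continuous_boundary: "continuous_on {s. 0 \<le> Re s \<and> Re s < e0} D"
begin

text \<open>The frequency u is carried through the smoothing so that its limit yields whole
  characteristic functions; u = 0 alone would give only total masses.\<close>

abbreviation osc :: "real \<Rightarrow> real \<Rightarrow> complex" where
  "osc u x \<equiv> exp (\<i> * of_real (u * x))"

abbreviation kern :: "real \<Rightarrow> real \<Rightarrow> real \<Rightarrow> complex" where
  "kern u y t \<equiv> of_real (triangle t) * exp (- (\<i> * of_real ((t + u) * y)))"

definition w :: "real \<Rightarrow> real" where "w z = g z - C * indicator {0<..} z"

lemma measurable_w [measurable]: "w \<in> borel_measurable borel"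
  unfolding w_def by measurable

lemma abs_w: "\<bar>w z\<bar> \<le> g z + C * indicator {0<..} z"
  using nonneg[of z] pos by (auto simp: w_def indicator_def)

lemma integrable_w_exp:
  assumes "0 < e" "e < e0"
  shows "integrable lborel (\<lambda>z. (g z + C * indicator {0<..} z) * exp (- e * z))"
  using Bochner_Integration.integrable_add[OF integrable_laplace[OF assms] integrable_mult_right[OF integrable_exp_halfline[OF assms(1)], of C]]
  by (simp add: algebra_simps)

text \<open>A Parseval identity: the Fejer kernel is replaced by its Fourier integral and the order
  of integration exchanged. The damping exp (- e * z) makes the double integral absolutely
  convergent, and the inner integral becomes \<open>D\<close> at the point e - i * (t + u).\<close>

lemma damped_smoothing:
  assumes e: "0 < e" "e < e0"
  shows "(LBINT z. of_real (w z * exp (- e * z) * fejer (z - y)) * osc u (z - y)) =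
    (LBINT t. kern u y t * D (of_real e - \<i> * of_real (t + u)))"
proof -
  define F where "F z t = of_real (w z * exp (- e * z)) * (of_real (triangle t) * exp (\<i> * of_real ((t + u) * (z - y))))" for z t
  \<comment> \<open>At z = y the kernel has the value 0, which is not the integral of
    \<open>triangle\<close>; the identity holds off this null set.\<close>
  have ae: "AE z in lborel. of_real (w z * exp (- e * z) * fejer (z - y)) * osc u (z - y) = (LBINT t. F z t)"
    using AE_lborel_singleton[of y]
  proof eventually_elim
    case (elim z)
    then have zy: "z - y \<noteq> 0" by simp
    have "(LBINT t. F z t) = (LBINT t. of_real (w z * exp (- e * z)) * osc u (z - y) *
        (of_real (triangle t) * exp (\<i> * of_real (t * (z - y)))))"
      by (intro Bochner_Integration.integral_cong)
         (auto simp: F_def exp_add[symmetric] algebra_simps)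
    also have "\<dots> = of_real (w z * exp (- e * z)) * osc u (z - y) * of_real (fejer (z - y))"
      by (simp only: integral_mult_right_zero fejer_eq_fourier_triangle[OF zy])
    finally show ?case by (simp add: mult_ac)
  qed
  have [measurable]: "case_prod F \<in> borel_measurable (lborel \<Otimes>\<^sub>M lborel)" unfolding F_def by measurable
  have int: "integrable (lborel \<Otimes>\<^sub>M lborel) (case_prod F)"
  proof (rule integrable_pair_bound[OF _ _ integrable_w_exp[OF e] integrable_triangle])
    show "norm (case_prod F (z, t)) \<le> (g z + C * indicator {0<..} z) * exp (- e * z) * triangle t" for z t
      using abs_w[of z] triangle_bounds(1)[of t] by (simp add: F_def norm_mult abs_mult mult_right_mono)
  qed (use nonneg pos triangle_bounds in \<open>auto intro!: mult_nonneg_nonneg add_nonneg_nonneg simp: lborel.sigma_finite_measure_axioms\<close>)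
  have "(LBINT z. of_real (w z * exp (- e * z) * fejer (z - y)) * osc u (z - y)) = (LBINT z. LBINT t. F z t)"
  proof (rule integral_cong_AE[OF _ _ ae])
    show "(\<lambda>z. LBINT t. F z t) \<in> borel_measurable lborel" by measurable
  qed measurable
  also have "\<dots> = (LBINT t. LBINT z. F z t)"
    using lborel_pair.Fubini_integral[OF int] by simp
  also have "\<dots> = (LBINT t. kern u y t * D (of_real e - \<i> * of_real (t + u)))"
  proof (intro Bochner_Integration.integral_cong refl)
    fix t
    have "(LBINT z. F z t) = (LBINT z. kern u y t *
       (of_real (w z) * exp (- (of_real e - \<i> * of_real (t + u)) * of_real z)))"
      by (intro Bochner_Integration.integral_cong)
         (auto simp: F_def exp_add[symmetric] exp_of_real[symmetric] algebra_simps)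
    also have "\<dots> = kern u y t * D (of_real e - \<i> * of_real (t + u))"
      using laplace[of "of_real e - \<i> * of_real (t + u)"] e
      by (subst integral_mult_right_zero) (simp add: w_def)
    finally show "(LBINT z. F z t) = kern u y t * D (of_real e - \<i> * of_real (t + u))" .
  qed
  finally show ?thesis .
qed

text \<open>The summand 2 keeps the sequence in the interval from 0 to e0 / 2, so that all damped
  arguments stay in one compact rectangle on which \<open>D\<close> is bounded.\<close>

definition eps :: "nat \<Rightarrow> real" where "eps n = e0 / real (n + 2)"

lemma eps: "0 < eps n" "eps n < e0" "eps n \<le> e0 / 2" "eps \<longlonglongrightarrow> 0"
proof -
  show "0 < eps n" "eps n < e0" "eps n \<le> e0 / 2" using pos by (auto simp: eps_def field_simps add_pos_nonneg)
  show "eps \<longlonglongrightarrow> 0" unfolding eps_def using pos by real_asymp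
qed

lemma bounded_strip:
  obtains B where "\<And>e t. 0 \<le> e \<Longrightarrow> e \<le> e0 / 2 \<Longrightarrow> \<bar>t\<bar> \<le> T \<Longrightarrow> norm (D (of_real e - \<i> * of_real t)) \<le> B"
proof -
  define K where "K = cbox (Complex 0 (- T)) (Complex (e0 / 2) T)"
  have "K \<subseteq> {s. 0 \<le> Re s \<and> Re s < e0}" using pos by (auto simp: K_def in_cbox_complex_iff)
  then have "bounded (D ` K)"
    by (intro compact_imp_bounded compact_continuous_image continuous_on_subset[OF continuous_boundary])
       (auto simp: K_def)
  then obtain B where B: "\<And>s. s \<in> K \<Longrightarrow> norm (D s) \<le> B" unfolding bounded_iff by blast
  have "norm (D (of_real e - \<i> * of_real t)) \<le> B" if "0 \<le> e" "e \<le> e0 / 2" "\<bar>t\<bar> \<le> T" for e t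
    using that by (intro B) (auto simp: K_def in_cbox_complex_iff)
  then show thesis by (rule that)
qed

text \<open>Dominated convergence as the vertical line moves to the boundary. Since
  \<open>triangle\<close> vanishes outside [-1, 1], only heights up to 1 + |u| occur, and
  \<open>bounded_strip\<close> bounds \<open>D\<close> there.\<close>

lemma boundary_kernel_tendsto:
  "(\<lambda>n. LBINT t. kern u y t * D (of_real (eps n) - \<i> * of_real (t + u)))
    \<longlonglongrightarrow> (LBINT t. kern u y t * D (- (\<i> * of_real (t + u))))"
proof -
  obtain B where B: "\<And>e t. 0 \<le> e \<Longrightarrow> e \<le> e0 / 2 \<Longrightarrow> \<bar>t\<bar> \<le> 1 + \<bar>u\<bar> \<Longrightarrow> norm (D (of_real e - \<i> * of_real t)) \<le> B"
    using bounded_strip[of "1 + \<bar>u\<bar>"] by blast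
  have contD: "continuous_on UNIV (\<lambda>t::real. D (of_real e - \<i> * of_real (t + u)))" if "0 \<le> e" "e < e0" for e
    by (rule continuous_on_compose2[OF continuous_boundary]) (use that in \<open>auto intro!: continuous_intros\<close>)
  have mD: "(\<lambda>t::real. D (of_real e - \<i> * of_real (t + u))) \<in> borel_measurable borel" if "0 \<le> e" "e < e0" for e
    using contD[OF that] by (rule borel_measurable_continuous_onI)
  have [measurable]: "(\<lambda>t::real. D (of_real (eps n) - \<i> * of_real (t + u))) \<in> borel_measurable borel" for n
    by (rule mD) (simp_all add: eps less_imp_le)
  have [measurable]: "(\<lambda>t::real. D (- (\<i> * of_real (t + u)))) \<in> borel_measurable borel"
    using mD[of 0] pos by simp
  show ?thesis
  proof (rule integral_dominated_convergence[where w = "\<lambda>t. B * triangle t"])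
    show "integrable lborel (\<lambda>t. B * triangle t)" by (intro integrable_mult_right integrable_triangle)
    show "AE t in lborel. norm (kern u y t * D (of_real (eps n) - \<i> * of_real (t + u))) \<le> B * triangle t" for n
    proof (intro AE_I2)
      fix t
      show "norm (kern u y t * D (of_real (eps n) - \<i> * of_real (t + u))) \<le> B * triangle t"
      proof (cases "\<bar>t\<bar> \<le> 1")
        case True
        then have "norm (D (of_real (eps n) - \<i> * of_real (t + u))) \<le> B" using eps(1-3)[of n] by (intro B) auto
        then have "triangle t * norm (D (of_real (eps n) - \<i> * of_real (t + u))) \<le> triangle t * B"
          by (intro mult_left_mono triangle_bounds)
        then show ?thesis using triangle_bounds(1)[of t] by (simp add: norm_mult mult_ac)
      qed (simp add: triangle_def)
    qed
    show "AE t in lborel. (\<lambda>n. kern u y t * D (of_real (eps n) - \<i> * of_real (t + u)))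
       \<longlonglongrightarrow> kern u y t * D (- (\<i> * of_real (t + u)))"
    proof (intro AE_I2 tendsto_mult tendsto_const)
      fix t
      have "(\<lambda>n. of_real (eps n) - \<i> * of_real (t + u)) \<longlonglongrightarrow> of_real 0 - \<i> * of_real (t + u)"
        by (intro tendsto_intros eps)
      then have "(\<lambda>n. of_real (eps n) - \<i> * of_real (t + u)) \<longlonglongrightarrow> - (\<i> * of_real (t + u))" by simp
      then show "(\<lambda>n. D (of_real (eps n) - \<i> * of_real (t + u))) \<longlonglongrightarrow> D (- (\<i> * of_real (t + u)))"
        by (rule continuous_on_tendsto_compose[OF continuous_boundary]) (use eps pos in \<open>auto simp: less_imp_le\<close>)
    qed
  qed measurable
qed

lemma integrable_shifted_fejer: "integrable lborel (\<lambda>z. fejer (z - y))"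
  using integrable_fejer lborel_integrable_real_affine_iff[of 1 fejer "- y"] by simp

lemma shifted_fejer_integral: "(LBINT z. fejer (z - y)) = (LBINT z. fejer z)"
  using lborel_integral_real_affine[of 1 fejer "- y"] by simp

lemma integrable_damped:
  assumes "0 < e" "e < e0"
  shows "integrable lborel (\<lambda>z. g z * exp (- e * z) * fejer (z - y))"
    "integrable lborel (\<lambda>z. C * indicator {0<..} z * exp (- e * z) * fejer (z - y))"
proof -
  show "integrable lborel (\<lambda>z. g z * exp (- e * z) * fejer (z - y))"
  proof (rule Bochner_Integration.integrable_bound[OF integrable_laplace[OF assms]])
    show "AE z in lborel. norm (g z * exp (- e * z) * fejer (z - y)) \<le> norm (g z * exp (- e * z))"
      using nonneg fejer_bounds by (auto intro!: AE_I2 mult_left_le simp: abs_mult)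
  qed measurable
  show "integrable lborel (\<lambda>z. C * indicator {0<..} z * exp (- e * z) * fejer (z - y))"
  proof (rule Bochner_Integration.integrable_bound[OF integrable_mult_right[OF integrable_exp_halfline[OF assms(1)], of C]])
    show "AE z in lborel. norm (C * indicator {0<..} z * exp (- e * z) * fejer (z - y)) \<le> norm (C * (indicator {0<..} z * exp (- e * z)))"
      using pos fejer_bounds by (auto intro!: AE_I2 mult_left_le simp: abs_mult indicator_def)
  qed measurable
qed

text \<open>The damped integrals of \<open>w\<close> converge by the boundary limit with u = 0,
  hence are bounded; adding back the constant part, which is at most C times the mass of the kernel,
  bounds the damped integrals of the nonnegative function \<open>g\<close>. Fatou's lemma then
  removes the damping.\<close>

lemma integrable_smoothing: "integrable lborel (\<lambda>z. g z * fejer (z - y))"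
proof -
  define S where "S n = (LBINT z. w z * exp (- eps n * z) * fejer (z - y))" for n
  have "complex_of_real (S n) = (LBINT t. of_real (triangle t) * exp (- (\<i> * of_real ((t + 0) * y))) * D (of_real (eps n) - \<i> * of_real (t + 0)))" for n
    using damped_smoothing[OF eps(1,2)[of n], of y 0] by (simp add: S_def del: of_real_mult of_real_add)
  then have "convergent (\<lambda>n. complex_of_real (S n))"
    using boundary_kernel_tendsto[of 0 y] by (auto simp: convergent_def)
  then obtain B where B: "\<And>n. norm (complex_of_real (S n)) \<le> B"
    using convergent_imp_Bseq[THEN BseqD] by blast
  show ?thesis
  proof (rule Fatou_integrable[where f = "\<lambda>n z. g z * exp (- eps n * z) * fejer (z - y)" and B = "B + C * (LBINT z. fejer z)"])
    show "integrable lborel (\<lambda>z. g z * exp (- eps n * z) * fejer (z - y))" for n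
      by (rule integrable_damped[OF eps(1,2)])
    show "(\<lambda>n. g z * exp (- eps n * z) * fejer (z - y)) \<longlonglongrightarrow> g z * fejer (z - y)" for z
    proof -
      have "(\<lambda>n. g z * exp (- eps n * z) * fejer (z - y)) \<longlonglongrightarrow> g z * exp (- 0 * z) * fejer (z - y)"
        by (intro tendsto_intros eps)
      then show ?thesis by simp
    qed
    show "(LBINT z. g z * exp (- eps n * z) * fejer (z - y)) \<le> B + C * (LBINT z. fejer z)" for n
    proof -
      have "(LBINT z. g z * exp (- eps n * z) * fejer (z - y)) =
          S n + (LBINT z. C * indicator {0<..} z * exp (- eps n * z) * fejer (z - y))"
        unfolding S_def w_def left_diff_distrib
        by (subst Bochner_Integration.integral_diff[OF integrable_damped[OF eps(1,2)[of n]]]) simp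
      also have "(LBINT z. C * indicator {0<..} z * exp (- eps n * z) * fejer (z - y)) \<le> (LBINT z. C * fejer (z - y))"
      proof (rule integral_mono[OF integrable_damped(2)[OF eps(1,2)] integrable_mult_right[OF integrable_shifted_fejer]])
        fix z
        have "indicator {0<..} z * exp (- eps n * z) \<le> 1"
          using eps(1)[of n] by (auto simp: indicator_def)
        then have "C * fejer (z - y) * (indicator {0<..} z * exp (- eps n * z)) \<le> C * fejer (z - y) * 1"
          using pos fejer_bounds(1)[of "z - y"] by (intro mult_left_mono) auto
        then show "C * indicator {0<..} z * exp (- eps n * z) * fejer (z - y) \<le> C * fejer (z - y)"
          by (simp add: mult_ac)
      qed
      also have "(LBINT z. C * fejer (z - y)) = C * (LBINT z. fejer z)" by (simp add: shifted_fejer_integral)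
      finally show ?thesis using B[of n] by simp
    qed
  qed (use nonneg fejer_bounds in auto)
qed

text \<open>Both sides of \<open>damped_smoothing\<close> pass to the limit. On the left the
  domination splits by sign: for z > 0 the damping factor is at most 1 and
  \<open>integrable_smoothing\<close> applies, while for z \<le> 0 it is at most exp (- (e0 / 2) *
  z), where \<open>integrable_laplace\<close> applies.\<close>

lemma smoothing:
  "(LBINT z. of_real (w z * fejer (z - y)) * osc u (z - y)) =
    (LBINT t. kern u y t * D (- (\<i> * of_real (t + u))))"
proof -
  have "(\<lambda>n. LBINT z. of_real (w z * exp (- eps n * z) * fejer (z - y)) * osc u (z - y))
    \<longlonglongrightarrow> (LBINT z. of_real (w z * fejer (z - y)) * osc u (z - y))"
  proof (rule integral_dominated_convergence[where
      w = "\<lambda>z. g z * fejer (z - y) + C * fejer (z - y) + g z * exp (- (e0 / 2) * z)"])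
    show "integrable lborel (\<lambda>z. g z * fejer (z - y) + C * fejer (z - y) + g z * exp (- (e0 / 2) * z))"
      using pos by (intro Bochner_Integration.integrable_add integrable_smoothing integrable_mult_right integrable_shifted_fejer integrable_laplace) auto
    show "AE z in lborel. (\<lambda>n. of_real (w z * exp (- eps n * z) * fejer (z - y)) * osc u (z - y))
      \<longlonglongrightarrow> of_real (w z * fejer (z - y)) * osc u (z - y)"
    proof (rule AE_I2)
      fix z
      have "(\<lambda>n. w z * exp (- eps n * z) * fejer (z - y)) \<longlonglongrightarrow> w z * exp (- 0 * z) * fejer (z - y)"
        by (intro tendsto_intros eps)
      then have "(\<lambda>n. w z * exp (- eps n * z) * fejer (z - y)) \<longlonglongrightarrow> w z * fejer (z - y)" by simp
      from tendsto_mult[OF tendsto_of_real[OF this] tendsto_const]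
      show "(\<lambda>n. of_real (w z * exp (- eps n * z) * fejer (z - y)) * osc u (z - y))
        \<longlonglongrightarrow> of_real (w z * fejer (z - y)) * osc u (z - y)" .
    qed
    show "AE z in lborel. norm (of_real (w z * exp (- eps n * z) * fejer (z - y)) * osc u (z - y))
        \<le> g z * fejer (z - y) + C * fejer (z - y) + g z * exp (- (e0 / 2) * z)" for n
    proof (intro AE_I2)
      fix z
      have "norm (of_real (w z * exp (- eps n * z) * fejer (z - y)) * osc u (z - y)) =
          \<bar>w z\<bar> * exp (- eps n * z) * fejer (z - y)"
        using fejer_bounds(1)[of "z - y"] by (simp add: norm_mult abs_mult)
      also have "\<dots> \<le> g z * fejer (z - y) + C * fejer (z - y) + g z * exp (- (e0 / 2) * z)"
      proof (cases "z > 0")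
        case True
        then have "\<bar>w z\<bar> \<le> g z + C" using abs_w[of z] by simp
        moreover have "exp (- eps n * z) \<le> 1" using True eps(1)[of n] by simp
        ultimately have "\<bar>w z\<bar> * exp (- eps n * z) * fejer (z - y) \<le> (g z + C) * 1 * fejer (z - y)"
          using fejer_bounds(1)[of "z - y"] nonneg[of z] pos by (intro mult_mono) auto
        moreover have "g z * exp (- (e0 / 2) * z) \<ge> 0" using nonneg by simp
        ultimately show ?thesis by (simp add: algebra_simps)
      next
        case False
        then have "\<bar>w z\<bar> \<le> g z" using abs_w[of z] by simp
        moreover have "- eps n * z \<le> - (e0 / 2) * z"
          using False eps(3)[of n] by (intro mult_right_mono_neg) auto
        ultimately have "\<bar>w z\<bar> * exp (- eps n * z) * fejer (z - y) \<le> g z * exp (- (e0 / 2) * z) * 1"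
          using fejer_bounds[of "z - y"] nonneg[of z] by (intro mult_mono) auto
        moreover have "g z * fejer (z - y) \<ge> 0" "C * fejer (z - y) \<ge> 0"
          using nonneg[of z] pos fejer_bounds(1)[of "z - y"] by auto
        ultimately show ?thesis by simp
      qed
      finally show "norm (of_real (w z * exp (- eps n * z) * fejer (z - y)) * osc u (z - y))
        \<le> g z * fejer (z - y) + C * fejer (z - y) + g z * exp (- (e0 / 2) * z)" .
    qed
  qed measurable
  then have "(\<lambda>n. LBINT t. kern u y t * D (of_real (eps n) - \<i> * of_real (t + u)))
     \<longlonglongrightarrow> (LBINT z. of_real (w z * fejer (z - y)) * osc u (z - y))"
    by (simp only: damped_smoothing[OF eps(1,2)])
  then show ?thesis by (rule LIMSEQ_unique[OF _ boundary_kernel_tendsto])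
qed

text \<open>Up to a phase of modulus 1, the shift by y turns the right-hand side of
  \<open>smoothing\<close> into the Fourier transform at y of a continuous function with compact
  support, so the Riemann-Lebesgue lemma applies.\<close>

lemma smoothing_tendsto_0:
  "((\<lambda>y. LBINT x. of_real (w (y + x) * fejer x) * osc u x) \<longlongrightarrow> 0) at_top"
proof -
  define f where "f t = of_real (triangle t) * D (- (\<i> * of_real (t + u)))" for t
  have "continuous_on UNIV (\<lambda>t::real. D (- (\<i> * of_real (t + u))))"
    by (rule continuous_on_compose2[OF continuous_boundary]) (use pos in \<open>auto intro!: continuous_intros\<close>)
  then have "continuous_on UNIV f" unfolding f_def by (intro continuous_intros)
  then have RL: "((\<lambda>y. LBINT t. f t * exp (- (\<i> * of_real (t * y)))) \<longlongrightarrow> 0) at_top"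
    by (rule Riemann_Lebesgue_continuous[where c = 1]) (auto simp: f_def triangle_def)
  have eq: "(LBINT x. of_real (w (y + x) * fejer x) * osc u x) =
      exp (- (\<i> * of_real (u * y))) * (LBINT t. f t * exp (- (\<i> * of_real (t * y))))" for y
  proof -
    have "(LBINT x. of_real (w (y + x) * fejer x) * osc u x) =
       (LBINT z. of_real (w z * fejer (z - y)) * osc u (z - y))"
      using lborel_integral_real_affine[of 1 "\<lambda>z. of_real (w z * fejer (z - y)) * osc u (z - y)" y] by simp
    also have "\<dots> = (LBINT t. exp (- (\<i> * of_real (u * y))) * (f t * exp (- (\<i> * of_real (t * y)))))"
      unfolding smoothing
      by (intro Bochner_Integration.integral_cong)
         (auto simp: f_def exp_add[symmetric] exp_diff exp_minus field_simps)
    finally show ?thesis by simp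
  qed
  show ?thesis
  proof (rule Lim_null_comparison[OF _ tendsto_norm_zero[OF RL]])
    show "\<forall>\<^sub>F y in at_top. norm (LBINT x. of_real (w (y + x) * fejer x) * osc u x)
       \<le> norm (LBINT t. f t * exp (- (\<i> * of_real (t * y))))"
      unfolding eq by (simp add: norm_mult)
  qed
qed

lemma integrable_shifted: "integrable lborel (\<lambda>x. g (y + x) * fejer x)"
  using integrable_smoothing[of y] lborel_integrable_real_affine_iff[of 1 "\<lambda>z. g z * fejer (z - y)" y] by simp

lemma transform_tendsto:
  "((\<lambda>y. LBINT x. of_real (g (y + x) * fejer x) * osc u x)
    \<longlongrightarrow> (LBINT x. of_real (C * fejer x) * osc u x)) at_top"
proof -
  have 1: "((\<lambda>y. LBINT x. of_real (C * indicator {0<..} (y + x) * fejer x) * osc u x)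
    \<longlongrightarrow> (LBINT x. of_real (C * fejer x) * osc u x)) at_top"
  proof (rule integral_dominated_convergence_at_top[where w = "\<lambda>x. C * fejer x"])
    show "integrable lborel (\<lambda>x. C * fejer x)" by (intro integrable_mult_right integrable_fejer)
    show "AE x in lborel. ((\<lambda>y. of_real (C * indicator {0<..} (y + x) * fejer x) * osc u x) \<longlongrightarrow>
      of_real (C * fejer x) * osc u x) at_top"
    proof (intro AE_I2 tendsto_eventually)
      fix x
      show "\<forall>\<^sub>F y in at_top. of_real (C * indicator {0<..} (y + x) * fejer x) * osc u x =
        of_real (C * fejer x) * osc u x"
        using eventually_gt_at_top[of "- x"] by eventually_elim (simp add: indicator_def)
    qed
    show "\<forall>\<^sub>F y in at_top. AE x in lborel. norm (of_real (C * indicator {0<..} (y + x) * fejer x) * osc u x) \<le> C * fejer x"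
      using pos fejer_bounds by (intro always_eventually allI AE_I2) (auto simp: norm_mult abs_mult indicator_def)
  qed measurable
  have "(LBINT x. of_real (w (y + x) * fejer x) * osc u x) +
     (LBINT x. of_real (C * indicator {0<..} (y + x) * fejer x) * osc u x) =
     (LBINT x. of_real (g (y + x) * fejer x) * osc u x)" for y
  proof (subst Bochner_Integration.integral_add[symmetric])
    have i: "integrable lborel (\<lambda>x. g (y + x) * fejer x + C * fejer x)"
      by (intro Bochner_Integration.integrable_add integrable_mult_right integrable_fejer integrable_shifted)
    show "integrable lborel (\<lambda>x. of_real (w (y + x) * fejer x) * osc u x)"
    proof (rule Bochner_Integration.integrable_bound[OF i])
      have "\<bar>w (y + x)\<bar> * fejer x \<le> (g (y + x) + C) * fejer x" for x
        using abs_w[of "y + x"] fejer_bounds(1)[of x] pos by (intro mult_right_mono) (cases "y + x > 0"; simp)+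
      then show "AE x in lborel. norm (of_real (w (y + x) * fejer x) * osc u x) \<le> norm (g (y + x) * fejer x + C * fejer x)"
        using fejer_bounds(1) nonneg pos by (intro AE_I2) (simp add: norm_mult abs_mult algebra_simps)
    qed measurable
    show "integrable lborel (\<lambda>x. of_real (C * indicator {0<..} (y + x) * fejer x) * osc u x)"
      by (rule Bochner_Integration.integrable_bound[OF integrable_mult_right[OF integrable_fejer, of C]])
         (use pos fejer_bounds in \<open>auto intro!: AE_I2 simp: norm_mult abs_mult indicator_def\<close>)
    show "(LBINT x. of_real (w (y + x) * fejer x) * osc u x + of_real (C * indicator {0<..} (y + x) * fejer x) * osc u x) =
     (LBINT x. of_real (g (y + x) * fejer x) * osc u x)"
      by (simp add: w_def algebra_simps)
  qed
  then show ?thesis using tendsto_add[OF smoothing_tendsto_0[of u] 1] by simp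
qed

section \<open>From smoothed averages to the pointwise limit\<close>

lemma fejer_mass_pos:
  assumes "a < b" "-1 \<le> a" "b \<le> 1"
  shows "(LBINT x. indicator {a<..b} x * fejer x) > 0"
proof -
  have i: "integrable lborel (\<lambda>x. indicator {a<..b} x * fejer x)"
    using integrable_real_mult_indicator[OF _ integrable_fejer, of "{a<..b}"] by (simp add: mult.commute)
  have "(LBINT x. indicator {a<..b} x * fejer x) \<noteq> 0"
  proof
    assume "(LBINT x. indicator {a<..b} x * fejer x) = 0"
    then have "AE x in lborel. indicator {a<..b} x * fejer x = 0"
      using i fejer_bounds by (subst (asm) integral_nonneg_eq_0_iff_AE) auto
    then have "AE x in lborel. x \<notin> {a<..b}"
      using AE_lborel_singleton[of 0]
    proof eventually_elim
      case (elim x)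
      show ?case
      proof
        assume x: "x \<in> {a<..b}"
        then have "fejer x > 0" using assms elim by (intro fejer_pos) auto
        then show False using elim x by simp
      qed
    qed
    then have "emeasure lborel {a<..b} = 0" by (subst (asm) AE_iff_measurable[where N = "{a<..b}"]) auto
    then show False using assms by simp
  qed
  moreover have "(LBINT x. indicator {a<..b} x * fejer x) \<ge> 0"
    using fejer_bounds by (intro integral_nonneg_AE) auto
  ultimately show ?thesis by simp
qed

lemma fejer_total_pos: "(LBINT x. fejer x) > 0"
proof -
  have "(LBINT x. indicator {0<..1} x * fejer x) \<le> (LBINT x. fejer x)"
    using integrable_real_mult_indicator[OF _ integrable_fejer, of "{0<..1}"] fejer_bounds(1)
    by (intro integral_mono integrable_fejer) (auto simp: mult.commute indicator_def)
  then show ?thesis using fejer_mass_pos[of 0 1] by simp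
qed

text \<open>Levy continuity applied to the normalised measures \<open>g (y + x) * fejer x dx\<close>.\<close>

lemma window_tendsto:
  assumes X: "filterlim X at_top sequentially" and ab: "a < b"
  shows "(\<lambda>n. LBINT x. indicator {a<..b} x * (g (X n + x) * fejer x)) \<longlonglongrightarrow>
    C * (LBINT x. indicator {a<..b} x * fejer x)"
proof -
  define \<kappa> where "\<kappa> = (LBINT x. fejer x)"
  define Z where "Z y = (LBINT x. g (y + x) * fejer x)" for y
  have \<kappa>: "\<kappa> > 0" using fejer_total_pos by (simp add: \<kappa>_def)
  have tr: "(\<lambda>n. LBINT x. of_real (g (X n + x) * fejer x) * osc u x)
      \<longlonglongrightarrow> (LBINT x. of_real (C * fejer x) * osc u x)" for u
    using filterlim_compose[OF transform_tendsto X] .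
  have "(\<lambda>n. complex_of_real (Z (X n))) \<longlonglongrightarrow> complex_of_real (C * \<kappa>)"
    using tr[of 0] by (simp add: Z_def \<kappa>_def del: of_real_mult)
  then have Zlim: "(\<lambda>n. Z (X n)) \<longlonglongrightarrow> C * \<kappa>" by (subst (asm) tendsto_of_real_iff)
  then have "eventually (\<lambda>n. Z (X n) > 0) sequentially"
    using pos \<kappa> by (intro order_tendstoD(1)[OF Zlim]) auto
  then obtain N where N: "\<And>n. n \<ge> N \<Longrightarrow> Z (X n) > 0" by (auto simp: eventually_sequentially)
  \<comment> \<open>The normalisation divides by \<open>Z\<close>, which is known to be positive
    only from N on; \<open>LIMSEQ_offset\<close> restores the full sequence at the end.\<close>
  define Y where "Y n = X (n + N)" for n
  have Z: "Z (Y n) > 0" for n using N by (simp add: Y_def)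
  have ZY: "(\<lambda>n. Z (Y n)) \<longlonglongrightarrow> C * \<kappa>" unfolding Y_def using Zlim by (rule LIMSEQ_ignore_initial_segment)
  define \<mu> where "\<mu> n = density lborel (\<lambda>x. ennreal (g (Y n + x) * fejer x / Z (Y n)))" for n
  define \<nu> where "\<nu> = density lborel (\<lambda>x. ennreal (fejer x / \<kappa>))"
  have rd: "real_distribution (density lborel (\<lambda>x. ennreal (f x / I)))"
    if f: "integrable lborel f" "\<And>x. f x \<ge> 0" and I: "I > 0" "(LBINT x. f x) = I" for f :: "real \<Rightarrow> real" and I
  proof -
    have [measurable]: "f \<in> borel_measurable borel" using f by auto
    have "emeasure (density lborel (\<lambda>x. ennreal (f x / I))) UNIV = (\<integral>\<^sup>+x. ennreal (f x / I) \<partial>lborel)"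
      by (subst emeasure_density) auto
    also have "\<dots> = 1" using f I by (subst nn_integral_eq_integral) auto
    finally have "prob_space (density lborel (\<lambda>x. ennreal (f x / I)))" by (intro prob_spaceI) simp
    then show ?thesis by (simp add: real_distribution_def real_distribution_axioms_def)
  qed
  have nn: "g (y + x) * fejer x \<ge> 0" for x y using nonneg fejer_bounds by simp
  have \<mu>: "real_distribution (\<mu> n)" for n
    unfolding \<mu>_def using Z by (intro rd integrable_shifted nn) (auto simp: Z_def)
  have \<nu>: "real_distribution \<nu>"
    unfolding \<nu>_def using \<kappa> by (intro rd integrable_fejer fejer_bounds) (auto simp: \<kappa>_def)
  have ch\<mu>: "char (\<mu> n) u = (LBINT x. of_real (g (Y n + x) * fejer x) * osc u x) / of_real (Z (Y n))" for n u
  proof -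
    have "char (\<mu> n) u = (LBINT x. (g (Y n + x) * fejer x / Z (Y n)) *\<^sub>R osc u x)"
      unfolding char_def \<mu>_def using nn Z[of n] by (subst integral_density) (auto intro!: AE_I2 divide_nonneg_pos)
    then show ?thesis by (simp add: scaleR_conv_of_real flip: integral_divide_zero)
  qed
  have ch\<nu>: "char \<nu> u = (LBINT x. of_real (C * fejer x) * osc u x) / of_real (C * \<kappa>)" for u
  proof -
    have "char \<nu> u = (LBINT x. (fejer x / \<kappa>) *\<^sub>R osc u x)"
      unfolding char_def \<nu>_def using fejer_bounds(1) \<kappa> by (subst integral_density) (auto intro!: AE_I2 divide_nonneg_pos)
    then show ?thesis using pos by (simp add: scaleR_conv_of_real mult.assoc flip: integral_divide_zero)
  qed
  have "(\<lambda>n. char (\<mu> n) u) \<longlonglongrightarrow> char \<nu> u" for u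
    unfolding ch\<mu> ch\<nu> using pos \<kappa> LIMSEQ_ignore_initial_segment[OF tr[of u], of N]
    by (intro tendsto_divide tendsto_of_real ZY) (auto simp: Y_def)
  then have "weak_conv_m \<mu> \<nu>" using \<mu> \<nu> by (intro levy_continuity) auto
  \<comment> \<open>The limit law has a density, hence no atoms, so weak convergence gives
    convergence of the distribution functions at both ends of every window.\<close>
  moreover have "isCont (cdf \<nu>) x" for x
  proof -
    interpret \<nu>: real_distribution \<nu> by fact
    have "emeasure \<nu> {x} = 0"
      unfolding \<nu>_def by (subst emeasure_density) (auto intro!: nn_integral_zero' AE_mp[OF AE_lborel_singleton[of x]])
    then show ?thesis by (simp add: \<nu>.isCont_cdf measure_def)
  qed
  ultimately have cdf: "(\<lambda>n. cdf (\<mu> n) x) \<longlonglongrightarrow> cdf \<nu> x" for x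
    by (auto simp: weak_conv_m_def weak_conv_def)
  have diff: "measure m {a<..b} = cdf m b - cdf m a" if "real_distribution m" for m
  proof -
    interpret m: real_distribution m by fact
    show ?thesis using m.cdf_diff_eq[OF ab] by simp
  qed
  have meas: "measure (density lborel (\<lambda>x. ennreal (f x / I))) {a<..b} = (LBINT x. indicator {a<..b} x * f x) / I"
    if f: "integrable lborel f" "\<And>x. f x \<ge> 0" and I: "I > 0" for f :: "real \<Rightarrow> real" and I
  proof -
    have [measurable]: "f \<in> borel_measurable borel" using f by auto
    have i: "integrable lborel (\<lambda>x. indicator {a<..b} x * f x / I)"
      using integrable_real_mult_indicator[OF _ f(1), of "{a<..b}"] by (simp add: mult.commute)
    have "emeasure (density lborel (\<lambda>x. ennreal (f x / I))) {a<..b} = (\<integral>\<^sup>+x. ennreal (indicator {a<..b} x * f x / I) \<partial>lborel)"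
      by (subst emeasure_density) (auto intro!: nn_integral_cong simp: indicator_def)
    also have "\<dots> = ennreal (LBINT x. indicator {a<..b} x * f x / I)"
      using f I i by (subst nn_integral_eq_integral) (auto intro!: AE_I2 divide_nonneg_pos)
    finally show ?thesis
      using f I by (simp add: measure_def enn2real_ennreal divide_nonneg_pos integral_nonneg_AE)
  qed
  have "(\<lambda>n. measure (\<mu> n) {a<..b}) \<longlonglongrightarrow> measure \<nu> {a<..b}"
    unfolding diff[OF \<mu>] diff[OF \<nu>] by (intro tendsto_diff cdf)
  then have "(\<lambda>n. measure (\<mu> n) {a<..b} * Z (Y n)) \<longlonglongrightarrow> measure \<nu> {a<..b} * (C * \<kappa>)"
    by (intro tendsto_mult ZY)
  moreover have "measure (\<mu> n) {a<..b} * Z (Y n) = (LBINT x. indicator {a<..b} x * (g (Y n + x) * fejer x))" for n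
    unfolding \<mu>_def using Z[of n] by (subst meas[OF integrable_shifted nn]) auto
  moreover have "measure \<nu> {a<..b} * (C * \<kappa>) = C * (LBINT x. indicator {a<..b} x * fejer x)"
    unfolding \<nu>_def using \<kappa> by (subst meas[OF integrable_fejer fejer_bounds(1)]) auto
  ultimately have "(\<lambda>n. LBINT x. indicator {a<..b} x * (g (Y n + x) * fejer x)) \<longlonglongrightarrow> C * (LBINT x. indicator {a<..b} x * fejer x)"
    by simp
  then show ?thesis unfolding Y_def by (rule LIMSEQ_offset)
qed

lemma integrable_window: "integrable lborel (\<lambda>x. indicator {a<..b} x * (g (y + x) * fejer x))"
  using integrable_real_mult_indicator[OF _ integrable_shifted[of y], of "{a<..b}"] by (simp add: mult.commute)

lemma integrable_fejer_window: "integrable lborel (\<lambda>x. indicator {a<..b} x * fejer x)"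
  using integrable_real_mult_indicator[OF _ integrable_fejer, of "{a<..b}"] by (simp add: mult.commute)

text \<open>By \<open>slow\<close>, g at a point is squeezed between weighted averages of g: the
  average over (0, h] to its right is at most exp (\<theta> * h) times the value, and the value is
  at most exp (\<theta> * h) times the average over (-h, 0] to its left. Both averages tend to C by
  \<open>window_tendsto\<close>, and h is then chosen small.\<close>

lemma tendsto_at_top: "(g \<longlongrightarrow> C) at_top"
proof (rule tendsto_at_topI_sequentially)
  fix X :: "nat \<Rightarrow> real" assume X: "filterlim X at_top sequentially"
  define R where "R a b n = (LBINT x. indicator {a<..b} x * (g (X n + x) * fejer x)) / (LBINT x. indicator {a<..b} x * fejer x)" for a b n
  have R: "R a b \<longlonglongrightarrow> C" if "a < b" "-1 \<le> a" "b \<le> 1" for a b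
    using tendsto_divide[OF window_tendsto[OF X that(1)] tendsto_const[of "LBINT x. indicator {a<..b} x * fejer x"]]
      fejer_mass_pos[OF that] by (simp add: R_def[abs_def])
  have lower: "exp (- \<theta> * h) * R 0 h n \<le> g (X n)" if h: "0 < h" "h \<le> 1" for h n
  proof -
    have "(LBINT x. indicator {0<..h} x * (g (X n + x) * fejer x)) \<le> (LBINT x. exp (\<theta> * h) * g (X n) * (indicator {0<..h} x * fejer x))"
    proof (intro integral_mono integrable_window integrable_mult_right integrable_fejer_window)
      fix x
      show "indicator {0<..h} x * (g (X n + x) * fejer x) \<le> exp (\<theta> * h) * g (X n) * (indicator {0<..h} x * fejer x)"
      proof (cases "x \<in> {0<..h}")
        case True
        then have "g (X n + x) \<le> exp (\<theta> * x) * g (X n)" by (intro slow) auto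
        also have "\<dots> \<le> exp (\<theta> * h) * g (X n)" using True pos nonneg by (intro mult_right_mono) auto
        finally show ?thesis using True fejer_bounds(1)[of x] by (simp add: mult_right_mono)
      qed simp
    qed
    then have "R 0 h n \<le> exp (\<theta> * h) * g (X n)"
      using fejer_mass_pos[of 0 h] h by (simp add: R_def pos_divide_le_eq)
    then show ?thesis by (simp add: exp_minus field_simps)
  qed
  have upper: "g (X n) \<le> exp (\<theta> * h) * R (- h) 0 n" if h: "0 < h" "h \<le> 1" for h n
  proof -
    have "(LBINT x. exp (- \<theta> * h) * g (X n) * (indicator {-h<..0} x * fejer x)) \<le> (LBINT x. indicator {-h<..0} x * (g (X n + x) * fejer x))"
    proof (intro integral_mono integrable_window integrable_mult_right integrable_fejer_window)
      fix x
      show "exp (- \<theta> * h) * g (X n) * (indicator {-h<..0} x * fejer x) \<le> indicator {-h<..0} x * (g (X n + x) * fejer x)"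
      proof (cases "x \<in> {-h<..0}")
        case True
        then have "g (X n) \<le> exp (\<theta> * (- x)) * g (X n + x)" using slow[of "- x" "X n + x"] by simp
        also have "\<dots> \<le> exp (\<theta> * h) * g (X n + x)"
          using True pos nonneg mult_left_mono[of "- x" h \<theta>] by (intro mult_right_mono) auto
        finally have "exp (- \<theta> * h) * g (X n) \<le> g (X n + x)" by (simp add: exp_minus field_simps)
        then show ?thesis using True fejer_bounds(1)[of x] by (simp add: mult_right_mono)
      qed simp
    qed
    then have "exp (- \<theta> * h) * g (X n) \<le> R (- h) 0 n"
      using fejer_mass_pos[of "-h" 0] h by (simp add: R_def pos_le_divide_eq)
    then show ?thesis by (simp add: exp_minus field_simps)
  qed
  show "(\<lambda>n. g (X n)) \<longlonglongrightarrow> C"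
  proof (rule order_tendstoI)
    fix a assume a: "a < C"
    have "((\<lambda>h. exp (- \<theta> * h) * C) \<longlongrightarrow> exp (- \<theta> * 0) * C) (at_right 0)" by (intro tendsto_intros)
    then have "eventually (\<lambda>h. a < exp (- \<theta> * h) * C) (at_right 0)" using a by (intro order_tendstoD(1)) auto
    moreover have "eventually (\<lambda>h::real. h \<le> 1) (at_right 0)" "eventually (\<lambda>h::real. h > 0) (at_right 0)"
      by (auto simp: eventually_at_right_field intro!: exI[of _ 1])
    ultimately have "eventually (\<lambda>h. a < exp (- \<theta> * h) * C \<and> h \<le> 1 \<and> h > 0) (at_right 0)"
      by eventually_elim auto
    then obtain h where h: "a < exp (- \<theta> * h) * C" "h \<le> 1" "h > 0"
      using eventually_happens'[of "at_right (0::real)"] by auto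
    have "(\<lambda>n. exp (- \<theta> * h) * R 0 h n) \<longlonglongrightarrow> exp (- \<theta> * h) * C"
      using h by (intro tendsto_mult tendsto_const R) auto
    then have "eventually (\<lambda>n. a < exp (- \<theta> * h) * R 0 h n) sequentially" using h by (intro order_tendstoD(1)) auto
    then show "eventually (\<lambda>n. a < g (X n)) sequentially"
      by eventually_elim (use lower[OF h(3,2)] in \<open>auto intro: less_le_trans\<close>)
  next
    fix a assume a: "C < a"
    have "((\<lambda>h. exp (\<theta> * h) * C) \<longlongrightarrow> exp (\<theta> * 0) * C) (at_right 0)" by (intro tendsto_intros)
    then have "eventually (\<lambda>h. exp (\<theta> * h) * C < a) (at_right 0)" using a by (intro order_tendstoD(2)) auto
    moreover have "eventually (\<lambda>h::real. h \<le> 1) (at_right 0)" "eventually (\<lambda>h::real. h > 0) (at_right 0)"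
      by (auto simp: eventually_at_right_field intro!: exI[of _ 1])
    ultimately have "eventually (\<lambda>h. exp (\<theta> * h) * C < a \<and> h \<le> 1 \<and> h > 0) (at_right 0)"
      by eventually_elim auto
    then obtain h where h: "exp (\<theta> * h) * C < a" "h \<le> 1" "h > 0"
      using eventually_happens'[of "at_right (0::real)"] by auto
    have "(\<lambda>n. exp (\<theta> * h) * R (- h) 0 n) \<longlonglongrightarrow> exp (\<theta> * h) * C"
      using h by (intro tendsto_mult tendsto_const R) auto
    then have "eventually (\<lambda>n. exp (\<theta> * h) * R (- h) 0 n < a) sequentially" using h by (intro order_tendstoD(2)) auto
    then show "eventually (\<lambda>n. g (X n) < a) sequentially"
      by eventually_elim (use upper[OF h(3,2)] in \<open>auto intro: le_less_trans\<close>)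
  qed
qed

end

section \<open>Restarting the process\<close>

text \<open>Compactness: times at which f exceeds n accumulate at some l, but the one-sided limits
  at l bound f on a whole neighbourhood of l.\<close>

lemma cadlag_bounded_above:
  assumes "cadlag f"
  obtains B where "\<And>t. 0 \<le> t \<Longrightarrow> t \<le> T \<Longrightarrow> f t \<le> B"
proof (rule ccontr)
  assume "\<not> thesis"
  then have "\<exists>t\<in>{0..T}. f t > real n" for n using that[of "real n"] by (meson atLeastAtMost_iff not_le)
  then obtain x where x: "\<And>n. x n \<in> {0..T}" "\<And>n. f (x n) > real n" by metis
  have "compact {0..T}" by simp
  then obtain l r where l: "l \<in> {0..T}" and r: "strict_mono (r :: nat \<Rightarrow> nat)" and lim: "(x \<circ> r) \<longlonglongrightarrow> l"
    using x(1) unfolding compact_eq_seq_compact_metric seq_compact_def by meson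
  have "(f \<longlongrightarrow> f l) (at_right l)" using assms l by (simp add: cadlag_def)
  then have R: "eventually (\<lambda>t. f t < f l + 1) (at_right l)" by (intro order_tendstoD(2)) auto
  \<comment> \<open>The premise t \<ge> 0 makes the claim vacuous at l = 0, where
    \<open>cadlag\<close> provides no left limit.\<close>
  have "\<exists>c. eventually (\<lambda>t. t \<ge> 0 \<longrightarrow> f t < c) (at_left l)"
  proof (cases "l = 0")
    case True
    then have "eventually (\<lambda>t. t \<ge> 0 \<longrightarrow> f t < 0) (at_left l)"
      by (auto simp: eventually_at_filter)
    then show ?thesis by blast
  next
    case False
    then have "l > 0" using l by simp
    then obtain c where "(f \<longlongrightarrow> c) (at_left l)" using assms unfolding cadlag_def by blast
    then have "eventually (\<lambda>t. f t < c + 1) (at_left l)" by (intro order_tendstoD(2)) auto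
    then have "eventually (\<lambda>t. t \<ge> 0 \<longrightarrow> f t < c + 1) (at_left l)" by (auto elim: eventually_mono)
    then show ?thesis by blast
  qed
  then obtain c where L: "eventually (\<lambda>t. t \<ge> 0 \<longrightarrow> f t < c) (at_left l)" by blast
  define m where "m = max c (f l + 1)"
  have "eventually (\<lambda>t. t \<ge> 0 \<longrightarrow> f t < m) (at l)"
    unfolding eventually_at_split using L R by (auto simp: m_def elim!: eventually_mono)
  then have "eventually (\<lambda>t. t \<ge> 0 \<longrightarrow> f t < m) (nhds l)"
    unfolding eventually_at_filter by (rule eventually_mono) (auto simp: m_def)
  then have "eventually (\<lambda>n. (x \<circ> r) n \<ge> 0 \<longrightarrow> f ((x \<circ> r) n) < m) sequentially"
    using lim unfolding filterlim_iff by blast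
  then have "eventually (\<lambda>n. real n < m) sequentially"
  proof eventually_elim
    case (elim n)
    have "real n \<le> real (r n)" using seq_suble[OF r] by simp
    also have "\<dots> < f (x (r n))" by (rule x)
    finally show ?case using elim x(1)[of "r n"] by simp
  qed
  moreover have "eventually (\<lambda>n. real n \<ge> m) sequentially"
    using filterlim_real_sequentially unfolding filterlim_at_top by blast
  ultimately have "eventually (\<lambda>n::nat. False) sequentially" by eventually_elim simp
  then show False by simp
qed

text \<open>The successor makes the sampling strictly one-sided: for j the floor of 2 ^ n * v, the
  grid point lies in the interval (v, v + 2 ^ (-n)], so right-continuity applies along it.\<close>

definition grid :: "nat \<Rightarrow> nat \<Rightarrow> real" where "grid n j = real (Suc j) / 2 ^ n"

lemma filterlim_grid:
  assumes "v \<ge> 0"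
  shows "filterlim (\<lambda>n. grid n (nat \<lfloor>2 ^ n * v\<rfloor>)) (at_right v) sequentially"
proof -
  have *: "v < grid n (nat \<lfloor>2 ^ n * v\<rfloor>)" "grid n (nat \<lfloor>2 ^ n * v\<rfloor>) \<le> v + (1/2) ^ n" for n
  proof -
    have "real (nat \<lfloor>2 ^ n * v\<rfloor>) = of_int \<lfloor>2 ^ n * v\<rfloor>" using assms by simp
    then have "2 ^ n * v < real (Suc (nat \<lfloor>2 ^ n * v\<rfloor>))" "real (Suc (nat \<lfloor>2 ^ n * v\<rfloor>)) \<le> 2 ^ n * v + 1"
      by linarith+
    then show "v < grid n (nat \<lfloor>2 ^ n * v\<rfloor>)" "grid n (nat \<lfloor>2 ^ n * v\<rfloor>) \<le> v + (1/2) ^ n"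
      by (simp_all add: grid_def field_simps power_divide)
  qed
  have "(\<lambda>n. grid n (nat \<lfloor>2 ^ n * v\<rfloor>)) \<longlonglongrightarrow> v"
  proof (rule tendsto_sandwich[OF _ _ tendsto_const])
    have "(\<lambda>n. v + (1/2) ^ n) \<longlonglongrightarrow> v + 0" by (intro tendsto_intros LIMSEQ_power_zero) auto
    then show "(\<lambda>n. v + (1/2) ^ n) \<longlonglongrightarrow> v" by simp
  qed (use * in \<open>auto intro!: always_eventually less_imp_le\<close>)
  then show ?thesis using *(1) by (auto simp: filterlim_at intro!: always_eventually less_imp_neq[symmetric])
qed

lemma cadlag_grid:
  assumes "cadlag f" "v \<ge> 0"
  shows "(\<lambda>n. f (grid n (nat \<lfloor>2 ^ n * v\<rfloor>))) \<longlonglongrightarrow> f v"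
proof -
  have "(f \<longlongrightarrow> f v) (at_right v)" using assms by (auto simp: cadlag_def)
  from filterlim_compose[OF this filterlim_grid[OF assms(2)]] show ?thesis .
qed

lemma cadlag_shift: "cadlag f \<Longrightarrow> u \<ge> 0 \<Longrightarrow> cadlag (\<lambda>v. f (u + v) - c)"
  unfolding cadlag_def
proof (intro conjI allI impI)
  assume f: "(\<forall>t\<ge>0. (f \<longlongrightarrow> f t) (at_right t)) \<and> (\<forall>t>0. \<exists>l. (f \<longlongrightarrow> l) (at_left t))" and u: "u \<ge> 0"
  fix t :: real
  {
    assume "t \<ge> 0"
    then have "(f \<longlongrightarrow> f (u + t)) (at_right (u + t))" using f u by simp
    moreover have "filterlim (\<lambda>v. u + v) (at_right (u + t)) (at_right t)"
      by (auto simp: filterlim_at eventually_at_filter intro!: tendsto_eq_intros)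
    ultimately have "((\<lambda>v. f (u + v)) \<longlongrightarrow> f (u + t)) (at_right t)" by (rule filterlim_compose)
    then show "((\<lambda>v. f (u + v) - c) \<longlongrightarrow> f (u + t) - c) (at_right t)" by (intro tendsto_intros)
  }
  {
    assume "t > 0"
    then obtain l where "(f \<longlongrightarrow> l) (at_left (u + t))" using f u by (metis add_nonneg_pos)
    moreover have "filterlim (\<lambda>v. u + v) (at_left (u + t)) (at_left t)"
      by (auto simp: filterlim_at eventually_at_filter intro!: tendsto_eq_intros)
    ultimately have "((\<lambda>v. f (u + v)) \<longlongrightarrow> l) (at_left t)" by (rule filterlim_compose)
    then show "\<exists>l. ((\<lambda>v. f (u + v) - c) \<longlongrightarrow> l) (at_left t)" by (intro exI[of _ "l - c"] tendsto_intros)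
  }
qed

text \<open>Approximating \<open>v\<close> from the right by dyadic times expresses the integral through countably many
  coordinates of the path, so that its law is determined by the dyadic increments.\<close>

definition sampled_functional :: "real set \<Rightarrow> (nat \<times> nat \<Rightarrow> real) \<Rightarrow> ennreal" where
  "sampled_functional B p =
    (\<integral>\<^sup>+v. indicator B v * liminf (\<lambda>n. ennreal (exp (p (n, nat \<lfloor>2 ^ n * v\<rfloor>)))) \<partial>lborel)"

text \<open>The limes inferior is defined and measurable for every array p, whether or not the
  samples converge. The sampled index depends on v but takes countably many values, which gives
  joint measurability in p and v.\<close>

lemma measurable_sampled_functional [measurable]:
  assumes [measurable]: "B \<in> sets borel"
  shows "sampled_functional B \<in> borel_measurable (Pi\<^sub>M UNIV (\<lambda>_. borel))"
proof -
  have [measurable]: "(\<lambda>x. fst x (n, nat \<lfloor>2 ^ n * snd x\<rfloor>)) \<in> borel_measurable (Pi\<^sub>M UNIV (\<lambda>_. borel) \<Otimes>\<^sub>M (lborel :: real measure))" for n :: nat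
  proof (rule measurable_compose_countable'[where I = UNIV and g = "\<lambda>x. nat \<lfloor>2 ^ n * snd x\<rfloor>" and f = "\<lambda>j x. fst x (n, j)"])
    show "(\<lambda>x. fst x (n, j)) \<in> borel_measurable (Pi\<^sub>M UNIV (\<lambda>_. borel) \<Otimes>\<^sub>M (lborel :: real measure))" for j :: nat
      by (rule measurable_compose[OF measurable_fst measurable_component_singleton]) simp
  qed auto
  have "(\<lambda>x. indicator B (snd x) * liminf (\<lambda>n. ennreal (exp (fst x (n, nat \<lfloor>2 ^ n * snd x\<rfloor>)))))
      \<in> borel_measurable (Pi\<^sub>M UNIV (\<lambda>_. borel) \<Otimes>\<^sub>M (lborel :: real measure))"
    by measurable
  then show ?thesis unfolding sampled_functional_def[abs_def]
    by (intro lborel.borel_measurable_nn_integral) (simp add: case_prod_beta')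
qed

lemma sampled_functional_cadlag:
  assumes "cadlag f" "B \<subseteq> {0..}"
  shows "sampled_functional B (\<lambda>(n, j). f (grid n j)) = (\<integral>\<^sup>+v\<in>B. ennreal (exp (f v)) \<partial>lborel)"
  unfolding sampled_functional_def
proof (intro nn_integral_cong)
  fix v
  have "liminf (\<lambda>n. ennreal (exp (f (grid n (nat \<lfloor>2 ^ n * v\<rfloor>))))) = ennreal (exp (f v))" if "v \<in> B"
    using that assms by (intro lim_imp_Liminf tendsto_ennrealI tendsto_exp cadlag_grid) auto
  then show "indicator B v * liminf (\<lambda>n. ennreal (exp (case (n, nat \<lfloor>2 ^ n * v\<rfloor>) of (n, j) \<Rightarrow> f (grid n j)))) =
     ennreal (exp (f v)) * indicator B v"
    by (auto simp: indicator_def)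
qed

section \<open>Independence and stationarity of the path after a fixed time\<close>

context levy_process
begin

definition sampled_increments :: "real \<Rightarrow> 'a \<Rightarrow> nat \<times> nat \<Rightarrow> real" where
  "sampled_increments u \<omega> = (\<lambda>(n, j). \<xi> (u + grid n j) \<omega> - \<xi> u \<omega>)"

lemma grid_nonneg: "grid n j \<ge> 0" by (simp add: grid_def)

lemma measurable_sampled_increments [measurable]:
  assumes "u \<ge> 0"
  shows "sampled_increments u \<in> measurable M (Pi\<^sub>M UNIV (\<lambda>_. borel))"
proof (rule measurable_PiM_single')
  show "(\<lambda>\<omega>. sampled_increments u \<omega> i) \<in> borel_measurable M" for i
    using random_variable_at[of u] random_variable_at[of "u + grid (fst i) (snd i)"] assms grid_nonneg
    by (auto simp: sampled_increments_def case_prod_beta')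
qed auto

text \<open>The increment up to u and the increments over K dyadic steps after u form one
  independent family, whose grouping into two blocks gives the product. The second block has a law
  independent of u, being a product of K copies of the law of \<xi> at time 1 / 2 ^ N.\<close>

lemma grid_increments:
  fixes N K :: nat
  assumes u: "u \<ge> 0" and A: "A \<in> sets borel" and V: "V \<in> sets (Pi\<^sub>M {..<K} (\<lambda>_. borel))"
  defines "D \<equiv> \<lambda>u \<omega>. \<lambda>k\<in>{..<K}. \<xi> (u + real (Suc k) / 2 ^ N) \<omega> - \<xi> (u + real k / 2 ^ N) \<omega>"
  shows "prob {\<omega>\<in>space M. \<xi> u \<omega> \<in> A \<and> D u \<omega> \<in> V} =
    prob {\<omega>\<in>space M. \<xi> u \<omega> \<in> A} * prob {\<omega>\<in>space M. D 0 \<omega> \<in> V}"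
proof -
  note [measurable] = A V
  have measurable_xi [measurable]: "\<xi> t \<in> borel_measurable M" if "t \<ge> 0" for t using random_variable_at[OF that] .
  have rvu [measurable]: "\<xi> u \<in> borel_measurable M" "\<xi> 0 \<in> borel_measurable M" using u by auto
  have inc: "(\<lambda>\<omega>. \<xi> (u + real (Suc k) / 2 ^ N) \<omega> - \<xi> (u + real k / 2 ^ N) \<omega>) \<in> borel_measurable M" if "u \<ge> 0" for u k
    using that by (intro borel_measurable_diff measurable_xi) auto
  have D [measurable]: "D u \<in> measurable M (Pi\<^sub>M {..<K} (\<lambda>_. borel))" if "u \<ge> 0" for u
    unfolding D_def using inc[OF that] by (intro measurable_restrict)
  have law: "prob {\<omega>\<in>space M. D v \<omega> \<in> V} = prob {\<omega>\<in>space M. D 0 \<omega> \<in> V}" if v: "v \<ge> 0" for v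
  proof (cases "K = 0")
    case True
    then show ?thesis by (simp add: D_def restrict_def)
  next
    case False
    have "distr M (Pi\<^sub>M {..<K} (\<lambda>_. borel)) (D v) = Pi\<^sub>M {..<K} (\<lambda>_. distr M borel (\<xi> (1 / 2 ^ N)))" if v: "v \<ge> 0" for v
    proof -
      have st: "distr M borel (\<lambda>\<omega>. \<xi> (v + real (Suc k) / 2 ^ N) \<omega> - \<xi> (v + real k / 2 ^ N) \<omega>) =
          distr M borel (\<xi> (1 / 2 ^ N))" for k
        using stationary_increments[of "v + real k / 2 ^ N" "1 / 2 ^ N"] v by (simp add: add_divide_distrib algebra_simps)
      have "indep_vars (\<lambda>_. borel) (\<lambda>k \<omega>. \<xi> (v + real (Suc k) / 2 ^ N) \<omega> - \<xi> (v + real k / 2 ^ N) \<omega>) {..<K}"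
        using v by (intro indep_increments) (auto intro!: divide_right_mono)
      then have "distr M (Pi\<^sub>M {..<K} (\<lambda>_. borel)) (D v) =
          Pi\<^sub>M {..<K} (\<lambda>k. distr M borel (\<lambda>\<omega>. \<xi> (v + real (Suc k) / 2 ^ N) \<omega> - \<xi> (v + real k / 2 ^ N) \<omega>))"
        unfolding D_def using False inc[OF v] by (subst (asm) indep_vars_iff_distr_eq_PiM') auto
      then show ?thesis by (simp only: st)
    qed
    from this[OF v] this[of 0] have eq: "distr M (Pi\<^sub>M {..<K} (\<lambda>_. borel)) (D v) = distr M (Pi\<^sub>M {..<K} (\<lambda>_. borel)) (D 0)" by simp
    have "prob {\<omega>\<in>space M. D v \<omega> \<in> V} = measure (distr M (Pi\<^sub>M {..<K} (\<lambda>_. borel)) (D v)) V"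
      using D[OF v] V by (subst measure_distr) (auto intro!: arg_cong[where f = prob])
    also have "\<dots> = prob {\<omega>\<in>space M. D 0 \<omega> \<in> V}"
      unfolding eq using D[of 0] V by (subst measure_distr) (auto intro!: arg_cong[where f = prob])
    finally show ?thesis .
  qed
  \<comment> \<open>Increment 0 is the one from 0 to u, so the dyadic increments are numbered from
    1. Increment 0 equals \<xi> u only almost surely, since \<xi> 0 vanishes almost surely.\<close>
  define \<tau> where "\<tau> i = (if i = 0 then 0 else u + real (i - 1) / 2 ^ N)" for i :: nat
  define X where "X i \<omega> = \<xi> (\<tau> (Suc i)) \<omega> - \<xi> (\<tau> i) \<omega>" for i \<omega>
  have "indep_vars (\<lambda>_. borel) X {..<Suc K}"
    unfolding X_def using u by (intro indep_increments) (auto simp: \<tau>_def divide_right_mono)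
  then have ind: "indep_var (Pi\<^sub>M {0} (\<lambda>_. borel)) (\<lambda>\<omega>. restrict (\<lambda>i. X i \<omega>) {0})
      (Pi\<^sub>M {1..<Suc K} (\<lambda>_. borel)) (\<lambda>\<omega>. restrict (\<lambda>i. X i \<omega>) {1..<Suc K})"
    by (rule indep_var_restrict) auto
  define A' where "A' = {d \<in> space (Pi\<^sub>M {0} (\<lambda>_. borel :: real measure)). d (0::nat) \<in> A}"
  define V' where "V' = {d \<in> space (Pi\<^sub>M {1..<Suc K} (\<lambda>_. borel :: real measure)). (\<lambda>k\<in>{..<K}. d (Suc k)) \<in> V}"
  have A': "A' \<in> sets (Pi\<^sub>M {0} (\<lambda>_. borel))" unfolding A'_def by measurable
  have V': "V' \<in> sets (Pi\<^sub>M {1..<Suc K} (\<lambda>_. borel))"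
  proof -
    have [measurable]: "(\<lambda>d. \<lambda>k\<in>{..<K}. d (Suc k)) \<in> measurable (Pi\<^sub>M {1..<Suc K} (\<lambda>_. borel :: real measure)) (Pi\<^sub>M {..<K} (\<lambda>_. borel))"
      by (intro measurable_restrict measurable_component_singleton) auto
    show ?thesis unfolding V'_def by measurable
  qed
  have X0: "X 0 \<omega> = \<xi> u \<omega> - \<xi> 0 \<omega>" for \<omega> by (simp add: X_def \<tau>_def)
  have inA: "restrict (\<lambda>i. X i \<omega>) {0} \<in> A' \<longleftrightarrow> \<xi> u \<omega> - \<xi> 0 \<omega> \<in> A" for \<omega>
    by (simp add: A'_def X0 space_PiM)
  have "(\<lambda>k\<in>{..<K}. restrict (\<lambda>i. X i \<omega>) {1..<Suc K} (Suc k)) = D u \<omega>" for \<omega>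
    by (auto simp: X_def \<tau>_def D_def fun_eq_iff restrict_def)
  then have inV: "restrict (\<lambda>i. X i \<omega>) {1..<Suc K} \<in> V' \<longleftrightarrow> D u \<omega> \<in> V" for \<omega>
    by (simp add: V'_def space_PiM)
  have "prob ((\<lambda>\<omega>. (restrict (\<lambda>i. X i \<omega>) {0}, restrict (\<lambda>i. X i \<omega>) {1..<Suc K})) -` (A' \<times> V') \<inter> space M) =
      prob ((\<lambda>\<omega>. restrict (\<lambda>i. X i \<omega>) {0}) -` A' \<inter> space M) * prob ((\<lambda>\<omega>. restrict (\<lambda>i. X i \<omega>) {1..<Suc K}) -` V' \<inter> space M)"
    by (rule indep_varD[OF ind A' V'])
  then have "prob ((\<lambda>\<omega>. (\<xi> u \<omega> - \<xi> 0 \<omega>, D u \<omega>)) -` (A \<times> V) \<inter> space M) =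
      prob ((\<lambda>\<omega>. \<xi> u \<omega> - \<xi> 0 \<omega>) -` A \<inter> space M) * prob (D u -` V \<inter> space M)"
    unfolding vimage_def mem_Times_iff fst_conv snd_conv inA inV .
  also have "(\<lambda>\<omega>. (\<xi> u \<omega> - \<xi> 0 \<omega>, D u \<omega>)) -` (A \<times> V) \<inter> space M = {\<omega>\<in>space M. \<xi> u \<omega> - \<xi> 0 \<omega> \<in> A \<and> D u \<omega> \<in> V}"
    by auto
  also have "prob \<dots> = prob {\<omega>\<in>space M. \<xi> u \<omega> \<in> A \<and> D u \<omega> \<in> V}"
  proof (rule measure_eq_AE)
    show "AE \<omega> in M. (\<omega> \<in> {\<omega>\<in>space M. \<xi> u \<omega> - \<xi> 0 \<omega> \<in> A \<and> D u \<omega> \<in> V}) = (\<omega> \<in> {\<omega>\<in>space M. \<xi> u \<omega> \<in> A \<and> D u \<omega> \<in> V})"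
      using starts_at_0 by eventually_elim simp
  qed (use D[OF u] in measurable)
  also have "(\<lambda>\<omega>. \<xi> u \<omega> - \<xi> 0 \<omega>) -` A \<inter> space M = {\<omega>\<in>space M. \<xi> u \<omega> - \<xi> 0 \<omega> \<in> A}" by auto
  also have "prob \<dots> = prob {\<omega>\<in>space M. \<xi> u \<omega> \<in> A}"
  proof (rule measure_eq_AE)
    show "AE \<omega> in M. (\<omega> \<in> {\<omega>\<in>space M. \<xi> u \<omega> - \<xi> 0 \<omega> \<in> A}) = (\<omega> \<in> {\<omega>\<in>space M. \<xi> u \<omega> \<in> A})"
      using starts_at_0 by eventually_elim simp
  qed measurable
  also have "D u -` V \<inter> space M = {\<omega>\<in>space M. D u \<omega> \<in> V}" by auto
  also have "prob \<dots> = prob {\<omega>\<in>space M. D 0 \<omega> \<in> V}" by (rule law[OF u])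
  finally show ?thesis .
qed

text \<open>Two finite measures on the path samples agree as soon as they agree on cylinders. A
  cylinder involves finitely many dyadic times, all multiples of one common step, so it is an event
  of \<open>grid_increments\<close>.\<close>

lemma sampled_increments_joint:
  assumes u: "u \<ge> 0" and A: "A \<in> sets borel" and S: "S \<in> sets (Pi\<^sub>M UNIV (\<lambda>_. borel))"
  shows "emeasure M {\<omega>\<in>space M. \<xi> u \<omega> \<in> A \<and> sampled_increments u \<omega> \<in> S} =
    emeasure M {\<omega>\<in>space M. \<xi> u \<omega> \<in> A} * emeasure M {\<omega>\<in>space M. sampled_increments 0 \<omega> \<in> S}"
proof -
  let ?PP = "Pi\<^sub>M UNIV (\<lambda>_. borel) :: (nat \<times> nat \<Rightarrow> real) measure"
  note [measurable] = A S
  have xu [measurable]: "\<xi> u \<in> borel_measurable M" using random_variable_at[OF u] .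
  have si [measurable]: "sampled_increments u \<in> measurable M ?PP" "sampled_increments 0 \<in> measurable M ?PP"
    using u by auto
  \<comment> \<open>The set A is absorbed into a density and, on the other side, into a scale
    factor, so that only S varies in the uniqueness argument.\<close>
  define P where "P = distr (density M (\<lambda>\<omega>. indicator A (\<xi> u \<omega>))) ?PP (sampled_increments u)"
  define Q where "Q = scale_measure (emeasure M {\<omega>\<in>space M. \<xi> u \<omega> \<in> A}) (distr M ?PP (sampled_increments 0))"
  have Pval: "emeasure P S = emeasure M {\<omega>\<in>space M. \<xi> u \<omega> \<in> A \<and> sampled_increments u \<omega> \<in> S}"
    if [measurable]: "S \<in> sets ?PP" for S
  proof -
    have "emeasure P S = emeasure (density M (\<lambda>\<omega>. indicator A (\<xi> u \<omega>))) (sampled_increments u -` S \<inter> space M)"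
      unfolding P_def by (subst emeasure_distr) auto
    also have "\<dots> = (\<integral>\<^sup>+\<omega>\<in>sampled_increments u -` S \<inter> space M. indicator A (\<xi> u \<omega>) \<partial>M)"
      by (rule emeasure_density) auto
    also have "\<dots> = (\<integral>\<^sup>+\<omega>. indicator {\<omega>\<in>space M. \<xi> u \<omega> \<in> A \<and> sampled_increments u \<omega> \<in> S} \<omega> \<partial>M)"
      by (intro nn_integral_cong) (auto split: split_indicator)
    finally show ?thesis by (subst (asm) nn_integral_indicator) auto
  qed
  have Qval: "emeasure Q S = emeasure M {\<omega>\<in>space M. \<xi> u \<omega> \<in> A} * emeasure M {\<omega>\<in>space M. sampled_increments 0 \<omega> \<in> S}"
    if [measurable]: "S \<in> sets ?PP" for S
    unfolding Q_def by (subst emeasure_scale_measure, subst emeasure_distr) (auto intro!: arg_cong2[where f = "(*)"] arg_cong[where f = "emeasure M"])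
  have "P = Q"
  proof (rule measure_eqI_PiM_infinite)
    show "sets P = sets ?PP" "sets Q = sets ?PP" by (auto simp: P_def Q_def)
    show "finite_measure P"
      by (rule finite_measureI) (auto simp: Pval[of "space ?PP", simplified] P_def[THEN arg_cong[where f = space]] sets.top)
    fix A' :: "nat \<times> nat \<Rightarrow> real set" and J :: "(nat \<times> nat) set"
    assume J: "finite J" "J \<subseteq> UNIV" and A': "\<And>i. i \<in> J \<Longrightarrow> A' i \<in> sets borel"
    \<comment> \<open>N is a common refinement of all levels in J, and \<open>m i\<close> is the
      number of steps of that level that make up the grid time i, so that a telescoping sum recovers
      each sample.\<close>
    define N where "N = Max (insert 0 (fst ` J))"
    define m where "m = (\<lambda>i. Suc (snd i) * 2 ^ (N - fst i))"
    define K where "K = Max (insert 0 (m ` J))"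
    have N: "fst i \<le> N" and K: "m i \<le> K" if "i \<in> J" for i
      using that J by (auto simp: N_def K_def intro!: Max_ge)
    define D where "D u \<omega> = (\<lambda>k\<in>{..<K}. \<xi> (u + real (Suc k) / 2 ^ N) \<omega> - \<xi> (u + real k / 2 ^ N) \<omega>)" for u \<omega>
    have tel: "sampled_increments v \<omega> i = (\<Sum>k<m i. D v \<omega> k)" if i: "i \<in> J" for v \<omega> i
    proof -
      have "(\<Sum>k<m i. D v \<omega> k) = (\<Sum>k<m i. \<xi> (v + real (Suc k) / 2 ^ N) \<omega> - \<xi> (v + real k / 2 ^ N) \<omega>)"
        using K[OF i] by (intro sum.cong) (auto simp: D_def)
      also have "\<dots> = \<xi> (v + real (m i) / 2 ^ N) \<omega> - \<xi> v \<omega>"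
        using sum_lessThan_telescope[of "\<lambda>k. \<xi> (v + real k / 2 ^ N) \<omega>" "m i"] by simp
      also have "real (m i) / 2 ^ N = grid (fst i) (snd i)"
      proof -
        have "(2::real) ^ N = 2 ^ (N - fst i) * 2 ^ fst i" using N[OF i] by (simp flip: power_add)
        then show ?thesis by (simp add: m_def grid_def field_simps)
      qed
      finally show ?thesis by (simp add: sampled_increments_def case_prod_beta')
    qed
    define V where "V = {d \<in> space (Pi\<^sub>M {..<K} (\<lambda>_. borel :: real measure)). \<forall>i\<in>J. (\<Sum>k<m i. d k) \<in> A' i}"
    have V: "V \<in> sets (Pi\<^sub>M {..<K} (\<lambda>_. borel))"
    proof -
      have *: "(\<lambda>d. \<Sum>k<m i. d k) \<in> borel_measurable (Pi\<^sub>M {..<K} (\<lambda>_. borel :: real measure))" if "i \<in> J" for i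
        using K[OF that] by (intro borel_measurable_sum measurable_component_singleton) auto
      show ?thesis unfolding V_def
        using * A' by (intro sets.sets_Collect_finite_All[OF _ J(1)]) (auto intro: measurable_sets_Collect)
    qed
    let ?E = "prod_emb UNIV (\<lambda>_. borel) J (Pi\<^sub>E J A')"
    have E: "?E \<in> sets ?PP" using J A' by (intro sets_PiM_I) auto
    have mem: "sampled_increments v \<omega> \<in> ?E \<longleftrightarrow> D v \<omega> \<in> V" for v \<omega>
    proof -
      have "D v \<omega> \<in> space (Pi\<^sub>M {..<K} (\<lambda>_. borel))" by (auto simp: D_def space_PiM)
      moreover have "sampled_increments v \<omega> \<in> ?E \<longleftrightarrow> (\<forall>i\<in>J. sampled_increments v \<omega> i \<in> A' i)"
        by (auto simp: prod_emb_def PiE_iff)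
      ultimately show ?thesis by (auto simp: V_def tel)
    qed
    have "emeasure P ?E = ennreal (prob {\<omega>\<in>space M. \<xi> u \<omega> \<in> A \<and> D u \<omega> \<in> V})"
      unfolding Pval[OF E] mem by (simp add: emeasure_eq_measure)
    also have "\<dots> = ennreal (prob {\<omega>\<in>space M. \<xi> u \<omega> \<in> A}) * ennreal (prob {\<omega>\<in>space M. D 0 \<omega> \<in> V})"
      using grid_increments[OF u A V] by (simp add: D_def ennreal_mult)
    also have "\<dots> = emeasure Q ?E"
      unfolding Qval[OF E] mem by (simp add: emeasure_eq_measure)
    finally show "emeasure P ?E = emeasure Q ?E" .
  qed
  then show ?thesis using Pval[OF S] Qval[OF S] by simp
qed

definition restarted :: "real \<Rightarrow> real set \<Rightarrow> 'a \<Rightarrow> ennreal" where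
  "restarted u B \<omega> = (\<integral>\<^sup>+v\<in>B. ennreal (exp (\<xi> (u + v) \<omega> - \<xi> u \<omega>)) \<partial>lborel)"

definition exp_int :: "real set \<Rightarrow> 'a \<Rightarrow> ennreal" where
  "exp_int B \<omega> = (\<integral>\<^sup>+v\<in>B. ennreal (exp (\<xi> v \<omega>)) \<partial>lborel)"

lemma restarted_eq:
  assumes "u \<ge> 0" "B \<subseteq> {0..}" "\<omega> \<in> space M"
  shows "restarted u B \<omega> = sampled_functional B (sampled_increments u \<omega>)"
  using sampled_functional_cadlag[OF cadlag_shift[OF cadlag_paths[OF assms(3)] assms(1)] assms(2), of "\<xi> u \<omega>"]
  by (simp add: restarted_def sampled_increments_def)

text \<open>The integrals are one and the same measurable functional of the sampled increments,
  started at u or at 0, so independence and equality in law pass from the samples to them.\<close>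

lemma
  assumes B [measurable]: "B \<in> sets borel" and B0: "B \<subseteq> {0..}"
  shows measurable_exp_int: "exp_int B \<in> borel_measurable M"
    and measurable_restarted: "u \<ge> 0 \<Longrightarrow> restarted u B \<in> borel_measurable M"
    and restarted_joint: "u \<ge> 0 \<Longrightarrow> distr M (borel \<Otimes>\<^sub>M borel) (\<lambda>\<omega>. (\<xi> u \<omega>, restarted u B \<omega>)) =
      distr M borel (\<xi> u) \<Otimes>\<^sub>M distr M borel (exp_int B)"
proof -
  let ?PP = "Pi\<^sub>M UNIV (\<lambda>_. borel) :: (nat \<times> nat \<Rightarrow> real) measure"
  have si [measurable]: "sampled_increments u \<in> measurable M ?PP" if "u \<ge> 0" for u
    using that by (rule measurable_sampled_increments)
  show mr: "restarted u B \<in> borel_measurable M" if u: "u \<ge> 0" for u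
    using u by (subst measurable_cong[OF restarted_eq[OF u B0]]) auto
  have exp_int: "exp_int B \<omega> = sampled_functional B (\<lambda>(n, j). \<xi> (grid n j) \<omega>)" if "\<omega> \<in> space M" for \<omega>
    using sampled_functional_cadlag[OF cadlag_paths[OF that] B0] by (simp add: exp_int_def)
  have mg [measurable]: "(\<lambda>\<omega>. \<lambda>(n, j). \<xi> (grid n j) \<omega>) \<in> measurable M ?PP"
    by (rule measurable_PiM_single') (auto simp: case_prod_beta' intro!: random_variable_at grid_nonneg)
  show me [measurable]: "exp_int B \<in> borel_measurable M"
    by (subst measurable_cong[OF exp_int]) measurable
  show "distr M (borel \<Otimes>\<^sub>M borel) (\<lambda>\<omega>. (\<xi> u \<omega>, restarted u B \<omega>)) =
      distr M borel (\<xi> u) \<Otimes>\<^sub>M distr M borel (exp_int B)" if u: "u \<ge> 0"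
  proof (rule pair_measure_eqI[symmetric])
    note [measurable] = mr[OF u] random_variable_at[OF u]
    fix A S assume "A \<in> sets (distr M borel (\<xi> u))" "S \<in> sets (distr M borel (exp_int B))"
    then have A [measurable]: "A \<in> sets borel" and S [measurable]: "S \<in> sets borel" by auto
    define S' where "S' = sampled_functional B -` S \<inter> space ?PP"
    have S': "S' \<in> sets ?PP" unfolding S'_def by measurable
    have "emeasure M {\<omega>\<in>space M. \<xi> u \<omega> \<in> A \<and> restarted u B \<omega> \<in> S} =
        emeasure M {\<omega>\<in>space M. \<xi> u \<omega> \<in> A \<and> sampled_increments u \<omega> \<in> S'}"
      by (intro arg_cong[where f = "emeasure M"]) (auto simp: restarted_eq[OF u B0] S'_def space_PiM)
    also have "\<dots> = emeasure M {\<omega>\<in>space M. \<xi> u \<omega> \<in> A} * emeasure M {\<omega>\<in>space M. sampled_increments 0 \<omega> \<in> S'}"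
      by (rule sampled_increments_joint[OF u A S'])
    \<comment> \<open>The samples at time 0 subtract \<xi> 0, whereas \<open>exp_int\<close> does
      not; the two agree almost surely.\<close>
    also have "emeasure M {\<omega>\<in>space M. sampled_increments 0 \<omega> \<in> S'} = emeasure M {\<omega>\<in>space M. exp_int B \<omega> \<in> S}"
    proof (rule emeasure_eq_AE)
      show "AE \<omega> in M. (\<omega> \<in> {\<omega>\<in>space M. sampled_increments 0 \<omega> \<in> S'}) = (\<omega> \<in> {\<omega>\<in>space M. exp_int B \<omega> \<in> S})"
        using starts_at_0 AE_space
        by eventually_elim (simp add: exp_int sampled_increments_def S'_def space_PiM)
    qed (use S' in measurable)
    finally show "emeasure (distr M borel (\<xi> u)) A * emeasure (distr M borel (exp_int B)) S =
        emeasure (distr M (borel \<Otimes>\<^sub>M borel) (\<lambda>\<omega>. (\<xi> u \<omega>, restarted u B \<omega>))) (A \<times> S)"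
      by (simp add: emeasure_distr vimage_def Int_def conj_commute conj_left_commute)
  next
    show "sigma_finite_measure (distr M borel (\<xi> u))" "sigma_finite_measure (distr M borel (exp_int B))"
      using random_variable_at[OF u] me by (simp_all add: prob_space_imp_sigma_finite prob_space_distr)
    show "sets (distr M borel (\<xi> u) \<Otimes>\<^sub>M distr M borel (exp_int B)) =
        sets (distr M (borel \<Otimes>\<^sub>M borel) (\<lambda>\<omega>. (\<xi> u \<omega>, restarted u B \<omega>)))"
      unfolding sets_distr by (rule sets_pair_measure_cong) auto
  qed
qed

lemma nn_integral_restarted:
  assumes u: "u \<ge> 0" and B: "B \<in> sets borel" "B \<subseteq> {0..}"
    and [measurable]: "f \<in> borel_measurable borel" "h \<in> borel_measurable borel"
  shows "(\<integral>\<^sup>+\<omega>. f (\<xi> u \<omega>) * h (restarted u B \<omega>) \<partial>M) =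
    (\<integral>\<^sup>+\<omega>. f (\<xi> u \<omega>) \<partial>M) * (\<integral>\<^sup>+\<omega>. h (exp_int B \<omega>) \<partial>M)"
proof -
  note [measurable] = measurable_restarted[OF B u] random_variable_at[OF u] measurable_exp_int[OF B]
  interpret E: prob_space "distr M borel (exp_int B)" by (rule prob_space_distr) measurable
  have "(\<integral>\<^sup>+\<omega>. f (\<xi> u \<omega>) * h (restarted u B \<omega>) \<partial>M) =
      (\<integral>\<^sup>+x. f (fst x) * h (snd x) \<partial>distr M (borel \<Otimes>\<^sub>M borel) (\<lambda>\<omega>. (\<xi> u \<omega>, restarted u B \<omega>)))"
    by (subst nn_integral_distr) auto
  also have "\<dots> = (\<integral>\<^sup>+x. \<integral>\<^sup>+y. f x * h y \<partial>distr M borel (exp_int B) \<partial>distr M borel (\<xi> u))"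
    unfolding restarted_joint[OF B u] by (subst E.nn_integral_fst[symmetric]) auto
  also have "\<dots> = (\<integral>\<^sup>+\<omega>. f (\<xi> u \<omega>) \<partial>M) * (\<integral>\<^sup>+\<omega>. h (exp_int B \<omega>) \<partial>M)"
    by (simp add: nn_integral_cmult nn_integral_multc nn_integral_distr)
  finally show ?thesis .
qed

lemma integral_restarted:
  fixes f :: "real \<Rightarrow> complex" and h :: "ennreal \<Rightarrow> complex"
  assumes u: "u \<ge> 0" and B: "B \<in> sets borel" "B \<subseteq> {0..}"
    and [measurable]: "f \<in> borel_measurable borel" "h \<in> borel_measurable borel"
    and int: "integrable M (\<lambda>\<omega>. f (\<xi> u \<omega>))" "integrable M (\<lambda>\<omega>. h (exp_int B \<omega>))"
  shows "(\<integral>\<omega>. f (\<xi> u \<omega>) * h (restarted u B \<omega>) \<partial>M) =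
    (\<integral>\<omega>. f (\<xi> u \<omega>) \<partial>M) * (\<integral>\<omega>. h (exp_int B \<omega>) \<partial>M)"
proof -
  note [measurable] = measurable_restarted[OF B u] random_variable_at[OF u] measurable_exp_int[OF B]
  interpret E: prob_space "distr M borel (exp_int B)" by (rule prob_space_distr) measurable
  interpret X: prob_space "distr M borel (\<xi> u)" by (rule prob_space_distr) measurable
  interpret XE: pair_sigma_finite "distr M borel (\<xi> u)" "distr M borel (exp_int B)" ..
  have int': "integrable (distr M borel (\<xi> u)) f" "integrable (distr M borel (exp_int B)) h"
    using int by (simp_all add: integrable_distr_eq)
  have "(\<integral>\<omega>. f (\<xi> u \<omega>) * h (restarted u B \<omega>) \<partial>M) =
      (\<integral>x. f (fst x) * h (snd x) \<partial>distr M (borel \<Otimes>\<^sub>M borel) (\<lambda>\<omega>. (\<xi> u \<omega>, restarted u B \<omega>)))"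
    by (subst integral_distr) auto
  also have "\<dots> = (\<integral>x. \<integral>y. f x * h y \<partial>distr M borel (exp_int B) \<partial>distr M borel (\<xi> u))"
    unfolding restarted_joint[OF B u]
  proof (subst XE.integral_fst'[symmetric])
    show "integrable (distr M borel (\<xi> u) \<Otimes>\<^sub>M distr M borel (exp_int B)) (\<lambda>x. f (fst x) * h (snd x))"
      by (rule integrable_pair_bound[OF E.sigma_finite_measure_axioms _ integrable_norm[OF int'(1)] integrable_norm[OF int'(2)]])
         (auto simp: norm_mult)
  qed simp
  also have "\<dots> = (\<integral>\<omega>. f (\<xi> u \<omega>) \<partial>M) * (\<integral>\<omega>. h (exp_int B \<omega>) \<partial>M)"
    by (simp add: integral_distr)
  finally show ?thesis .
qed

end

section \<open>Substitution along the remaining mass\<close>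

text \<open>The probability integral transform for a finite measure without atoms. The tail mass is
  the total mass minus a continuous distribution function, whose superlevel sets are closed
  half-lines of known mass, so the distribution function of the image can be read off.\<close>

lemma distr_tail_mass:
  fixes \<nu> :: "real measure"
  assumes "finite_borel_measure \<nu>" and atom: "\<And>x. measure \<nu> {x} = 0"
  shows "distr \<nu> borel (\<lambda>u. measure \<nu> {u<..}) = density lborel (indicator {0..measure \<nu> UNIV})"
proof -
  interpret finite_borel_measure \<nu> by fact
  have sets_\<nu> [simp, measurable_cong]: "sets \<nu> = sets borel" by (rule M_is_borel)
  define T where "T = measure \<nu> UNIV"
  have cont: "isCont (cdf \<nu>) x" for x using atom by (simp add: isCont_cdf)
  then have contUNIV: "continuous_on UNIV (cdf \<nu>)" by (simp add: continuous_at_imp_continuous_on)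
  have [measurable]: "cdf \<nu> \<in> borel_measurable borel" using contUNIV by (rule borel_measurable_continuous_onI)
  have bot: "(cdf \<nu> \<longlongrightarrow> 0) at_bot" by (rule cdf_lim_at_bot)
  have top: "(cdf \<nu> \<longlongrightarrow> T) at_top" using cdf_lim_at_top by (simp add: T_def borel_UNIV)
  have mono: "cdf \<nu> x \<le> cdf \<nu> y" if "x \<le> y" for x y using that by (rule cdf_nondecreasing)
  have T0: "T \<ge> 0" by (simp add: T_def)
  have cdfT: "cdf \<nu> u \<le> T" for u unfolding cdf_def T_def by (intro finite_measure_mono) auto
  have G: "measure \<nu> {u<..} = T - cdf \<nu> u" for u
  proof -
    have "measure \<nu> (UNIV - {..u}) = T - cdf \<nu> u"
      unfolding T_def cdf_def using finite_measure_compl[of "{..u}"] by (simp add: borel_UNIV)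
    then show ?thesis by (simp add: Compl_eq_Diff_UNIV[symmetric])
  qed
  have val: "measure \<nu> {u. T - cdf \<nu> u \<le> y} = max 0 (min y T)" for y
  proof (cases "0 \<le> y \<and> y < T")
    case False
    then consider "y < 0" | "y \<ge> T" by linarith
    then show ?thesis
    proof cases
      case 1
      then have "{u. T - cdf \<nu> u \<le> y} = {}" using cdfT by (auto simp: not_le intro: less_le_trans)
      then show ?thesis using 1 by simp
    next
      case 2
      then have "{u. T - cdf \<nu> u \<le> y} = UNIV" using cdf_nonneg by (auto intro: order_trans[of _ T])
      then show ?thesis using 2 T0 by (simp add: T_def)
    qed
  next
    case True
    define t where "t = T - y"
    have t: "0 < t" "t \<le> T" using True by (auto simp: t_def)
    define E where "E = {u. t \<le> cdf \<nu> u}"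
    have E: "{u. T - cdf \<nu> u \<le> y} = E" by (auto simp: E_def t_def)
    show ?thesis
    proof (cases "E = {}")
      case empty: True
      \<comment> \<open>An empty E means that the distribution function never reaches t; as it tends
        to the total mass T, this forces t = T.\<close>
      have "y = 0"
      proof (rule ccontr)
        assume "y \<noteq> 0"
        then have "t < T" using True by (simp add: t_def)
        from order_tendstoD(1)[OF top this] obtain u where "t < cdf \<nu> u" using eventually_happens' trivial_limit_at_top_linorder by blast
        then show False using empty by (auto simp: E_def dest: less_imp_le)
      qed
      then show ?thesis using empty E True by simp
    next
      case False
      have "eventually (\<lambda>u. cdf \<nu> u < t) at_bot" using order_tendstoD(2)[OF bot t(1)] .
      then obtain b where b: "\<And>u. u \<le> b \<Longrightarrow> cdf \<nu> u < t" by (auto simp: eventually_at_bot_linorder)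
      have bdd: "bdd_below E" by (intro bdd_belowI[of _ b]) (metis E_def b mem_Collect_eq not_le nle_le)
      have "closed E" unfolding E_def using contUNIV by (intro closed_Collect_le continuous_on_const)
      then have a: "Inf E \<in> E" using bdd False by (intro closed_contains_Inf)
      define a where "a = Inf E"
      have Ea: "E = {a..}"
      proof (intro set_eqI iffI)
        fix u assume "u \<in> E" then show "u \<in> {a..}" using bdd by (auto simp: a_def intro: cInf_lower)
      next
        fix u assume "u \<in> {a..}" then show "u \<in> E" using mono[of a u] a by (auto simp: E_def a_def)
      qed
      \<comment> \<open>A value above t would, by continuity, put points to the left of a into E,
        against the minimality of a.\<close>
      have "cdf \<nu> a = t"
      proof (rule ccontr)
        assume "cdf \<nu> a \<noteq> t"
        then have "t < cdf \<nu> a" using a by (simp add: E_def a_def)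
        moreover have "(cdf \<nu> \<longlongrightarrow> cdf \<nu> a) (at_left a)"
          using cont[of a] by (simp add: isCont_def filterlim_at_split)
        ultimately have "eventually (\<lambda>u. t < cdf \<nu> u) (at_left a)" by (rule order_tendstoD(1)[rotated])
        moreover have "eventually (\<lambda>u. u < a) (at_left a)" by (simp add: eventually_at_filter)
        ultimately have "eventually (\<lambda>u. t < cdf \<nu> u \<and> u < a) (at_left a)" by (rule eventually_conj)
        then obtain u where "t < cdf \<nu> u" "u < a"
          using eventually_happens'[OF trivial_limit_at_left_real] by blast
        then have "u \<in> E" by (simp add: E_def)
        then show False using Ea \<open>u < a\<close> by simp
      qed
      moreover have "measure \<nu> E = measure \<nu> {a<..} + measure \<nu> {a}"
        unfolding Ea by (subst finite_measure_Union[symmetric]) (auto intro!: arg_cong[where f = "measure \<nu>"])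
      ultimately show ?thesis using True atom[of a] by (simp add: E G t_def)
    qed
  qed
  have [measurable]: "(\<lambda>u. T - cdf \<nu> u) \<in> borel_measurable \<nu>" by simp
  have "distr \<nu> borel (\<lambda>u. T - cdf \<nu> u) = density lborel (indicator {0..T})"
  proof (rule cdf_unique')
    show "finite_borel_measure (distr \<nu> borel (\<lambda>u. T - cdf \<nu> u))"
      by (intro finite_borel_measure.intro finite_measure_distr finite_borel_measure_axioms.intro) auto
    have d: "emeasure (density lborel (indicator {0..T})) S = emeasure lborel ({0..T} \<inter> S)" if "S \<in> sets borel" for S
      using that by (subst emeasure_density) (auto simp: indicator_inter_arith[symmetric])
    show "finite_borel_measure (density lborel (indicator {0..T}))"
      by (intro finite_borel_measure.intro finite_measureI finite_borel_measure_axioms.intro) (auto simp: d T0)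
    show "cdf (distr \<nu> borel (\<lambda>u. T - cdf \<nu> u)) = cdf (density lborel (indicator {0..T}))"
    proof
      fix y
      have "cdf (distr \<nu> borel (\<lambda>u. T - cdf \<nu> u)) y = measure \<nu> {u. T - cdf \<nu> u \<le> y}"
        unfolding cdf_def[of "distr \<nu> borel (\<lambda>u. T - cdf \<nu> u)"] by (subst measure_distr) (auto intro!: arg_cong[where f = "measure \<nu>"] simp: borel_UNIV)
      also have "\<dots> = cdf (density lborel (indicator {0..T})) y"
      proof -
        have "{0..T} \<inter> {..y} = {0..min y T}" by auto
        then have "measure (density lborel (indicator {0..T})) {..y} = max 0 (min y T)"
          using T0 by (simp add: measure_def d emeasure_lborel_Icc_eq max_def min.commute)
        then show ?thesis by (simp add: cdf_def[of "density lborel (indicator {0..T})"] val)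
      qed
      finally show "cdf (distr \<nu> borel (\<lambda>u. T - cdf \<nu> u)) y = cdf (density lborel (indicator {0..T})) y" .
    qed
  qed
  then show ?thesis by (simp add: G T_def)
qed

text \<open>The substitution r = G u, carried out as a push-forward: the measure with density f is
  sent by its own tail mass to Lebesgue measure on [0, T]. This handles integrands f that are merely
  measurable.\<close>

lemma tail_substitution:
  fixes f :: "real \<Rightarrow> real"
  assumes [measurable]: "f \<in> borel_measurable borel" and f0: "\<And>u. f u \<ge> 0"
    and fin: "(\<integral>\<^sup>+u. ennreal (f u) \<partial>lborel) < \<infinity>"
  defines "G \<equiv> \<lambda>u. enn2real (\<integral>\<^sup>+v\<in>{u<..}. ennreal (f v) \<partial>lborel)"
    and "T \<equiv> enn2real (\<integral>\<^sup>+u. ennreal (f u) \<partial>lborel)"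
  shows nn_integral_tail_substitution: "h \<in> borel_measurable borel \<Longrightarrow>
      (\<integral>\<^sup>+u. ennreal (f u) * h (G u) \<partial>lborel) = (\<integral>\<^sup>+r\<in>{0..T}. h r \<partial>lborel)"
    and integral_tail_substitution: "k \<in> borel_measurable borel \<Longrightarrow>
      (LBINT u. f u *\<^sub>R (k (G u) :: complex)) = (LBINT r:{0..T}. k r)"
proof -
  define \<nu> where "\<nu> = density lborel (\<lambda>u. ennreal (f u))"
  have em: "emeasure \<nu> S = (\<integral>\<^sup>+v\<in>S. ennreal (f v) \<partial>lborel)" if "S \<in> sets borel" for S
    unfolding \<nu>_def using that by (subst emeasure_density) auto
  have fb: "finite_borel_measure \<nu>"
    using fin by (intro finite_borel_measure.intro finite_measureI finite_borel_measure_axioms.intro)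
      (auto simp: \<nu>_def emeasure_density)
  have GT: "G u = measure \<nu> {u<..}" "T = measure \<nu> UNIV" for u
    by (simp_all add: G_def T_def measure_def em)
  have atom: "measure \<nu> {x} = 0" for x
    by (simp add: measure_def em nn_integral_0_iff_AE)
  interpret finite_borel_measure \<nu> by fact
  have [measurable_cong]: "sets \<nu> = sets borel" by (simp add: \<nu>_def)
  have law: "distr \<nu> borel G = density lborel (indicator {0..T})"
    using distr_tail_mass[OF fb atom] by (simp add: GT[abs_def])
  have "mono (\<lambda>u. - G u)" unfolding GT by (auto intro!: monoI finite_measure_mono simp: M_is_borel)
  then have "(\<lambda>u. - (- G u)) \<in> borel_measurable borel" by (intro borel_measurable_uminus borel_measurable_mono)
  then have [measurable]: "G \<in> borel_measurable borel" by simp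
  show "(\<integral>\<^sup>+u. ennreal (f u) * h (G u) \<partial>lborel) = (\<integral>\<^sup>+r\<in>{0..T}. h r \<partial>lborel)"
    if [measurable]: "h \<in> borel_measurable borel" for h
  proof -
    have "(\<integral>\<^sup>+u. ennreal (f u) * h (G u) \<partial>lborel) = (\<integral>\<^sup>+u. h (G u) \<partial>\<nu>)"
      unfolding \<nu>_def by (subst nn_integral_density) auto
    also have "\<dots> = (\<integral>\<^sup>+r. h r \<partial>distr \<nu> borel G)" by (subst nn_integral_distr) auto
    also have "\<dots> = (\<integral>\<^sup>+r. indicator {0..T} r * h r \<partial>lborel)"
      unfolding law by (subst nn_integral_density) auto
    finally show ?thesis by (simp add: mult.commute)
  qed
  show "(LBINT u. f u *\<^sub>R k (G u)) = (LBINT r:{0..T}. k r)"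
    if [measurable]: "k \<in> borel_measurable borel" for k :: "real \<Rightarrow> complex"
  proof -
    have "(LBINT u. f u *\<^sub>R k (G u)) = (\<integral>u. k (G u) \<partial>\<nu>)"
      unfolding \<nu>_def using f0 by (subst integral_density) auto
    also have "\<dots> = (\<integral>r. k r \<partial>distr \<nu> borel G)" by (subst integral_distr) auto
    also have "\<dots> = (LBINT r:{0..T}. k r)"
      unfolding law set_lebesgue_integral_def ennreal_indicator[symmetric] by (subst integral_density) auto
    finally show ?thesis .
  qed
qed

lemma nn_integral_powr_Icc:
  fixes T p :: real
  assumes "T \<ge> 0" "p > 0"
  shows "(\<integral>\<^sup>+r\<in>{0..T}. ennreal (p * r powr (p - 1)) \<partial>lborel) = ennreal (T powr p)"
proof -
  have "((\<lambda>r. p * r powr (p - 1)) has_integral p * (T powr (p - 1 + 1) / (p - 1 + 1))) {0..T}"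
    using assms by (intro has_integral_mult_right has_integral_powr_from_0) auto
  then have "((\<lambda>r. p * r powr (p - 1)) has_integral T powr p) {0..T}" using assms by simp
  then have "((\<lambda>r. if r \<in> {0..T} then p * r powr (p - 1) else 0) has_integral T powr p) UNIV"
    by (simp only: has_integral_restrict_UNIV)
  also have "(\<lambda>r. if r \<in> {0..T} then p * r powr (p - 1) else 0) = (\<lambda>r. indicator {0..T} r * (p * r powr (p - 1)))"
    by (auto simp: fun_eq_iff indicator_def)
  finally have "(\<integral>\<^sup>+r. ennreal (indicator {0..T} r * (p * r powr (p - 1))) \<partial>lborel) = ennreal (T powr p)"
    using assms by (intro nn_integral_has_integral_lborel) auto
  moreover have "(\<integral>\<^sup>+r\<in>{0..T}. ennreal (p * r powr (p - 1)) \<partial>lborel) =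
      (\<integral>\<^sup>+r. ennreal (indicator {0..T} r * (p * r powr (p - 1))) \<partial>lborel)"
    by (intro nn_integral_cong) (auto split: split_indicator)
  ultimately show ?thesis by simp
qed

section \<open>Joint measurability of the path and the identity for moments\<close>

context levy_process
begin

text \<open>Time is clamped at 0 because integrals over time run over the whole line, while
  measurability and path regularity are assumed only at nonnegative times.\<close>

definition path_value :: "real \<times> 'a \<Rightarrow> real" where "path_value = (\<lambda>(u, \<omega>). \<xi> (max 0 u) \<omega>)"

text \<open>Right-continuity exhibits the path as a pointwise limit of its dyadic samples, each of
  which is jointly measurable because it involves countably many fixed times.\<close>

lemma measurable_path [measurable]: "path_value \<in> borel_measurable (borel \<Otimes>\<^sub>M M)"
proof (rule borel_measurable_LIMSEQ_real)
  fix x assume "x \<in> space ((borel :: real measure) \<Otimes>\<^sub>M M)"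
  then have "snd x \<in> space M" by (auto simp: space_pair_measure)
  from cadlag_grid[OF cadlag_paths[OF this], of "max 0 (fst x)"]
  show "(\<lambda>n. \<xi> (grid n (nat \<lfloor>2 ^ n * max 0 (fst x)\<rfloor>)) (snd x)) \<longlonglongrightarrow> path_value x"
    by (simp add: path_value_def case_prod_beta')
next
  fix n :: nat
  show "(\<lambda>x. \<xi> (grid n (nat \<lfloor>2 ^ n * max 0 (fst x)\<rfloor>)) (snd x)) \<in> borel_measurable ((borel :: real measure) \<Otimes>\<^sub>M M)"
  proof (rule measurable_compose_countable'[where I = UNIV and g = "\<lambda>x. nat \<lfloor>2 ^ n * max 0 (fst x)\<rfloor>" and f = "\<lambda>j x. \<xi> (grid n j) (snd x)"])
    show "(\<lambda>x. \<xi> (grid n j) (snd x)) \<in> borel_measurable ((borel :: real measure) \<Otimes>\<^sub>M M)" for j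
      by (rule measurable_compose[OF measurable_snd random_variable_at[OF grid_nonneg]])
  qed auto
qed

lemma path_eq: "u \<ge> 0 \<Longrightarrow> path_value (u, \<omega>) = \<xi> u \<omega>"
  by (simp add: path_value_def)

lemma measurable_path_at: "\<omega> \<in> space M \<Longrightarrow> (\<lambda>u. path_value (u, \<omega>)) \<in> borel_measurable borel"
  by measurable

text \<open>The strict inequality matches the open interval after u in \<open>tail\<close>. For the
  half-line the result is therefore the open half-line, which differs from {0..} by a null
  set.\<close>

definition remaining :: "real set \<Rightarrow> real \<Rightarrow> real set" where
  "remaining B u = {v. 0 < v \<and> u + v \<in> B}"

lemma remaining_props:
  assumes [measurable]: "B \<in> sets borel"
  shows "remaining B u \<in> sets borel" "remaining B u \<subseteq> {0..}"
  unfolding remaining_def by (measurable, auto)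

definition tail :: "real set \<Rightarrow> real \<Rightarrow> 'a \<Rightarrow> real" where
  "tail B u \<omega> = enn2real (\<integral>\<^sup>+v\<in>{u<..}. ennreal (indicator B v * exp (path_value (v, \<omega>))) \<partial>lborel)"

lemma measurable_tail [measurable]:
  assumes [measurable]: "B \<in> sets borel"
  shows "(\<lambda>x. tail B (fst x) (snd x)) \<in> borel_measurable (borel \<Otimes>\<^sub>M M)"
proof -
  have [measurable]: "(\<lambda>y. ennreal (indicator B (snd y) * exp (path_value (snd y, snd (fst y)))) * indicator {fst (fst y)<..} (snd y))
      \<in> borel_measurable ((borel \<Otimes>\<^sub>M M) \<Otimes>\<^sub>M lborel)"
    by (simp add: indicator_def) measurable
  have [measurable]: "(\<lambda>x. \<integral>\<^sup>+v\<in>{fst x<..}. ennreal (indicator B v * exp (path_value (v, snd x))) \<partial>lborel) \<in> borel_measurable (borel \<Otimes>\<^sub>M M)"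
    by (rule lborel.borel_measurable_nn_integral) (simp add: case_prod_beta')
  show ?thesis unfolding tail_def by measurable
qed

lemma tail_eq:
  assumes u: "u \<ge> 0" and B: "B \<in> sets borel" "B \<subseteq> {0..}" and \<omega>: "\<omega> \<in> space M"
  shows "tail B u \<omega> = exp (\<xi> u \<omega>) * enn2real (restarted u (remaining B u) \<omega>)"
proof -
  note [measurable] = B(1) remaining_props(1)[OF B(1), of u] measurable_path_at[OF \<omega>]
  have "(\<integral>\<^sup>+v\<in>{u<..}. ennreal (indicator B v * exp (path_value (v, \<omega>))) \<partial>lborel) =
      (\<integral>\<^sup>+v. ennreal (indicator B (u + v) * exp (path_value (u + v, \<omega>))) * indicator {u<..} (u + v) \<partial>lborel)"
    using nn_integral_real_affine[of "\<lambda>v. ennreal (indicator B v * exp (path_value (v, \<omega>))) * indicator {u<..} v" 1 u] by simp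
  also have "\<dots> = (\<integral>\<^sup>+v. ennreal (exp (\<xi> u \<omega>)) * (ennreal (exp (\<xi> (u + v) \<omega> - \<xi> u \<omega>)) * indicator (remaining B u) v) \<partial>lborel)"
    using u by (intro nn_integral_cong)
      (auto simp: remaining_def path_eq exp_diff indicator_def ennreal_mult[symmetric] simp flip: mult.assoc)
  also have "\<dots> = ennreal (exp (\<xi> u \<omega>)) * restarted u (remaining B u) \<omega>"
    unfolding restarted_def
  proof (rule nn_integral_cmult)
    have "(\<lambda>v. ennreal (exp (path_value (u + v, \<omega>) - \<xi> u \<omega>)) * indicator (remaining B u) v) \<in> borel_measurable lborel" by measurable
    also have "(\<lambda>v. ennreal (exp (path_value (u + v, \<omega>) - \<xi> u \<omega>)) * indicator (remaining B u) v) =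
        (\<lambda>v. ennreal (exp (\<xi> (u + v) \<omega> - \<xi> u \<omega>)) * indicator (remaining B u) v)"
      using u by (auto simp: fun_eq_iff indicator_def remaining_def path_eq)
    finally show "(\<lambda>v. ennreal (exp (\<xi> (u + v) \<omega> - \<xi> u \<omega>)) * indicator (remaining B u) v) \<in> borel_measurable lborel" .
  qed
  finally show ?thesis by (simp add: tail_def enn2real_mult)
qed

lemma exp_int_path:
  assumes "B \<subseteq> {0..}"
  shows "exp_int B \<omega> = (\<integral>\<^sup>+v. ennreal (indicator B v * exp (path_value (v, \<omega>))) \<partial>lborel)"
  unfolding exp_int_def using assms by (intro nn_integral_cong) (auto simp: indicator_def path_eq)

text \<open>Two conventions are in force: \<open>enn2real\<close> sends infinity to 0, and
  \<open>0 powr p\<close> is 0 even for negative p. The moment therefore sees only the event that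
  the integral is positive and finite.\<close>

abbreviation power_moment :: "real set \<Rightarrow> real \<Rightarrow> ennreal" where
  "power_moment B p \<equiv> (\<integral>\<^sup>+\<omega>. ennreal (enn2real (exp_int B \<omega>) powr p) \<partial>M)"

abbreviation exp_moment :: "real \<Rightarrow> real \<Rightarrow> ennreal" where
  "exp_moment l t \<equiv> (\<integral>\<^sup>+\<omega>. ennreal (exp (l * \<xi> t \<omega>)) \<partial>M)"

text \<open>The power is written as the integral of p * r powr (p - 1), substituted along the tail,
  and Tonelli with independence does the rest. All terms are nonnegative, so the identity may read
  infinity on both sides. A general B allows finite horizons, for which finiteness holds on every
  path.\<close>

lemma moment_identity:
  assumes B: "B \<in> sets borel" "B \<subseteq> {0..}" and fin: "AE \<omega> in M. exp_int B \<omega> < \<infinity>" and p: "p > 0"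
  shows "power_moment B p =
    (\<integral>\<^sup>+u\<in>B. ennreal p * exp_moment p u *
      power_moment (remaining B u) (p - 1) \<partial>lborel)"
proof -
  note [measurable] = B(1) measurable_exp_int[OF B]
  interpret P: pair_sigma_finite lborel M by standard
  define F where "F u \<omega> = ennreal (indicator B u * exp (path_value (u, \<omega>))) * ennreal (p * tail B u \<omega> powr (p - 1))" for u \<omega>
  have meas [measurable]: "case_prod F \<in> borel_measurable (lborel \<Otimes>\<^sub>M M)"
  proof -
    have "(\<lambda>x. tail B (fst x) (snd x)) \<in> borel_measurable (lborel \<Otimes>\<^sub>M M)" using measurable_tail[OF B(1)] by simp
    moreover have "path_value \<in> borel_measurable (lborel \<Otimes>\<^sub>M M)" using measurable_path by simp
    ultimately show ?thesis unfolding F_def case_prod_beta' by measurable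
  qed
  have "power_moment B p = (\<integral>\<^sup>+\<omega>. \<integral>\<^sup>+u. F u \<omega> \<partial>lborel \<partial>M)"
  proof (rule nn_integral_cong_AE)
    show "AE \<omega> in M. ennreal (enn2real (exp_int B \<omega>) powr p) = (\<integral>\<^sup>+u. F u \<omega> \<partial>lborel)"
      using fin AE_space
    proof eventually_elim
      case (elim \<omega>)
      note [measurable] = measurable_path_at[OF elim(2)]
      have "(\<integral>\<^sup>+u. F u \<omega> \<partial>lborel) = (\<integral>\<^sup>+r\<in>{0..enn2real (exp_int B \<omega>)}. ennreal (p * r powr (p - 1)) \<partial>lborel)"
        unfolding F_def tail_def exp_int_path[OF B(2)]
        by (rule nn_integral_tail_substitution) (use elim(1) in \<open>auto simp: exp_int_path[OF B(2)]\<close>)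
      then show ?case using p by (simp add: nn_integral_powr_Icc)
    qed
  qed
  also have "\<dots> = (\<integral>\<^sup>+u. \<integral>\<^sup>+\<omega>. F u \<omega> \<partial>M \<partial>lborel)"
    by (rule P.Fubini'[OF meas])
  also have "\<dots> = (\<integral>\<^sup>+u\<in>B. ennreal p * exp_moment p u *
      power_moment (remaining B u) (p - 1) \<partial>lborel)"
  proof (rule nn_integral_cong)
    fix u
    show "(\<integral>\<^sup>+\<omega>. F u \<omega> \<partial>M) = ennreal p * exp_moment p u *
      power_moment (remaining B u) (p - 1) * indicator B u"
    proof (cases "u \<in> B")
      case True
      then have u: "u \<ge> 0" using B by auto
      note [measurable] = random_variable_at[OF u] measurable_restarted[OF remaining_props[OF B(1), of u] u]
      have "(\<integral>\<^sup>+\<omega>. F u \<omega> \<partial>M) = (\<integral>\<^sup>+\<omega>. ennreal p * (ennreal (exp (p * \<xi> u \<omega>)) * ennreal (enn2real (restarted u (remaining B u) \<omega>) powr (p - 1))) \<partial>M)"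
      proof (rule nn_integral_cong)
        fix \<omega> assume \<omega>: "\<omega> \<in> space M"
        have "exp (\<xi> u \<omega>) * exp (\<xi> u \<omega>) powr (p - 1) = exp (p * \<xi> u \<omega>)"
          by (simp add: exp_powr_real exp_add[symmetric] algebra_simps)
        then have "exp (\<xi> u \<omega>) * (p * tail B u \<omega> powr (p - 1)) = p * (exp (p * \<xi> u \<omega>) * enn2real (restarted u (remaining B u) \<omega>) powr (p - 1))"
          unfolding tail_eq[OF u B \<omega>] by (simp add: powr_mult mult_ac)
        then show "F u \<omega> = ennreal p * (ennreal (exp (p * \<xi> u \<omega>)) * ennreal (enn2real (restarted u (remaining B u) \<omega>) powr (p - 1)))"
          using True u p by (simp add: F_def path_eq ennreal_mult[symmetric])
      qed
      also have "\<dots> = ennreal p * (\<integral>\<^sup>+\<omega>. ennreal (exp (p * \<xi> u \<omega>)) * ennreal (enn2real (restarted u (remaining B u) \<omega>) powr (p - 1)) \<partial>M)"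
        by (rule nn_integral_cmult) measurable
      also have "\<dots> = ennreal p * (exp_moment p u *
          power_moment (remaining B u) (p - 1))"
        by (subst nn_integral_restarted[OF u remaining_props[OF B(1)], where f = "\<lambda>x. ennreal (exp (p * x))" and h = "\<lambda>r. ennreal (enn2real r powr (p - 1))"]) auto
      finally show ?thesis using True by (simp add: mult.assoc)
    qed (simp add: F_def)
  qed
  finally show ?thesis .
qed

end

section \<open>Moments of the exponential functional\<close>

lemma ennreal_le_suminf: "f n \<le> (\<Sum>n. f n)" for f :: "nat \<Rightarrow> ennreal"
  using sum_le_suminf[OF summableI, of "{n}" f] by simp

text \<open>Squaring the weak inequality at y / 2 gains the term y^2 / 4.\<close>

lemma exp_gt_add_one_self:
  fixes y :: real
  assumes "y \<noteq> 0"
  shows "1 + y < exp y"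
proof (cases "1 + y / 2 \<ge> 0")
  case True
  have "1 + y < (1 + y / 2)\<^sup>2" using assms by (simp add: power2_eq_square algebra_simps) (simp flip: power2_eq_square)
  also have "\<dots> \<le> (exp (y / 2))\<^sup>2" using True exp_ge_add_one_self by (intro power_mono) auto
  also have "\<dots> = exp y" by (simp add: exp_double[symmetric])
  finally show ?thesis .
next
  case False
  then have "1 + y < 0" by simp
  then show ?thesis using exp_gt_zero[of y] by linarith
qed

text \<open>Strict convexity on the segment from 0 to y: the tangent to the exponential at a * y
  lies strictly below it at both ends, and the two inequalities are averaged with weights 1 - a and
  a.\<close>

lemma exp_convex_strict:
  fixes a y :: real
  assumes a: "0 < a" "a < 1"
  shows "exp (a * y) \<le> (1 - a) + a * exp y"
    and "y \<noteq> 0 \<Longrightarrow> exp (a * y) < (1 - a) + a * exp y"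
proof -
  have strict: "exp (a * y) < (1 - a) + a * exp y" if y: "y \<noteq> 0"
  proof -
    have "1 - a * y < exp (- (a * y))" using exp_gt_add_one_self[of "- (a * y)"] a y by simp
    then have "exp (a * y) * (1 - a * y) < exp (a * y) * exp (- (a * y))" by (intro mult_strict_left_mono) auto
    then have 1: "exp (a * y) * (1 - a * y) < 1" by (simp add: exp_minus)
    have "1 + (1 - a) * y < exp ((1 - a) * y)" using a y by (intro exp_gt_add_one_self) auto
    then have "exp (a * y) * (1 + (1 - a) * y) < exp (a * y) * exp ((1 - a) * y)" by (intro mult_strict_left_mono) auto
    also have "\<dots> = exp y" by (simp add: exp_add[symmetric] algebra_simps)
    finally have 2: "exp (a * y) * (1 + (1 - a) * y) < exp y" .
    have "exp (a * y) = (1 - a) * (exp (a * y) * (1 - a * y)) + a * (exp (a * y) * (1 + (1 - a) * y))"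
      by (simp add: algebra_simps)
    also have "\<dots> < (1 - a) * 1 + a * exp y"
      using a 1 2 by (intro add_strict_mono mult_strict_left_mono) auto
    finally show ?thesis by simp
  qed
  then show "y \<noteq> 0 \<Longrightarrow> exp (a * y) < (1 - a) + a * exp y" .
  show "exp (a * y) \<le> (1 - a) + a * exp y"
    using strict by (cases "y = 0") (auto intro: less_imp_le)
qed

section \<open>Cramer's condition and the Laplace exponent\<close>

locale cramer_process = levy_process M \<xi> for M :: "'a measure" and \<xi> +
  fixes \<theta> \<epsilon> :: real
  assumes \<theta>_pos: "\<theta> > 0" and \<epsilon>_pos: "\<epsilon> > 0"
    and exponent_\<theta>: "levy_exponent M \<xi> \<theta> = 0"
    and exponent_finite: "l \<in> {0..\<theta> + \<epsilon>} \<Longrightarrow> levy_exponent M \<xi> l > -\<infinity>"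
    and nonarithmetic: "\<not> arithmetic_law (distr M borel (\<xi> 1))"
begin

text \<open>The Laplace exponent, opposite in sign to \<open>levy_exponent\<close>, so that the
  exponential moment of order l at time t is exp (t * \<kappa> l).\<close>

definition \<kappa> :: "real \<Rightarrow> real" where "\<kappa> l = ln (\<integral>\<omega>. exp (l * \<xi> 1 \<omega>) \<partial>M)"

lemma levy_exponent_\<kappa>:
  assumes "0 \<le> l" "l \<le> \<theta> + \<epsilon>"
  shows "levy_exponent M \<xi> l = ereal (- \<kappa> l)"
  using exponent_finite[of l] assms by (simp add: levy_exponent_def \<kappa>_def split: if_splits)

lemma \<kappa>_\<theta>: "\<kappa> \<theta> = 0"
  using levy_exponent_\<kappa>[of \<theta>] exponent_\<theta> \<theta>_pos \<epsilon>_pos by simp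

lemma measurable_xi [measurable]: "t \<ge> 0 \<Longrightarrow> \<xi> t \<in> borel_measurable M"
  by (rule random_variable_at)

lemma measurable_xi_1 [measurable]: "\<xi> 1 \<in> borel_measurable M"
  by (rule measurable_xi) simp

lemma nn_integral_exp:
  assumes "0 \<le> l" "l \<le> \<theta> + \<epsilon>" "t \<ge> 0"
  shows "exp_moment l t = ennreal (exp (t * \<kappa> l))"
proof (cases "t = 0")
  case True
  have "exp_moment l 0 = (\<integral>\<^sup>+\<omega>. 1 \<partial>M)"
    using starts_at_0 by (intro nn_integral_cong_AE) (auto elim: eventually_mono)
  then show ?thesis using True by (simp add: emeasure_space_1)
next
  case False
  then show ?thesis using nn_integral_exp_levy[of t l] assms by (simp add: levy_exponent_\<kappa>)
qed

lemma has_bochner_integral_exp: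
  assumes "0 \<le> l" "l \<le> \<theta> + \<epsilon>" "t \<ge> 0"
  shows "has_bochner_integral M (\<lambda>\<omega>. exp (l * \<xi> t \<omega>)) (exp (t * \<kappa> l))"
  using assms measurable_xi[OF assms(3)] by (intro has_bochner_integral_nn_integral) (auto simp: nn_integral_exp)

lemma integrable_exp:
  assumes "0 \<le> l" "l \<le> \<theta> + \<epsilon>" "t \<ge> 0"
  shows "integrable M (\<lambda>\<omega>. exp (l * \<xi> t \<omega>))"
  using has_bochner_integral_exp[OF assms] by (simp add: has_bochner_integral_iff)

lemma integral_exp:
  assumes "0 \<le> l" "l \<le> \<theta> + \<epsilon>" "t \<ge> 0"
  shows "(\<integral>\<omega>. exp (l * \<xi> t \<omega>) \<partial>M) = exp (t * \<kappa> l)"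
  using has_bochner_integral_exp[OF assms] by (rule has_bochner_integral_integral_eq)

lemma has_bochner_integral_const: "has_bochner_integral M (\<lambda>_. c :: real) c"
  by (simp add: has_bochner_integral_iff prob_space)

text \<open>Used with l = 0 to exclude that \<xi> 1 vanishes almost surely, and with l = 2 * pi / y
  to exclude a second solution on the critical line.\<close>

lemma not_concentrated:
  assumes "AE \<omega> in M. \<exists>k::int. \<xi> 1 \<omega> = l * of_int k"
  shows False
proof -
  let ?S = "range (\<lambda>k::int. l * of_int k)"
  have S: "?S \<in> sets borel" by (rule sets.countable) simp_all
  have "measure (distr M borel (\<xi> 1)) ?S = prob {\<omega>\<in>space M. \<xi> 1 \<omega> \<in> ?S}"
    using S by (subst measure_distr) (auto intro!: arg_cong[where f = prob])
  also have "\<dots> = 1"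
    using assms S by (intro prob_Collect_eq_1[THEN iffD2]) (auto elim!: eventually_mono)
  finally show False using nonarithmetic by (auto simp: arithmetic_law_def)
qed

text \<open>The exponential moment of \<xi> 1 is convex in its order and equals 1 at 0 and at
  \<theta>. Equality at an interior point would force \<xi> 1 = 0 almost surely, by strict convexity
  of the exponential.\<close>

lemma \<kappa>_neg:
  assumes l: "0 < l" "l < \<theta>"
  shows "\<kappa> l < 0"
proof -
  define a where "a = l / \<theta>"
  have a: "0 < a" "a < 1" using l by (auto simp: a_def)
  define f where "f \<omega> = (1 - a) + a * exp (\<theta> * \<xi> 1 \<omega>) - exp (l * \<xi> 1 \<omega>)" for \<omega>
  have al: "a * (\<theta> * x) = l * x" for x using \<theta>_pos by (simp add: a_def)
  have f0: "f \<omega> \<ge> 0" and fs: "\<xi> 1 \<omega> \<noteq> 0 \<Longrightarrow> f \<omega> > 0" for \<omega>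
    using exp_convex_strict[OF a, of "\<theta> * \<xi> 1 \<omega>"] \<theta>_pos by (auto simp: f_def al)
  have hb: "has_bochner_integral M f ((1 - a) + a * exp (1 * \<kappa> \<theta>) - exp (1 * \<kappa> l))"
    unfolding f_def
    by (intro has_bochner_integral_diff has_bochner_integral_add has_bochner_integral_mult_right has_bochner_integral_exp has_bochner_integral_const)
       (use l \<epsilon>_pos \<theta>_pos in auto)
  then have int: "integrable M f" and val: "(\<integral>\<omega>. f \<omega> \<partial>M) = 1 - exp (\<kappa> l)"
    by (auto simp: has_bochner_integral_iff \<kappa>_\<theta>)
  have "(\<integral>\<omega>. f \<omega> \<partial>M) \<noteq> 0"
  proof
    assume "(\<integral>\<omega>. f \<omega> \<partial>M) = 0"
    then have "AE \<omega> in M. f \<omega> = 0" using int f0 by (subst (asm) integral_nonneg_eq_0_iff_AE) auto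
    then have "AE \<omega> in M. \<exists>k::int. \<xi> 1 \<omega> = 0 * of_int k"
      by eventually_elim (use fs in force)
    then show False by (rule not_concentrated)
  qed
  moreover have "(\<integral>\<omega>. f \<omega> \<partial>M) \<ge> 0" using f0 by (intro integral_nonneg_AE) auto
  ultimately have "exp (\<kappa> l) < 1" using val by simp
  then show ?thesis by simp
qed

text \<open>The rate at which the process falls below -1. The numerator comes from 2 - 2 * exp (s *
  \<kappa> (\<theta> / 2)) \<le> - 2 * s * \<kappa> (\<theta> / 2); the denominator is a lower bound
  of (1 - exp (\<theta> / 2 * x))^2 over x < -1.\<close>

definition c1 :: real where "c1 = 2 * (- \<kappa> (\<theta> / 2)) / (1 - exp (- \<theta> / 2))\<^sup>2"

lemma c1_nonneg: "c1 \<ge> 0"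
proof -
  have "\<kappa> (\<theta> / 2) < 0" using \<theta>_pos by (intro \<kappa>_neg) simp_all
  then show ?thesis unfolding c1_def by (intro divide_nonneg_nonneg zero_le_power2) simp
qed

text \<open>Chebyshev's inequality for \<open>exp (\<theta> * \<xi> s / 2)\<close>, whose second moment is \<open>1\<close>.\<close>

lemma prob_below_minus_one:
  assumes s: "s \<ge> 0"
  shows "prob {\<omega>\<in>space M. \<xi> s \<omega> < -1} \<le> c1 * s"
proof -
  note [measurable] = measurable_xi[OF s]
  define g where "g \<omega> = exp (\<theta> * \<xi> s \<omega>) - 2 * exp (\<theta> / 2 * \<xi> s \<omega>) + 1" for \<omega>
  define d where "d = (1 - exp (- \<theta> / 2))\<^sup>2"
  have d: "d > 0" using \<theta>_pos by (simp add: d_def)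
  have g: "g \<omega> = (1 - exp (\<theta> / 2 * \<xi> s \<omega>))\<^sup>2" for \<omega>
    by (simp add: g_def power2_eq_square algebra_simps exp_add[symmetric])
  have hb: "has_bochner_integral M g (exp (s * \<kappa> \<theta>) - 2 * exp (s * \<kappa> (\<theta> / 2)) + 1)"
    unfolding g_def
    by (intro has_bochner_integral_diff has_bochner_integral_add has_bochner_integral_mult_right has_bochner_integral_exp has_bochner_integral_const)
       (use s \<epsilon>_pos \<theta>_pos in auto)
  have "d * prob {\<omega>\<in>space M. \<xi> s \<omega> < -1} = (\<integral>\<omega>. d * indicator {\<omega>\<in>space M. \<xi> s \<omega> < -1} \<omega> \<partial>M)" by simp
  also have "\<dots> \<le> (\<integral>\<omega>. g \<omega> \<partial>M)"
  proof (rule integral_mono)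
    show "integrable M g" using hb by (simp add: has_bochner_integral_iff)
    show "d * indicator {\<omega>\<in>space M. \<xi> s \<omega> < -1} \<omega> \<le> g \<omega>" for \<omega>
    proof (cases "\<xi> s \<omega> < -1")
      case True
      then have "\<theta> / 2 * \<xi> s \<omega> \<le> \<theta> / 2 * (-1)" using \<theta>_pos by (intro mult_left_mono) auto
      then have "exp (\<theta> / 2 * \<xi> s \<omega>) \<le> exp (- \<theta> / 2)" by simp
      moreover have "exp (- \<theta> / 2) \<le> 1" using \<theta>_pos by simp
      ultimately have "d \<le> g \<omega>" unfolding g d_def by (intro power_mono) auto
      moreover have "g \<omega> \<ge> 0" by (simp add: g)
      ultimately show ?thesis by (simp add: indicator_def)
    qed (simp add: g)
  qed (intro integrable_mult_right integrable_real_indicator, auto simp: emeasure_eq_measure)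
  also have "\<dots> = 2 - 2 * exp (s * \<kappa> (\<theta> / 2))"
    using has_bochner_integral_integral_eq[OF hb] by (simp add: \<kappa>_\<theta>)
  also have "\<dots> \<le> 2 * (- \<kappa> (\<theta> / 2)) * s"
  proof -
    have "2 - 2 * e \<le> 2 * (- k) * s" if "1 + s * k \<le> e" for e k :: real
      using that by (simp add: algebra_simps)
    from this[OF exp_ge_add_one_self] show ?thesis .
  qed
  finally have "prob {\<omega>\<in>space M. \<xi> s \<omega> < -1} \<le> 2 * (- \<kappa> (\<theta> / 2)) * s / d"
    by (subst pos_le_divide_eq[OF d]) (simp only: mult.commute[of _ d])
  then show ?thesis by (simp add: c1_def d_def)
qed

text \<open>A path that stays at or above -1 for at least half of a time interval of length \<delta>
  collects at least exp (-1) * \<delta> / 2 there.\<close>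

definition c0 :: real where "c0 = exp (-1) / 2"

lemma exp_int_mono: "A \<subseteq> B \<Longrightarrow> exp_int A \<omega> \<le> exp_int B \<omega>"
  unfolding exp_int_def by (intro nn_integral_mono) (auto split: split_indicator)

text \<open>A value below c0 * \<delta> means that the path spends more than half of the interval
  below -1. The expected time spent there is at most c1 * \<delta>^2, and Markov's inequality at
  level \<delta> / 2 gives the bound.\<close>

lemma prob_exp_int_small:
  assumes \<delta>: "\<delta> > 0"
  shows "emeasure M {\<omega>\<in>space M. exp_int {0<..<\<delta>} \<omega> < ennreal (c0 * \<delta>)} \<le> ennreal (2 * c1 * \<delta>)"
proof -
  interpret P: pair_sigma_finite lborel M by standard
  define f where "f = (\<lambda>(s, \<omega>). indicator {0<..<\<delta>} s * (if path_value (s, \<omega>) < -1 then 1 else 0 :: ennreal))"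
  have [measurable]: "path_value \<in> borel_measurable (lborel \<Otimes>\<^sub>M M)" using measurable_path by simp
  have f [measurable]: "f \<in> borel_measurable (lborel \<Otimes>\<^sub>M M)" unfolding f_def case_prod_beta' by measurable
  have fm [measurable]: "(\<lambda>\<omega>. f (s, \<omega>)) \<in> borel_measurable M" for s by simp
  have m: "exp_int {0<..<\<delta>} \<in> borel_measurable M" by (rule measurable_exp_int) auto
  have N [measurable]: "(\<lambda>\<omega>. \<integral>\<^sup>+s. f (s, \<omega>) \<partial>lborel) \<in> borel_measurable M" by measurable
  have "{\<omega>\<in>space M. exp_int {0<..<\<delta>} \<omega> < ennreal (c0 * \<delta>)} \<subseteq> {\<omega>\<in>space M. 1 \<le> ennreal (2 / \<delta>) * (\<integral>\<^sup>+s. f (s, \<omega>) \<partial>lborel)}"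
  proof safe
    fix \<omega> assume \<omega>: "\<omega> \<in> space M" and small: "exp_int {0<..<\<delta>} \<omega> < ennreal (c0 * \<delta>)"
    have [measurable]: "(\<lambda>s. path_value (s, \<omega>)) \<in> borel_measurable borel" by (rule measurable_path_at[OF \<omega>])
    have [measurable]: "(\<lambda>s. f (s, \<omega>)) \<in> borel_measurable borel" unfolding f_def prod.case by measurable
    have e: "exp_int {0<..<\<delta>} \<omega> = (\<integral>\<^sup>+s. ennreal (indicator {0<..<\<delta>} s * exp (path_value (s, \<omega>))) \<partial>lborel)"
      by (rule exp_int_path) auto
    define n where "n = (\<integral>\<^sup>+s. f (s, \<omega>) \<partial>lborel)"
    have "ennreal (exp (-1)) * ennreal \<delta> = (\<integral>\<^sup>+s. ennreal (exp (-1)) * indicator {0<..<\<delta>} s \<partial>lborel)"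
      using \<delta> by (simp add: nn_integral_cmult_indicator)
    also have "\<dots> \<le> (\<integral>\<^sup>+s. ennreal (indicator {0<..<\<delta>} s * exp (path_value (s, \<omega>))) + ennreal (exp (-1)) * f (s, \<omega>) \<partial>lborel)"
      by (intro nn_integral_mono) (auto simp: f_def indicator_def not_less intro!: ennreal_leI)
    also have "\<dots> = exp_int {0<..<\<delta>} \<omega> + ennreal (exp (-1)) * n"
      unfolding n_def e by (simp add: nn_integral_add nn_integral_cmult)
    finally have le: "ennreal (exp (-1)) * ennreal \<delta> \<le> exp_int {0<..<\<delta>} \<omega> + ennreal (exp (-1)) * n" .
    have "n \<le> (\<integral>\<^sup>+s. indicator {0<..<\<delta>} s \<partial>lborel)" unfolding n_def by (intro nn_integral_mono) (auto simp: f_def)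
    then have "n < \<infinity>" using \<delta> by (auto intro: le_less_trans)
    then obtain x where x: "n = ennreal x" "x \<ge> 0" by (cases n) auto
    obtain a where a: "exp_int {0<..<\<delta>} \<omega> = ennreal a" "a \<ge> 0" using small by (cases "exp_int {0<..<\<delta>} \<omega>") auto
    have "a < c0 * \<delta>" using small a by (simp add: ennreal_less_iff)
    moreover have "exp (-1) * \<delta> \<le> a + exp (-1) * x"
      using le a x \<delta> by (simp add: ennreal_mult[symmetric] ennreal_plus[symmetric] del: ennreal_plus)
    moreover have "e * \<delta> < e * (2 * x)" if "a < e / 2 * \<delta>" "e * \<delta> \<le> a + e * x" for e :: real
      using that by (simp add: algebra_simps)
    ultimately have "exp (-1) * \<delta> < exp (-1) * (2 * x)" unfolding c0_def by blast
    then have "\<delta> < 2 * x" by (simp only: mult_less_cancel_left_pos exp_gt_zero)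
    then have "1 \<le> 2 / \<delta> * x" using \<delta> by (simp add: field_simps)
    then have "ennreal 1 \<le> ennreal (2 / \<delta> * x)" by (rule ennreal_leI)
    also have "\<dots> = ennreal (2 / \<delta>) * n" unfolding x(1) using \<delta> x by (intro ennreal_mult) auto
    finally show "1 \<le> ennreal (2 / \<delta>) * (\<integral>\<^sup>+s. f (s, \<omega>) \<partial>lborel)" by (simp add: n_def)
  qed
  note incl = this
  have "(\<integral>\<^sup>+\<omega>. \<integral>\<^sup>+s. f (s, \<omega>) \<partial>lborel \<partial>M) = (\<integral>\<^sup>+s. \<integral>\<^sup>+\<omega>. f (s, \<omega>) \<partial>M \<partial>lborel)"
    using P.Fubini'[of "\<lambda>s \<omega>. f (s, \<omega>)"] f by simp
  also have "\<dots> \<le> (\<integral>\<^sup>+s. ennreal (c1 * \<delta>) * indicator {0<..<\<delta>} s \<partial>lborel)"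
  proof (rule nn_integral_mono)
    fix s :: real
    show "(\<integral>\<^sup>+\<omega>. f (s, \<omega>) \<partial>M) \<le> ennreal (c1 * \<delta>) * indicator {0<..<\<delta>} s"
    proof (cases "s \<in> {0<..<\<delta>}")
      case True
      then have s: "s \<ge> 0" by simp
      note [measurable] = measurable_xi[OF s]
      have "(\<integral>\<^sup>+\<omega>. f (s, \<omega>) \<partial>M) = (\<integral>\<^sup>+\<omega>. indicator {\<omega>\<in>space M. \<xi> s \<omega> < -1} \<omega> \<partial>M)"
        using True by (intro nn_integral_cong) (auto simp: f_def path_eq indicator_def)
      also have "\<dots> = ennreal (prob {\<omega>\<in>space M. \<xi> s \<omega> < -1})" by (simp add: emeasure_eq_measure)
      also have "\<dots> \<le> ennreal (c1 * \<delta>)"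
        using prob_below_minus_one[OF s] True c1_nonneg mult_left_mono[of s \<delta> c1] by (intro ennreal_leI) auto
      finally show ?thesis using True by simp
    qed (simp add: f_def)
  qed
  also have "\<dots> = ennreal (c1 * \<delta>) * ennreal \<delta>" using \<delta> by (simp add: nn_integral_cmult_indicator)
  finally have I: "(\<integral>\<^sup>+\<omega>. \<integral>\<^sup>+s. f (s, \<omega>) \<partial>lborel \<partial>M) \<le> ennreal (c1 * \<delta>) * ennreal \<delta>" .
  from incl have "emeasure M {\<omega>\<in>space M. exp_int {0<..<\<delta>} \<omega> < ennreal (c0 * \<delta>)} \<le> emeasure M {\<omega>\<in>space M. 1 \<le> ennreal (2 / \<delta>) * (\<integral>\<^sup>+s. f (s, \<omega>) \<partial>lborel)}"
    by (rule emeasure_mono) measurable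
  also have "\<dots> \<le> ennreal (2 / \<delta>) * (\<integral>\<^sup>+\<omega>. \<integral>\<^sup>+s. f (s, \<omega>) \<partial>lborel \<partial>M)"
    using nn_integral_Markov_inequality[where M = M and A = "space M" and c = "ennreal (2 / \<delta>)"
        and u = "\<lambda>\<omega>. \<integral>\<^sup>+s. f (s, \<omega>) \<partial>lborel"] by (simp cong: nn_integral_cong)
  also have "\<dots> \<le> ennreal (2 / \<delta>) * (ennreal (c1 * \<delta>) * ennreal \<delta>)"
    by (intro mult_left_mono I) simp
  also have "\<dots> = ennreal (2 * c1 * \<delta>)"
    using \<delta> c1_nonneg by (simp add: ennreal_mult[symmetric])
  finally show ?thesis .
qed

lemma c0_pos: "c0 > 0" by (simp add: c0_def)

abbreviation layer :: "real \<Rightarrow> nat \<Rightarrow> 'a set" where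
  "layer t n \<equiv> {\<omega>\<in>space M. exp_int {0<..<t / 2 ^ n} \<omega> < ennreal (c0 * (t / 2 ^ n))}"

abbreviation layer_sum :: "real \<Rightarrow> real \<Rightarrow> 'a \<Rightarrow> ennreal" where
  "layer_sum q t \<omega> \<equiv> (\<Sum>n. ennreal ((c0 * (t / 2 ^ Suc n)) powr (- q)) * indicator (layer t n) \<omega>)"

text \<open>A dyadic layer-cake estimate: the layer of \<open>exp_int B\<close> between \<open>c0 * t / 2 ^ Suc n\<close> and
  \<open>c0 * t / 2 ^ n\<close> has probability of order \<open>t / 2 ^ n\<close>.\<close>

lemma negative_moment_layers:
  assumes q: "q > 0" and t: "t > 0" and B: "{0<..<t} \<subseteq> B" and \<omega>: "\<omega> \<in> space M"
  shows "ennreal (enn2real (exp_int B \<omega>) powr (- q)) \<le> ennreal ((c0 * t) powr (- q)) +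
    layer_sum q t \<omega>"
proof -
  define X where "X = enn2real (exp_int B \<omega>)"
  have dec: "ennreal (y powr (- q)) \<le> ennreal (x powr (- q))" if "0 < x" "x \<le> y" for x y :: real
    using that q by (intro ennreal_leI powr_mono2') auto
  have X0: "X \<ge> 0" by (simp add: X_def)
  \<comment> \<open>The case X = 0 also covers an infinite integral; the power with negative
    exponent is then 0 by convention.\<close>
  show ?thesis unfolding X_def[symmetric]
  proof (cases "X = 0 \<or> c0 * t \<le> X")
    case True
    then have "ennreal (X powr (- q)) \<le> ennreal ((c0 * t) powr (- q))"
    proof
      assume "c0 * t \<le> X"
      then show ?thesis using c0_pos t by (intro dec) auto
    qed simp
    then show "ennreal (X powr (- q)) \<le> ennreal ((c0 * t) powr (- q)) +
      layer_sum q t \<omega>"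
      by (rule order_trans) simp
  next
    case False
    then have X: "0 < X" "X < c0 * t" using X0 by auto
    have "exp_int B \<omega> = ennreal X" using X by (cases "exp_int B \<omega>") (auto simp: X_def)
    have "(\<lambda>n. c0 * t * (1 / 2) ^ Suc n) \<longlonglongrightarrow> c0 * t * 0"
      by (intro tendsto_intros LIMSEQ_Suc LIMSEQ_power_zero) auto
    then have "eventually (\<lambda>n. c0 * t * (1 / 2) ^ Suc n < X) sequentially"
      using X by (intro order_tendstoD(2)) auto
    then obtain m where "c0 * t * (1 / 2) ^ Suc m < X" using eventually_happens' sequentially_bot by blast
    then have ex: "c0 * (t / 2 ^ Suc m) \<le> X" by (simp add: power_divide)
    define n where "n = (LEAST n. c0 * (t / 2 ^ Suc n) \<le> X)"
    have n: "c0 * (t / 2 ^ Suc n) \<le> X" unfolding n_def by (rule LeastI[of "\<lambda>n. c0 * (t / 2 ^ Suc n) \<le> X", OF ex])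
    have n': "X < c0 * (t / 2 ^ n)"
    proof (cases n)
      case (Suc k)
      then have "\<not> c0 * (t / 2 ^ Suc k) \<le> X" using not_less_Least[of k "\<lambda>n. c0 * (t / 2 ^ Suc n) \<le> X"] by (simp add: n_def)
      then show ?thesis using Suc by simp
    qed (use X in simp)
    have "t / 2 ^ n \<le> t" using t by (simp add: divide_le_eq)
    then have "exp_int {0<..<t / 2 ^ n} \<omega> \<le> exp_int B \<omega>"
      using B by (intro exp_int_mono) auto
    also have "\<dots> < ennreal (c0 * (t / 2 ^ n))"
      unfolding \<open>exp_int B \<omega> = ennreal X\<close> using n' X by (simp add: ennreal_less_iff)
    finally have ind: "exp_int {0<..<t / 2 ^ n} \<omega> < ennreal (c0 * (t / 2 ^ n))" .
    have "ennreal (X powr (- q)) \<le> ennreal ((c0 * (t / 2 ^ Suc n)) powr (- q)) *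
      indicator (layer t n) \<omega>"
      using ind \<omega> dec[OF _ n] c0_pos t by simp
    also have "\<dots> \<le> layer_sum q t \<omega>"
      by (rule ennreal_le_suminf)
    finally show "ennreal (X powr (- q)) \<le> ennreal ((c0 * t) powr (- q)) +
      layer_sum q t \<omega>"
      by (rule order_trans) simp
  qed
qed

text \<open>Layer n contributes at most a constant times (2 powr q / 2) ^ n, a geometric series
  because q < 1. Scaling gives the factor t powr (- q), and t \<le> 1 absorbs the extra factor t in
  the layer probabilities. Uniformity in B and the explicit dependence on t are what the
  finite-horizon argument requires.\<close>

lemma negative_moment:
  assumes q: "0 < q" "q < 1"
  shows "\<exists>K\<ge>0. \<forall>t B. 0 < t \<longrightarrow> t \<le> 1 \<longrightarrow> {0<..<t} \<subseteq> B \<longrightarrow>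
    power_moment B (- q) \<le> ennreal (K * t powr (- q))"
proof -
  define r where "r = 2 powr q / 2"
  have pw: "(2 ^ m :: real) powr (- q) = inverse ((2 powr q) ^ m)" for m :: nat
  proof -
    have "(2 ^ m :: real) powr (- q) = 2 powr (real m * - q)" by (simp add: powr_powr flip: powr_realpow)
    moreover have "(2 powr q) ^ m = 2 powr (q * real m)" by (simp add: powr_powr flip: powr_realpow)
    ultimately show ?thesis by (simp add: powr_minus mult.commute)
  qed
  have "2 powr q < 2 powr 1" using q by (intro powr_less_mono) auto
  then have r: "0 < r" "r < 1" by (auto simp: r_def)
  define K where "K = c0 powr (- q) * (1 + 2 * c1 * 2 powr q / (1 - r))"
  have K0: "K \<ge> 0" unfolding K_def using r c1_nonneg by (intro mult_nonneg_nonneg add_nonneg_nonneg divide_nonneg_pos) auto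
  have "power_moment B (- q) \<le> ennreal (K * t powr (- q))"
    if t: "0 < t" "t \<le> 1" and B: "{0<..<t} \<subseteq> B" for t B
  proof -
    define S where "S n = layer t n" for n :: nat
    have [measurable]: "exp_int {0<..<d} \<in> borel_measurable M" for d by (rule measurable_exp_int) auto
    have [measurable]: "S n \<in> sets M" for n unfolding S_def by measurable
    define b where "b = (c0 * t) powr (- q)"
    have term_bound: "ennreal ((c0 * (t / 2 ^ Suc n)) powr (- q)) * emeasure M (S n) \<le> ennreal (b * (2 * c1 * 2 powr q) * r ^ n)" for n
    proof -
      have "(c0 * (t / 2 ^ Suc n)) powr (- q) = b * (2 powr q) ^ Suc n"
      proof -
        have "(c0 * (t / 2 ^ Suc n)) powr (- q) = (c0 * t) powr (- q) / (2 ^ Suc n) powr (- q)"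
          using powr_divide[of "c0 * t" "2 ^ Suc n" "- q"] c0_pos t by simp
        also have "(2 ^ Suc n :: real) powr (- q) = inverse ((2 powr q) ^ Suc n)"
          by (rule pw)
        finally show ?thesis by (simp only: b_def divide_inverse inverse_inverse_eq)
      qed
      then have "ennreal ((c0 * (t / 2 ^ Suc n)) powr (- q)) * emeasure M (S n) \<le> ennreal (b * (2 powr q) ^ Suc n) * ennreal (2 * c1 * (t / 2 ^ n))"
        using prob_exp_int_small[of "t / 2 ^ n"] t by (simp add: S_def mult_left_mono)
      also have "\<dots> = ennreal (b * (2 powr q) ^ Suc n * (2 * c1 * (t / 2 ^ n)))"
        using c1_nonneg t by (intro ennreal_mult[symmetric]) (auto simp: b_def)
      also have "b * (2 powr q) ^ Suc n * (2 * c1 * (t / 2 ^ n)) = t * (b * (2 * c1 * 2 powr q) * r ^ n)"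
        by (simp add: r_def power_divide)
      also have "\<dots> \<le> 1 * (b * (2 * c1 * 2 powr q) * r ^ n)"
        using t c1_nonneg r by (intro mult_right_mono) (auto simp: b_def)
      finally show ?thesis by (simp add: ennreal_leI)
    qed
    have "power_moment B (- q) \<le>
      (\<integral>\<^sup>+\<omega>. ennreal b + (\<Sum>n. ennreal ((c0 * (t / 2 ^ Suc n)) powr (- q)) * indicator (S n) \<omega>) \<partial>M)"
      unfolding S_def b_def by (intro nn_integral_mono negative_moment_layers q t B)
    also have "\<dots> = ennreal b + (\<Sum>n. ennreal ((c0 * (t / 2 ^ Suc n)) powr (- q)) * emeasure M (S n))"
      by (subst nn_integral_add) (auto simp: nn_integral_suminf nn_integral_cmult_indicator emeasure_space_1)
    also have "\<dots> \<le> ennreal b + (\<Sum>n. ennreal (b * (2 * c1 * 2 powr q) * r ^ n))"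
      by (intro add_left_mono suminf_le term_bound summableI)
    also have "(\<Sum>n. ennreal (b * (2 * c1 * 2 powr q) * r ^ n)) = ennreal (\<Sum>n. b * (2 * c1 * 2 powr q) * r ^ n)"
      using r c1_nonneg by (intro suminf_ennreal2 summable_mult) (auto simp: b_def intro: summable_geometric)
    also have "(\<Sum>n. b * (2 * c1 * 2 powr q) * r ^ n) = b * (2 * c1 * 2 powr q) / (1 - r)"
      using r by (subst suminf_mult) (auto simp: suminf_geometric intro: summable_geometric)
    also have "ennreal b + ennreal (b * (2 * c1 * 2 powr q) / (1 - r)) = ennreal (b + b * (2 * c1 * 2 powr q) / (1 - r))"
      using r c1_nonneg by (intro ennreal_plus[symmetric]) (auto simp: b_def)
    also have "b + b * (2 * c1 * 2 powr q) / (1 - r) = K * t powr (- q)"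
      using c0_pos t by (simp add: b_def K_def powr_mult algebra_simps)
    finally show ?thesis .
  qed
  then show ?thesis using K0 by blast
qed

lemma exp_int_bounded_finite:
  assumes "\<omega> \<in> space M"
  shows "exp_int {0..<T} \<omega> < \<infinity>"
proof -
  obtain b where b: "\<And>t. 0 \<le> t \<Longrightarrow> t \<le> T \<Longrightarrow> \<xi> t \<omega> \<le> b"
    using cadlag_bounded_above[OF cadlag_paths[OF assms]] by metis
  have "exp_int {0..<T} \<omega> \<le> (\<integral>\<^sup>+v. ennreal (exp b) * indicator {0..<T} v \<partial>lborel)"
    unfolding exp_int_def using b by (intro nn_integral_mono) (auto split: split_indicator intro!: ennreal_leI)
  also have "\<dots> = ennreal (exp b) * emeasure lborel {0..<T}" by (simp add: nn_integral_cmult_indicator)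
  also have "\<dots> < \<infinity>" by (cases "0 \<le> T") (auto simp: ennreal_mult_less_top)
  finally show ?thesis .
qed

text \<open>For p < 1 the moment identity on [0, T) involves only moments of order p - 1 in the
  interval (-1, 0). More than one time unit before T they are bounded and the factor exp (u *
  \<kappa> p) is integrable over the half-line; within the last unit the singularity (T - u) powr (p
  - 1) is integrable since p > 0. Neither contribution depends on T.\<close>

lemma bounded_horizon_moment:
  assumes p: "0 < p" "p < 1" "p < \<theta>"
  shows "\<exists>C. \<forall>T>0. power_moment {0..<T} p \<le> ennreal C"
proof -
  have \<kappa>p: "\<kappa> p < 0" using p by (intro \<kappa>_neg)
  obtain K where K: "K \<ge> 0" "\<And>t B. 0 < t \<Longrightarrow> t \<le> 1 \<Longrightarrow> {0<..<t} \<subseteq> B \<Longrightarrow>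
    power_moment B (- (1 - p)) \<le> ennreal (K * t powr (- (1 - p)))"
    using negative_moment[of "1 - p"] p by auto
  have "power_moment {0..<T} p \<le> ennreal (K * p / - \<kappa> p + K)"
    if T: "T > 0" for T
  proof -
    have bound: "ennreal p * exp_moment p u *
        power_moment (remaining {0..<T} u) (p - 1) * indicator {0..<T} u
      \<le> ennreal (K * p) * (ennreal (exp (- (- \<kappa> p) * u)) * indicator {0..} u) +
        ennreal K * (ennreal (p * (T - u) powr (p - 1)) * indicator {0..1} (T - u))" for u
    proof (cases "u \<in> {0..<T}")
      case True
      \<comment> \<open>The cap at 1 respects the range of times in \<open>negative_moment\<close>;
        shortening the interval is harmless, since the bound there holds for every larger
        set.\<close>
      define s where "s = min 1 (T - u)"
      have s: "0 < s" "s \<le> 1" "s \<le> T - u" using True by (auto simp: s_def)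
      have "{0<..<s} \<subseteq> remaining {0..<T} u" using s True by (auto simp: remaining_def)
      from K(2)[OF s(1,2) this] have 1: "power_moment (remaining {0..<T} u) (p - 1) \<le> ennreal (K * s powr (p - 1))"
        by simp
      have e: "exp (u * \<kappa> p) \<le> 1" using True \<kappa>p by (simp add: mult_nonneg_nonpos)
      have "ennreal p * exp_moment p u *
        power_moment (remaining {0..<T} u) (p - 1) \<le>
        ennreal p * ennreal (exp (u * \<kappa> p)) * ennreal (K * s powr (p - 1))"
        using p \<epsilon>_pos True by (intro mult_mono 1) (auto simp: nn_integral_exp)
      also have "\<dots> = ennreal (p * exp (u * \<kappa> p) * (K * s powr (p - 1)))"
        using p K(1) by (simp add: ennreal_mult[symmetric] del: ennreal_mult')
      also have "\<dots> \<le> ennreal (K * p * exp (u * \<kappa> p) + K * (p * (T - u) powr (p - 1)) * indicator {0..1} (T - u))"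
      proof (rule ennreal_leI, cases "T - u \<le> 1")
        case le: True
        then have "s = T - u" by (simp add: s_def)
        then have "p * exp (u * \<kappa> p) * (K * s powr (p - 1)) \<le> p * 1 * (K * (T - u) powr (p - 1))"
          using mult_right_mono[OF mult_left_mono[OF e, of p], of "K * s powr (p - 1)"] p K(1) by simp
        moreover have "K * p * exp (u * \<kappa> p) \<ge> 0" using p K(1) by simp
        ultimately show "p * exp (u * \<kappa> p) * (K * s powr (p - 1)) \<le>
          K * p * exp (u * \<kappa> p) + K * (p * (T - u) powr (p - 1)) * indicator {0..1} (T - u)"
          using le True by (simp add: mult_ac)
      next
        case False
        then show "p * exp (u * \<kappa> p) * (K * s powr (p - 1)) \<le>
          K * p * exp (u * \<kappa> p) + K * (p * (T - u) powr (p - 1)) * indicator {0..1} (T - u)"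
          by (simp add: s_def mult_ac)
      qed
      also have "\<dots> = ennreal (K * p) * ennreal (exp (u * \<kappa> p)) + ennreal K * ennreal (p * (T - u) powr (p - 1)) * indicator {0..1} (T - u)"
        using p K(1) by (simp add: ennreal_mult[symmetric] ennreal_plus[symmetric] indicator_def del: ennreal_plus)
      finally show ?thesis using True by (simp add: mult_ac)
    qed simp
    have "power_moment {0..<T} p =
      (\<integral>\<^sup>+u. ennreal p * exp_moment p u *
        power_moment (remaining {0..<T} u) (p - 1) * indicator {0..<T} u \<partial>lborel)"
      using exp_int_bounded_finite p by (intro moment_identity) auto
    also have "\<dots> \<le> (\<integral>\<^sup>+u. ennreal (K * p) * (ennreal (exp (- (- \<kappa> p) * u)) * indicator {0..} u) +
        ennreal K * (ennreal (p * (T - u) powr (p - 1)) * indicator {0..1} (T - u)) \<partial>lborel)"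
      by (intro nn_integral_mono bound)
    also have "\<dots> = ennreal (K * p) * (\<integral>\<^sup>+u\<in>{0..}. ennreal (exp (- (- \<kappa> p) * u)) \<partial>lborel) +
        ennreal K * (\<integral>\<^sup>+u. ennreal (p * (T - u) powr (p - 1)) * indicator {0..1} (T - u) \<partial>lborel)"
      by (subst nn_integral_add) (auto simp: nn_integral_cmult)
    also have "(\<integral>\<^sup>+u. ennreal (p * (T - u) powr (p - 1)) * indicator {0..1} (T - u) \<partial>lborel) =
        (\<integral>\<^sup>+u\<in>{0..1}. ennreal (p * u powr (p - 1)) \<partial>lborel)"
      by (subst (2) nn_integral_real_affine[where c = "-1" and t = T]) auto
    also have "\<dots> = 1" using p by (subst nn_integral_powr_Icc) auto
    also have "(\<integral>\<^sup>+u\<in>{0..}. ennreal (exp (- (- \<kappa> p) * u)) \<partial>lborel) = ennreal (1 / - \<kappa> p)"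
      using \<kappa>p by (intro nn_integral_exp_halfline) simp
    also have "ennreal (K * p) * ennreal (1 / - \<kappa> p) + ennreal K * 1 = ennreal (K * p / - \<kappa> p + K)"
    proof -
      have 0: "0 \<le> 1 / - \<kappa> p" "0 \<le> K * p" "0 \<le> K * p / - \<kappa> p"
        using \<kappa>p K(1) p by (auto simp: divide_nonneg_neg)
      have "ennreal (K * p) * ennreal (1 / - \<kappa> p) = ennreal (K * p / - \<kappa> p)"
        unfolding ennreal_mult[OF 0(2,1), symmetric] by simp
      then show ?thesis unfolding ennreal_plus[OF 0(3) K(1)] by simp
    qed
    finally show ?thesis .
  qed
  then show ?thesis by blast
qed

section \<open>Finiteness and moments on the whole half-line\<close>

abbreviation A_inf :: "'a \<Rightarrow> ennreal" where "A_inf \<equiv> exp_int {0..}"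

lemma measurable_A_inf [measurable]: "A_inf \<in> borel_measurable M"
  by (rule measurable_exp_int) auto

lemma A_inf_le_horizons:
  assumes \<omega>: "\<omega> \<in> space M" and le: "\<And>n::nat. exp_int {0..<real n} \<omega> \<le> c"
  shows "A_inf \<omega> \<le> c"
proof -
  note [measurable] = measurable_path_at[OF \<omega>]
  define \<nu> where "\<nu> = density lborel (\<lambda>v. ennreal (exp (path_value (v, \<omega>))))"
  have em: "emeasure \<nu> S = exp_int S \<omega>" if "S \<in> sets borel" "S \<subseteq> {0..}" for S
    unfolding \<nu>_def exp_int_path[OF that(2)] using that(1)
    by (subst emeasure_density) (auto intro!: nn_integral_cong split: split_indicator)
  have "(SUP n. emeasure \<nu> {0..<real n}) = emeasure \<nu> (\<Union>n. {0..<real n})"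
    by (rule SUP_emeasure_incseq) (auto simp: incseq_def \<nu>_def)
  also have "(\<Union>n. {0..<real n}) = {0..}" by (auto intro: reals_Archimedean2)
  also have "(SUP n. emeasure \<nu> {0..<real n}) = (SUP n. exp_int {0..<real n} \<omega>)"
    by (intro SUP_cong refl em) auto
  finally have "A_inf \<omega> = (SUP n. exp_int {0..<real n} \<omega>)" by (simp add: em)
  then show ?thesis using le by (auto intro: SUP_least)
qed

text \<open>The p-th powers over the horizons increase and have bounded expectations, so their
  supremum is integrable and hence finite almost surely.\<close>

lemma A_inf_finite: "AE \<omega> in M. A_inf \<omega> < \<infinity>"
proof -
  \<comment> \<open>Any exponent strictly between 0 and the smaller of 1 and \<theta> serves
    here.\<close>
  define p where "p = min 1 \<theta> / 2"
  have p: "0 < p" "p < 1" "p < \<theta>" using \<theta>_pos by (auto simp: p_def min_def)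
  obtain C where C: "\<And>T. T > 0 \<Longrightarrow> power_moment {0..<T} p \<le> ennreal C"
    using bounded_horizon_moment[OF p] by blast
  define h where "h n \<omega> = ennreal (enn2real (exp_int {0..<real (Suc n)} \<omega>) powr p)" for n \<omega>
  have [measurable]: "exp_int {0..<T} \<in> borel_measurable M" for T by (rule measurable_exp_int) auto
  have hm [measurable]: "h n \<in> borel_measurable M" for n unfolding h_def by measurable
  have "(\<integral>\<^sup>+\<omega>. (SUP n. h n \<omega>) \<partial>M) = (SUP n. \<integral>\<^sup>+\<omega>. h n \<omega> \<partial>M)"
  proof (rule nn_integral_monotone_convergence_SUP_AE)
    show "AE \<omega> in M. h n \<omega> \<le> h (Suc n) \<omega>" for n
      using AE_space
    proof eventually_elim
      case (elim \<omega>)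
      have "enn2real (exp_int {0..<real (Suc n)} \<omega>) \<le> enn2real (exp_int {0..<real (Suc (Suc n))} \<omega>)"
        using exp_int_bounded_finite[OF elim, of "real (Suc (Suc n))"] by (intro enn2real_mono exp_int_mono) auto
      then show ?case unfolding h_def using p by (intro ennreal_leI powr_mono2) auto
    qed
  qed simp
  also have "\<dots> \<le> ennreal C" unfolding h_def by (intro SUP_least C) simp
  finally have "(\<integral>\<^sup>+\<omega>. (SUP n. h n \<omega>) \<partial>M) \<noteq> \<infinity>" by (auto simp: top_unique)
  then have "AE \<omega> in M. (SUP n. h n \<omega>) \<noteq> \<infinity>" by (intro nn_integral_PInf_AE) auto
  then show ?thesis using AE_space
  proof eventually_elim
    case (elim \<omega>)
    then obtain c where c: "(SUP n. h n \<omega>) = ennreal c" "c \<ge> 0" by (cases "SUP n. h n \<omega>") auto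
    have "exp_int {0..<real n} \<omega> \<le> ennreal (c powr (1 / p))" for n
    proof -
      have "exp_int {0..<real n} \<omega> \<le> exp_int {0..<real (Suc n)} \<omega>" by (intro exp_int_mono) auto
      also obtain e where e: "exp_int {0..<real (Suc n)} \<omega> = ennreal e" "e \<ge> 0"
        using exp_int_bounded_finite[OF elim(2), of "real (Suc n)"] by (cases "exp_int {0..<real (Suc n)} \<omega>") auto
      have "h n \<omega> \<le> ennreal c" unfolding c(1)[symmetric] by (rule SUP_upper) simp
      then have "e powr p \<le> c" using e c by (simp add: h_def)
      then have "(e powr p) powr (1 / p) \<le> c powr (1 / p)" using p by (intro powr_mono2) auto
      then have "e \<le> c powr (1 / p)" using e p by (simp add: powr_powr)
      then have "exp_int {0..<real (Suc n)} \<omega> \<le> ennreal (c powr (1 / p))" unfolding e(1) by (rule ennreal_leI)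
      finally show ?thesis .
    qed
    then have "A_inf \<omega> \<le> ennreal (c powr (1 / p))" using elim(2) by (intro A_inf_le_horizons)
    then show ?case by (rule le_less_trans) simp
  qed
qed

text \<open>\<open>enn2real\<close> sends \<open>\<infinity>\<close> to \<open>0\<close>; this happens only on a null set.\<close>

definition R :: "'a \<Rightarrow> real" where "R \<omega> = enn2real (A_inf \<omega>)"

lemma measurable_R [measurable]: "R \<in> borel_measurable M"
  unfolding R_def by measurable

lemma R_pos: "AE \<omega> in M. R \<omega> > 0"
  using A_inf_finite AE_space
proof eventually_elim
  case (elim \<omega>)
  note [measurable] = measurable_path_at[OF elim(2)]
  have "A_inf \<omega> \<noteq> 0"
  proof
    assume "A_inf \<omega> = 0"
    then have "AE v in lborel. ennreal (indicator {0..} v * exp (path_value (v, \<omega>))) = 0"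
      unfolding exp_int_path[OF order_refl] by (subst (asm) nn_integral_0_iff_AE) auto
    then have "AE v in lborel. v \<notin> {0..<1::real}"
      by eventually_elim (auto simp: ennreal_eq_0_iff indicator_def mult_le_0_iff not_le[symmetric] split: if_splits)
    then have "emeasure lborel {0..<1::real} = 0" by (subst (asm) AE_iff_measurable[where N = "{0..<1}"]) auto
    then show False by simp
  qed
  then show ?case using elim(1) by (simp add: R_def enn2real_positive_iff less_top zero_less_iff_neq_zero)
qed

lemma exp_int_remaining_halfline:
  assumes "u \<ge> 0"
  shows "exp_int (remaining {0..} u) \<omega> = A_inf \<omega>"
proof -
  have "remaining {0..} u = {0<..}" using assms by (auto simp: remaining_def)
  moreover have "AE v in lborel. ennreal (exp (\<xi> v \<omega>)) * indicator {0<..} v = ennreal (exp (\<xi> v \<omega>)) * indicator {0..} v"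
    using AE_lborel_singleton[of 0] by eventually_elim (auto split: split_indicator)
  ultimately show ?thesis unfolding exp_int_def by (simp add: nn_integral_cong_AE)
qed

definition moment :: "real \<Rightarrow> ennreal" where "moment p = (\<integral>\<^sup>+\<omega>. ennreal (R \<omega> powr p) \<partial>M)"

text \<open>On the half-line the remainder has the law of the whole functional whatever u is, so its
  moment leaves the integral over u, and that integral of exp (u * \<kappa> p) is 1 / (- \<kappa>
  p). Here - \<kappa> p is the Levy exponent at p.\<close>

lemma moment_recursion:
  assumes p: "0 < p" "p < \<theta>"
  shows "moment p = ennreal (p / - \<kappa> p) * moment (p - 1)"
proof -
  have \<kappa>p: "\<kappa> p < 0" using p by (intro \<kappa>_neg)
  have "moment p = (\<integral>\<^sup>+u\<in>{0..}. ennreal p * exp_moment p u *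
      power_moment (remaining {0..} u) (p - 1) \<partial>lborel)"
    unfolding moment_def R_def using p A_inf_finite by (intro moment_identity) auto
  also have "\<dots> = (\<integral>\<^sup>+u. ennreal p * moment (p - 1) * (ennreal (exp (- (- \<kappa> p) * u)) * indicator {0..} u) \<partial>lborel)"
    using p \<epsilon>_pos by (intro nn_integral_cong)
      (auto simp: nn_integral_exp exp_int_remaining_halfline moment_def R_def mult_ac split: split_indicator)
  also have "\<dots> = ennreal p * moment (p - 1) * (\<integral>\<^sup>+u\<in>{0..}. ennreal (exp (- (- \<kappa> p) * u)) \<partial>lborel)"
    by (rule nn_integral_cmult) measurable
  also have "\<dots> = ennreal p * moment (p - 1) * ennreal (1 / - \<kappa> p)"
    using \<kappa>p by (subst nn_integral_exp_halfline) auto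
  also have "\<dots> = ennreal p * ennreal (1 / - \<kappa> p) * moment (p - 1)"
    by (simp only: mult.assoc mult.commute[of "moment (p - 1)"])
  also have "ennreal p * ennreal (1 / - \<kappa> p) = ennreal (p / - \<kappa> p)"
  proof -
    have "1 / - \<kappa> p \<ge> 0" using \<kappa>p by (simp add: divide_nonneg_neg)
    then show ?thesis using p by (subst ennreal_mult[symmetric]) auto
  qed
  finally show ?thesis .
qed

text \<open>Negative moments cover the interval (-1, 0], which has length one, so unit steps of the
  recursion reach every order below \<theta>; the induction runs over an integer upper bound of
  p.\<close>

lemma moment_finite:
  assumes p: "-1 < p" "p < \<theta>"
  shows "moment p < \<infinity>"
proof -
  have nonpos: "moment p < \<infinity>" if "-1 < p" "p \<le> 0" for p
  proof (cases "p = 0")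
    case True
    have "moment p \<le> (\<integral>\<^sup>+\<omega>. 1 \<partial>M)" unfolding moment_def True by (intro nn_integral_mono) auto
    then show ?thesis by (simp add: emeasure_space_1 le_less_trans[OF _ ennreal_one_less_top])
  next
    case False
    then have "0 < - p" "- p < 1" using that by auto
    from negative_moment[OF this] obtain K where "\<forall>t B. 0 < t \<longrightarrow> t \<le> 1 \<longrightarrow> {0<..<t} \<subseteq> B \<longrightarrow>
      power_moment B (- (- p)) \<le> ennreal (K * t powr (- (- p)))"
      by blast
    from this[rule_format, of 1 "{0..}"]
    have "moment p \<le> ennreal K" by (simp add: moment_def R_def greaterThanLessThan_subseteq_atLeastAtMost_iff subset_iff)
    then show ?thesis by (rule le_less_trans) simp
  qed
  have step: "moment p < \<infinity>" if "moment (p - 1) < \<infinity>" "0 < p" "p < \<theta>" for p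
    using that by (subst moment_recursion) (auto simp: ennreal_mult_less_top)
  have "p \<le> real n \<Longrightarrow> moment p < \<infinity>" if "-1 < p" "p < \<theta>" for n p
    using that
  proof (induction n arbitrary: p)
    case 0
    then show ?case by (intro nonpos) auto
  next
    case (Suc n)
    show ?case
    proof (cases "p \<le> 0")
      case False
      have "moment (p - 1) < \<infinity>" by (rule Suc.IH) (use Suc.prems False in auto)
      then show ?thesis by (rule step) (use Suc.prems False in auto)
    qed (use Suc.prems nonpos in auto)
  qed
  from this[OF p, of "nat \<lceil>p\<rceil>"] show ?thesis by (simp add: real_nat_ceiling_ge)
qed

text \<open>Passing to the logarithm makes powers of the functional exponential transforms, so that
  the same analyticity lemma serves for it and for \<xi>. The value of the logarithm at 0 matters
  only on a null set.\<close>

definition L :: "'a \<Rightarrow> real" where "L \<omega> = ln (R \<omega>)"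

lemma measurable_L [measurable]: "L \<in> borel_measurable M"
  unfolding L_def by measurable

lemma integrable_exp_L:
  assumes p: "-1 < p" "p < \<theta>"
  shows "integrable M (\<lambda>\<omega>. exp (p * L \<omega>))"
proof (rule integrableI_bounded)
  have "(\<integral>\<^sup>+\<omega>. ennreal (norm (exp (p * L \<omega>))) \<partial>M) = moment p"
    unfolding moment_def using R_pos
    by (intro nn_integral_cong_AE) (auto simp: L_def powr_def elim!: eventually_mono)
  then show "(\<integral>\<^sup>+\<omega>. ennreal (norm (exp (p * L \<omega>))) \<partial>M) < \<infinity>" using moment_finite[OF p] by simp
qed measurable

end

section \<open>Complex transforms\<close>

lemma nn_integral_halfline_exp:
  fixes \<sigma> l :: real
  assumes "\<sigma> > 0"
  shows "(\<integral>\<^sup>+x\<in>{..<l}. ennreal (exp (\<sigma> * x)) \<partial>lborel) = ennreal (exp (\<sigma> * l) / \<sigma>)"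
proof -
  have "(\<integral>\<^sup>+x\<in>{..<l}. ennreal (exp (\<sigma> * x)) \<partial>lborel) = (\<integral>\<^sup>+x. ennreal (exp (\<sigma> * (l - x))) * indicator {..<l} (l - x) \<partial>lborel)"
    by (subst nn_integral_real_affine[where c = "-1" and t = l]) auto
  also have "\<dots> = (\<integral>\<^sup>+x. ennreal (exp (\<sigma> * l)) * (ennreal (exp (- \<sigma> * x)) * indicator {0..} x) \<partial>lborel)"
  proof (rule nn_integral_cong_AE)
    show "AE x in lborel. ennreal (exp (\<sigma> * (l - x))) * indicator {..<l} (l - x) =
        ennreal (exp (\<sigma> * l)) * (ennreal (exp (- \<sigma> * x)) * indicator {0..} x)"
      using AE_lborel_singleton[of 0]
      by eventually_elim (auto simp: indicator_def ennreal_mult[symmetric] exp_add[symmetric] algebra_simps)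
  qed
  also have "\<dots> = ennreal (exp (\<sigma> * l)) * (\<integral>\<^sup>+x\<in>{0..}. ennreal (exp (- \<sigma> * x)) \<partial>lborel)"
    by (rule nn_integral_cmult) measurable
  also have "\<dots> = ennreal (exp (\<sigma> * l)) * ennreal (1 / \<sigma>)" using assms by (subst nn_integral_exp_halfline) auto
  also have "\<dots> = ennreal (exp (\<sigma> * l) / \<sigma>)" using assms by (subst ennreal_mult[symmetric]) auto
  finally show ?thesis .
qed

lemma integral_halfline_exp:
  fixes s :: complex and l :: real
  assumes s: "Re s > 0"
  shows "integrable lborel (\<lambda>x. indicator {..<l} x *\<^sub>R exp (s * of_real x))"
    and "(LBINT x:{..<l}. exp (s * of_real x)) = exp (s * of_real l) / s"
proof -
  have s0: "s \<noteq> 0" using s by auto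
  show int: "integrable lborel (\<lambda>x. indicator {..<l} x *\<^sub>R exp (s * of_real x))"
  proof (rule integrableI_bounded)
    have "(\<integral>\<^sup>+x. ennreal (norm (indicator {..<l} x *\<^sub>R exp (s * of_real x))) \<partial>lborel) = (\<integral>\<^sup>+x\<in>{..<l}. ennreal (exp (Re s * x)) \<partial>lborel)"
      by (intro nn_integral_cong) (auto split: split_indicator)
    then show "(\<integral>\<^sup>+x. ennreal (norm (indicator {..<l} x *\<^sub>R exp (s * of_real x))) \<partial>lborel) < \<infinity>"
      using s by (simp add: nn_integral_halfline_exp)
  qed measurable
  define F where "F z = exp (s * z) / s" for z
  have d: "(F has_field_derivative exp (s * z)) (at z)" for z
    unfolding F_def using s0 by (auto intro!: derivative_eq_intros)
  have dv: "((\<lambda>x. F (of_real x)) has_vector_derivative exp (s * of_real x)) (at x)" for x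
    by (intro has_vector_derivative_real_field) (rule d)
  have "(LBINT x=-\<infinity>..ereal l. exp (s * of_real x)) = F (of_real l) - 0"
  proof (rule interval_integral_FTC_integrable[where F = "\<lambda>x. F (of_real x)"])
    show "set_integrable lborel (einterval (-\<infinity>) (ereal l)) (\<lambda>x. exp (s * of_real x))"
    proof -
      have "einterval (-\<infinity>) (ereal l) = {..<l}" by (auto simp: einterval_def)
      then show ?thesis using int by (simp add: set_integrable_def)
    qed
    show "(((\<lambda>x. F (of_real x)) \<circ> real_of_ereal) \<longlongrightarrow> 0) (at_right (- \<infinity>))"
    proof -
      have "((\<lambda>x. exp (Re s * x) / norm s) \<longlongrightarrow> 0) at_bot" using s s0 by real_asymp
      then have "((\<lambda>x. F (of_real x)) \<longlongrightarrow> 0) at_bot"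
        by (rule Lim_null_comparison[rotated]) (simp add: F_def norm_divide)
      then show ?thesis by (simp only: ereal_tendsto_simps1)
    qed
    show "(((\<lambda>x. F (of_real x)) \<circ> real_of_ereal) \<longlongrightarrow> F (of_real l)) (at_left (ereal l))"
    proof -
      have "isCont (\<lambda>x. F (of_real x)) l" using has_vector_derivative_continuous[OF dv] .
      then have "((\<lambda>x. F (of_real x)) \<longlongrightarrow> F (of_real l)) (at_left l)" by (simp add: isCont_def filterlim_at_split)
      then show ?thesis by (simp only: ereal_tendsto_simps1)
    qed
  qed (use dv in auto)
  moreover have "(LBINT x=-\<infinity>..ereal l. exp (s * of_real x)) = (LBINT x:{..<l}. exp (s * of_real x))"
  proof -
    have "einterval (-\<infinity>) (ereal l) = {..<l}" by (auto simp: einterval_def)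
    then show ?thesis by (simp add: interval_lebesgue_integral_def)
  qed
  ultimately show "(LBINT x:{..<l}. exp (s * of_real x)) = exp (s * of_real l) / s" by (simp add: F_def)
qed

text \<open>The exponential of a multiple of the real logarithm stands for the complex power with
  exponent s - 1. At the endpoint 0 the integrand takes a default value, which the integral does not
  see; near 0 integrability comes from Re s > 0.\<close>

lemma integral_complex_power:
  fixes s :: complex and r :: real
  assumes s: "Re s > 0" and r: "r > 0"
  shows "(LBINT x:{0..r}. exp ((s - 1) * of_real (ln x))) = exp (s * of_real (ln r)) / s"
proof -
  have s0: "s \<noteq> 0" using s by auto
  have "integrable lborel (\<lambda>x. indicator {0<..<r} x *\<^sub>R exp ((s - 1) * of_real (ln x)))"
  proof (rule integrableI_bounded)
    have "(\<integral>\<^sup>+x. ennreal (norm (indicator {0<..<r} x *\<^sub>R exp ((s - 1) * of_real (ln x)))) \<partial>lborel) \<le>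
      (\<integral>\<^sup>+x. ennreal (1 / Re s) * (ennreal (Re s * x powr (Re s - 1)) * indicator {0..r} x) \<partial>lborel)"
      using s by (intro nn_integral_mono) (auto split: split_indicator simp: powr_def ennreal_mult[symmetric])
    also have "\<dots> = ennreal (1 / Re s) * (\<integral>\<^sup>+x\<in>{0..r}. ennreal (Re s * x powr (Re s - 1)) \<partial>lborel)"
      by (rule nn_integral_cmult) measurable
    also have "\<dots> < \<infinity>" using s r by (simp add: nn_integral_powr_Icc ennreal_mult_less_top)
    finally show "(\<integral>\<^sup>+x. ennreal (norm (indicator {0<..<r} x *\<^sub>R exp ((s - 1) * of_real (ln x)))) \<partial>lborel) < \<infinity>" .
  qed measurable
  then have int: "set_integrable lborel (einterval 0 (ereal r)) (\<lambda>x. exp ((s - 1) * of_real (ln x)))"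
    by (simp add: set_integrable_def einterval_def zero_ereal_def greaterThanLessThan_def greaterThan_def lessThan_def Int_def)
  define F where "F x = exp (s * of_real (ln x)) / s" for x :: real
  have dv: "(F has_vector_derivative exp ((s - 1) * of_real (ln x))) (at x)" if "x > 0" for x
  proof -
    have 1: "((\<lambda>z. exp (s * z) / s) has_field_derivative exp (s * of_real (ln x))) (at (of_real (ln x)))"
      using s0 by (auto intro!: derivative_eq_intros)
    have "(ln has_vector_derivative inverse x) (at x)"
      using DERIV_ln[OF that] by (simp add: has_real_derivative_iff_has_vector_derivative)
    then have 2: "((\<lambda>x. complex_of_real (ln x)) has_vector_derivative of_real (inverse x)) (at x)"
      by (rule bounded_linear.has_vector_derivative[OF bounded_linear_of_real])
    have "(((\<lambda>z. exp (s * z) / s) \<circ> (\<lambda>x. complex_of_real (ln x))) has_vector_derivative (of_real (inverse x) * exp (s * of_real (ln x)))) (at x)"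
      by (rule field_vector_diff_chain_at[OF 2 1])
    moreover have "complex_of_real (inverse x) = exp (- of_real (ln x))"
      using that by (simp add: exp_minus exp_of_real)
    ultimately show ?thesis
      by (simp add: F_def[abs_def] o_def exp_add[symmetric] algebra_simps)
  qed
  have "(LBINT x=0..ereal r. exp ((s - 1) * of_real (ln x))) = F r - 0"
  proof (rule interval_integral_FTC_integrable[OF _ _ _ int])
    show "((F \<circ> real_of_ereal) \<longlongrightarrow> 0) (at_right 0)"
    proof -
      have "((\<lambda>x. exp (Re s * ln x) / norm s) \<longlongrightarrow> 0) (at_right 0)" using s s0 by real_asymp
      then have "(F \<longlongrightarrow> 0) (at_right 0)"
        by (rule Lim_null_comparison[rotated]) (simp add: F_def norm_divide)
      then show ?thesis by (simp add: ereal_tendsto_simps1 zero_ereal_def)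
    qed
    show "((F \<circ> real_of_ereal) \<longlongrightarrow> F r) (at_left (ereal r))"
    proof -
      have "isCont F r" using has_vector_derivative_continuous[OF dv[OF r]] .
      then have "(F \<longlongrightarrow> F r) (at_left r)" by (simp add: isCont_def filterlim_at_split)
      then show ?thesis by (simp add: ereal_tendsto_simps1)
    qed
    show "isCont (\<lambda>x. exp ((s - 1) * of_real (ln x))) x" if "0 < ereal x" for x
      using that by (intro continuous_intros) auto
  qed (use r dv in \<open>auto simp: zero_ereal_def\<close>)
  moreover have "(LBINT x=0..ereal r. exp ((s - 1) * of_real (ln x))) = (LBINT x:{0..r}. exp ((s - 1) * of_real (ln x)))"
    using r by (simp add: zero_ereal_def interval_integral_Icc)
  ultimately show ?thesis by (simp add: F_def)
qed

section \<open>The Mellin transform and its functional equation\<close>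

context cramer_process
begin

definition \<phi> :: "real \<Rightarrow> complex \<Rightarrow> complex" where
  "\<phi> u s = (\<integral>\<omega>. exp (s * of_real (\<xi> u \<omega>)) \<partial>M)"

definition Mellin :: "complex \<Rightarrow> complex" where
  "Mellin s = (\<integral>\<omega>. exp (s * of_real (L \<omega>)) \<partial>M)"

lemma integrable_\<phi>:
  assumes "u \<ge> 0" "0 \<le> Re s" "Re s \<le> \<theta> + \<epsilon>"
  shows "integrable M (\<lambda>\<omega>. exp (s * of_real (\<xi> u \<omega>)))"
  by (rule integrable_exp_between[OF measurable_xi integrable_exp integrable_exp, of u 0 "\<theta> + \<epsilon>"])
     (use assms \<theta>_pos \<epsilon>_pos in auto)

lemma norm_\<phi>_le:
  assumes "u \<ge> 0" "0 \<le> Re s" "Re s \<le> \<theta> + \<epsilon>"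
  shows "norm (\<phi> u s) \<le> exp (u * \<kappa> (Re s))"
proof -
  have "norm (\<phi> u s) \<le> (\<integral>\<omega>. norm (exp (s * of_real (\<xi> u \<omega>))) \<partial>M)"
    unfolding \<phi>_def by (rule integral_norm_bound)
  then show ?thesis using assms by (simp add: integral_exp)
qed

text \<open>The first factor of the path is the increment up to u, the second an independent
  increment of length v. Multiplicativity in time serves below in place of a complex exponent, for
  which a branch of the logarithm would have to be chosen.\<close>

lemma \<phi>_add:
  assumes u: "u \<ge> 0" "v \<ge> 0" and s: "0 \<le> Re s" "Re s \<le> \<theta> + \<epsilon>"
  shows "\<phi> (u + v) s = \<phi> u s * \<phi> v s"
proof -
  define t where "t = (\<lambda>i::nat. if i = 0 then 0 else if i = 1 then u else u + v)"
  define Y where "Y = (\<lambda>(i::nat) \<omega>. exp (s * of_real (\<xi> (t (Suc i)) \<omega> - \<xi> (t i) \<omega>)))"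
  have law: "(\<integral>\<omega>. exp (s * of_real (\<xi> (a + h) \<omega> - \<xi> a \<omega>)) \<partial>M) = \<phi> h s \<and>
      integrable M (\<lambda>\<omega>. exp (s * of_real (\<xi> (a + h) \<omega> - \<xi> a \<omega>)))" if "a \<ge> 0" "h \<ge> 0" for a h
  proof -
    have [measurable]: "\<xi> a \<in> borel_measurable M" "\<xi> h \<in> borel_measurable M" "\<xi> (a + h) \<in> borel_measurable M"
      using that by (auto intro: measurable_xi)
    have "integrable (distr M borel (\<xi> h)) (\<lambda>x. exp (s * of_real x))"
      using integrable_\<phi>[OF that(2) s] by (simp add: integrable_distr_eq)
    then have "integrable M (\<lambda>\<omega>. exp (s * of_real (\<xi> (a + h) \<omega> - \<xi> a \<omega>)))"
      unfolding stationary_increments[OF that, symmetric] by (subst (asm) integrable_distr_eq) auto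
    moreover have "(\<integral>\<omega>. exp (s * of_real (\<xi> (a + h) \<omega> - \<xi> a \<omega>)) \<partial>M) = (\<integral>x. exp (s * of_real x) \<partial>distr M borel (\<lambda>\<omega>. \<xi> (a + h) \<omega> - \<xi> a \<omega>))"
      by (subst integral_distr) auto
    moreover have "\<dots> = \<phi> h s"
      unfolding stationary_increments[OF that] \<phi>_def by (subst integral_distr) auto
    ultimately show ?thesis by simp
  qed
  have "indep_vars (\<lambda>_. borel) (\<lambda>i \<omega>. \<xi> (t (Suc i)) \<omega> - \<xi> (t i) \<omega>) {..<2::nat}"
    using u by (intro indep_increments) (auto simp: t_def)
  then have ind: "indep_vars (\<lambda>_. borel) Y {..<2}"
    unfolding Y_def by (rule indep_vars_compose2[where Y = "\<lambda>_ x. exp (s * of_real x)"]) auto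
  have [measurable]: "\<xi> 0 \<in> borel_measurable M" "\<xi> u \<in> borel_measurable M" "\<xi> (u + v) \<in> borel_measurable M"
    using u by (auto intro: measurable_xi)
  have "\<phi> (u + v) s = (\<integral>\<omega>. (\<Prod>i<2. Y i \<omega>) \<partial>M)"
    unfolding \<phi>_def
  proof (rule integral_cong_AE)
    show "AE \<omega> in M. exp (s * of_real (\<xi> (u + v) \<omega>)) = (\<Prod>i<2. Y i \<omega>)"
      using starts_at_0
      by eventually_elim (simp add: Y_def t_def numeral_2_eq_2 exp_add[symmetric] algebra_simps)
  qed (auto simp: Y_def t_def numeral_2_eq_2)
  also have "\<dots> = (\<Prod>i<2. \<integral>\<omega>. Y i \<omega> \<partial>M)"
  proof (rule indep_vars_lebesgue_integral[OF _ ind])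
    show "integrable M (Y i)" if "i \<in> {..<2}" for i
      using that law[of 0 u] law[of u v] u by (auto simp: Y_def t_def less_Suc_eq numeral_2_eq_2)
  qed simp
  also have "\<dots> = \<phi> u s * \<phi> v s"
    using law[of 0 u] law[of u v] u by (simp add: Y_def t_def numeral_2_eq_2)
  finally show ?thesis .
qed

lemma measurable_\<phi>: "(\<lambda>u. \<integral>\<omega>. exp (s * complex_of_real (path_value (u, \<omega>))) \<partial>M) \<in> borel_measurable borel"
  by (rule borel_measurable_lebesgue_integral) (simp add: case_prod_beta')

text \<open>The integral of \<open>\<phi> u s\<close> over 0 \<le> u \<le> 1, written over the
  product of time and probability space. In this form it is a single exponential transform and
  inherits analyticity up to Re s < \<theta> + \<epsilon>.\<close>

definition local_transform :: "complex \<Rightarrow> complex" where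
  "local_transform s = (\<integral>x. exp (s * of_real (path_value x)) \<partial>(density lborel (indicator {0..1}) \<Otimes>\<^sub>M M))"

lemma measurable_path_density [measurable]: "path_value \<in> borel_measurable (density lborel (indicator {0..1}) \<Otimes>\<^sub>M M)"
proof -
  have "sets (density lborel (indicator {0..1}) \<Otimes>\<^sub>M M) = sets (borel \<Otimes>\<^sub>M M)"
    by (rule sets_pair_measure_cong) auto
  then show ?thesis using measurable_path by (simp cong: measurable_cong_sets)
qed

lemma integrable_exp_path:
  assumes "0 \<le> a" "a \<le> \<theta> + \<epsilon>"
  shows "integrable (density lborel (indicator {0..1}) \<Otimes>\<^sub>M M) (\<lambda>x. exp (a * path_value x))"
proof (rule integrableI_bounded)
  let ?U = "density lborel (indicator {0..1}) :: real measure"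
  have "(\<integral>\<^sup>+x. ennreal (norm (exp (a * path_value x))) \<partial>(?U \<Otimes>\<^sub>M M)) = (\<integral>\<^sup>+u. \<integral>\<^sup>+\<omega>. ennreal (exp (a * path_value (u, \<omega>))) \<partial>M \<partial>?U)"
    by (subst nn_integral_fst[symmetric]) auto
  also have "\<dots> = (\<integral>\<^sup>+u. indicator {0..1} u * (\<integral>\<^sup>+\<omega>. ennreal (exp (a * path_value (u, \<omega>))) \<partial>M) \<partial>lborel)"
  proof (rule nn_integral_density)
    show "(\<lambda>u. \<integral>\<^sup>+\<omega>. ennreal (exp (a * path_value (u, \<omega>))) \<partial>M) \<in> borel_measurable lborel"
    proof -
      have "(\<lambda>u. \<integral>\<^sup>+\<omega>. ennreal (exp (a * path_value (u, \<omega>))) \<partial>M) \<in> borel_measurable borel"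
        by (rule borel_measurable_nn_integral) (simp add: case_prod_beta')
      then show ?thesis by simp
    qed
  qed simp
  also have "\<dots> \<le> (\<integral>\<^sup>+(u::real). ennreal (exp \<bar>\<kappa> a\<bar>) * indicator {0..1} u \<partial>lborel)"
  proof (intro nn_integral_mono)
    fix u :: real
    have "u * \<kappa> a \<le> \<bar>\<kappa> a\<bar>" if "0 \<le> u" "u \<le> 1"
    proof -
      have "u * \<kappa> a \<le> u * \<bar>\<kappa> a\<bar>" using that by (intro mult_left_mono) auto
      also have "\<dots> \<le> \<bar>\<kappa> a\<bar>" using that by (intro mult_left_le_one_le) auto
      finally show ?thesis .
    qed
    then show "indicator {0..1} u * (\<integral>\<^sup>+\<omega>. ennreal (exp (a * path_value (u, \<omega>))) \<partial>M) \<le> ennreal (exp \<bar>\<kappa> a\<bar>) * indicator {0..1} u"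
      using assms by (auto simp: path_eq nn_integral_exp intro!: ennreal_leI split: split_indicator)
  qed
  also have "\<dots> < \<infinity>" by (simp add: nn_integral_cmult_indicator)
  finally show "(\<integral>\<^sup>+x. ennreal (norm (exp (a * path_value x))) \<partial>(?U \<Otimes>\<^sub>M M)) < \<infinity>" .
qed measurable

lemma local_transform_eq:
  assumes s: "0 \<le> Re s" "Re s \<le> \<theta> + \<epsilon>"
  shows "local_transform s = (LBINT u:{0..1}. \<phi> u s)"
    and "set_integrable lborel {0..1} (\<lambda>u. \<phi> u s)"
proof -
  let ?U = "density lborel (indicator {0..1}) :: real measure"
  interpret U: sigma_finite_measure ?U
    by (intro finite_measure.axioms(1) finite_measureI) (simp add: emeasure_density)
  interpret UM: pair_sigma_finite ?U M ..
  have int: "integrable (?U \<Otimes>\<^sub>M M) (\<lambda>x. exp (s * of_real (path_value x)))"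
    by (rule integrable_exp_between[OF measurable_path_density integrable_exp_path integrable_exp_path, of 0 "\<theta> + \<epsilon>"])
       (use s \<theta>_pos \<epsilon>_pos in auto)
  have path_value: "indicator {0..1} u *\<^sub>R (\<integral>\<omega>. exp (s * of_real (path_value (u, \<omega>))) \<partial>M) = indicator {0..1} u *\<^sub>R \<phi> u s" for u :: real
    by (auto simp: indicator_def \<phi>_def path_eq)
  have "local_transform s = (\<integral>u. \<integral>\<omega>. exp (s * of_real (path_value (u, \<omega>))) \<partial>M \<partial>?U)"
    unfolding local_transform_def using UM.integral_fst'[OF int] by simp
  also have "\<dots> = (LBINT u. indicator {0..1} u *\<^sub>R (\<integral>\<omega>. exp (s * of_real (path_value (u, \<omega>))) \<partial>M))"
    unfolding ennreal_indicator[symmetric] using measurable_\<phi> by (subst integral_density) auto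
  finally show "local_transform s = (LBINT u:{0..1}. \<phi> u s)" by (simp only: path_value set_lebesgue_integral_def)
  have "integrable ?U (\<lambda>u. \<integral>\<omega>. exp (s * of_real (path_value (u, \<omega>))) \<partial>M)"
    using UM.integrable_fst'[OF int] by simp
  then have "integrable lborel (\<lambda>u. indicator {0..1} u *\<^sub>R (\<integral>\<omega>. exp (s * of_real (path_value (u, \<omega>))) \<partial>M))"
    unfolding ennreal_indicator[symmetric] using measurable_\<phi> by (subst (asm) integrable_density) auto
  then show "set_integrable lborel {0..1} (\<lambda>u. \<phi> u s)" by (simp only: path_value set_integrable_def)
qed

lemma set_integrable_\<phi>:
  assumes s: "0 < Re s" "Re s < \<theta>"
  shows "set_integrable lborel {0..} (\<lambda>u. \<phi> u s)"
proof -
  have \<kappa>s: "\<kappa> (Re s) < 0" using s by (intro \<kappa>_neg)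
  have path_value: "indicator {0..} u *\<^sub>R (\<integral>\<omega>. exp (s * of_real (path_value (u, \<omega>))) \<partial>M) = indicator {0..} u *\<^sub>R \<phi> u s" for u :: real
    by (auto simp: indicator_def \<phi>_def path_eq)
  have "integrable lborel (\<lambda>u. indicator {0..} u *\<^sub>R (\<integral>\<omega>. exp (s * of_real (path_value (u, \<omega>))) \<partial>M))"
  proof (rule integrableI_bounded)
    have "(\<integral>\<^sup>+u. ennreal (norm (indicator {0..} u *\<^sub>R \<phi> u s)) \<partial>lborel) \<le> (\<integral>\<^sup>+u\<in>{0..}. ennreal (exp (- (- \<kappa> (Re s)) * u)) \<partial>lborel)"
      using norm_\<phi>_le[of _ s] s \<epsilon>_pos
      by (intro nn_integral_mono) (auto split: split_indicator intro!: ennreal_leI simp: mult.commute)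
    also have "\<dots> < \<infinity>" using \<kappa>s by (subst nn_integral_exp_halfline) auto
    finally show "(\<integral>\<^sup>+u. ennreal (norm (indicator {0..} u *\<^sub>R (\<integral>\<omega>. exp (s * of_real (path_value (u, \<omega>))) \<partial>M))) \<partial>lborel) < \<infinity>"
      by (simp only: path_value)
  qed (use measurable_\<phi> in measurable)
  then show ?thesis by (simp only: path_value set_integrable_def)
qed

text \<open>The part of the integral after time 1, shifted back by one unit, reproduces the whole
  integral with the factor \<open>\<phi> 1 s\<close>. This trades an integral shown to converge left
  of \<theta> for two functions that are analytic beyond \<theta>.\<close>

lemma renewal_\<phi>:
  assumes s: "0 < Re s" "Re s < \<theta>"
  shows "(LBINT u:{0..}. \<phi> u s) * (1 - \<phi> 1 s) = local_transform s"
proof -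
  note int = set_integrable_\<phi>[OF s]
  have "(LBINT u:{0..1} \<union> {1<..}. \<phi> u s) = (LBINT u:{0..1}. \<phi> u s) + (LBINT u:{1<..}. \<phi> u s)"
    by (rule set_integral_Un) (auto intro: set_integrable_subset[OF int])
  also have "{0..1} \<union> {1<..} = {0::real..}" by auto
  also have "(LBINT u:{1<..}. \<phi> u s) = (LBINT u. indicator {1<..} (1 + u) *\<^sub>R \<phi> (1 + u) s)"
    unfolding set_lebesgue_integral_def by (subst lborel_integral_real_affine[where c = 1 and t = 1]) auto
  also have "\<dots> = (LBINT u. \<phi> 1 s * (indicator {0<..} u *\<^sub>R \<phi> u s))"
    using s \<epsilon>_pos by (intro Bochner_Integration.integral_cong) (auto simp: indicator_def \<phi>_add)
  also have "\<dots> = \<phi> 1 s * (LBINT u:{0<..}. \<phi> u s)" 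
    unfolding set_lebesgue_integral_def by (rule integral_mult_right_zero)
  also have "(LBINT u:{0<..}. \<phi> u s) = (LBINT u:{0..}. \<phi> u s)"
  proof -
    have "(LBINT u:{0<..}. \<phi> u s) = (LBINT u:{0<..} \<union> {0}. \<phi> u s) - (LBINT u:{0}. \<phi> u s)"
      by (subst set_integral_Un) (auto intro: set_integrable_subset[OF int])
    moreover have "{0<..} \<union> {0} = {0::real..}" by auto
    moreover have "(LBINT u:{0}. \<phi> u s) = 0"
      unfolding set_lebesgue_integral_def
    proof (rule integral_eq_zero_AE)
      show "AE u in lborel. indicator {0} u *\<^sub>R \<phi> u s = 0"
        using AE_lborel_singleton[of 0] by eventually_elim simp
    qed
    ultimately show ?thesis by simp
  qed
  finally have E: "(LBINT u:{0..}. \<phi> u s) = (LBINT u:{0..1}. \<phi> u s) + \<phi> 1 s * (LBINT u:{0..}. \<phi> u s)" .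
  have solve: "x * (1 - c) = k" if "x = k + c * x" for x c k :: complex
  proof -
    have "x - c * x = k" using that by (simp only: diff_eq_eq)
    then show ?thesis by (simp add: right_diff_distrib mult.commute)
  qed
  have "local_transform s = (LBINT u:{0..1}. \<phi> u s)"
    using s \<epsilon>_pos by (intro local_transform_eq(1)) auto
  then show ?thesis using solve[OF E] by (simp only:)
qed

abbreviation future :: "real \<Rightarrow> 'a \<Rightarrow> ennreal" where
  "future u \<equiv> restarted u (remaining {0..} u)"

text \<open>Positivity of the whole functional, transferred by equality in law. It is required
  because the logarithm turns the product in \<open>tail_eq\<close> into a sum only for positive
  factors.\<close>

lemma restarted_pos:
  assumes u: "u \<ge> 0"
  shows "AE \<omega> in M. enn2real (future u \<omega>) > 0"
proof -
  have B: "{0..} \<in> sets (borel :: real measure)" by simp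
  note rp = remaining_props[OF B, of u]
  note [measurable] = measurable_restarted[OF rp u] measurable_exp_int[OF rp]
  define h :: "ennreal \<Rightarrow> ennreal" where "h r = (if enn2real r = 0 then 1 else 0)" for r
  have [measurable]: "h \<in> borel_measurable borel" unfolding h_def by measurable
  have "(\<integral>\<^sup>+\<omega>. h (future u \<omega>) \<partial>M) = (\<integral>\<^sup>+\<omega>. h (exp_int (remaining {0..} u) \<omega>) \<partial>M)"
    using nn_integral_restarted[OF u rp, of "\<lambda>_. 1" h] by (simp add: emeasure_space_1)
  also have "\<dots> = (\<integral>\<^sup>+\<omega>. 0 \<partial>M)"
    using R_pos by (intro nn_integral_cong_AE) (auto simp: exp_int_remaining_halfline[OF u] h_def R_def elim!: eventually_mono)
  finally have "(\<integral>\<^sup>+\<omega>. h (future u \<omega>) \<partial>M) = 0" by simp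
  then have "AE \<omega> in M. h (future u \<omega>) = 0"
    by (subst (asm) nn_integral_0_iff_AE) auto
  then show ?thesis
    by eventually_elim (auto simp: h_def less_le split: if_splits)
qed

text \<open>The complex counterpart of \<open>moment_recursion\<close>: the same substitution and
  the same independence, with Fubini in place of Tonelli.\<close>

lemma Mellin_functional_equation:
  assumes s: "0 < Re s" "Re s < \<theta>"
  shows "Mellin s = s * (LBINT u:{0..}. \<phi> u s) * Mellin (s - 1)"
proof -
  have s0: "s \<noteq> 0" using s by auto
  have B: "{0..} \<in> sets (borel :: real measure)" "{0..} \<subseteq> {0::real..}" by auto
  have \<kappa>s: "\<kappa> (Re s) < 0" using s by (intro \<kappa>_neg)
  interpret P: pair_sigma_finite lborel M by standard
  define k where "k r = exp ((s - 1) * of_real (ln r))" for r :: real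
  have [measurable]: "k \<in> borel_measurable borel" unfolding k_def by measurable
  define F where "F u \<omega> = (indicator {0..} u * exp (path_value (u, \<omega>))) *\<^sub>R k (tail {0..} u \<omega>)" for u \<omega>
  have meas [measurable]: "case_prod F \<in> borel_measurable (lborel \<Otimes>\<^sub>M M)"
  proof -
    have "(\<lambda>x. tail {0..} (fst x) (snd x)) \<in> borel_measurable (lborel \<Otimes>\<^sub>M M)" using measurable_tail[OF B(1)] by simp
    moreover have "path_value \<in> borel_measurable (lborel \<Otimes>\<^sub>M M)" using measurable_path by simp
    ultimately show ?thesis unfolding F_def case_prod_beta' by measurable
  qed
  define h where "h r = k (enn2real r)" for r
  have [measurable]: "h \<in> borel_measurable borel" unfolding h_def by measurable
  have AE_F: "AE \<omega> in M. F u \<omega> = exp (s * of_real (\<xi> u \<omega>)) * h (future u \<omega>) \<and>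
      norm (F u \<omega>) = exp (Re s * \<xi> u \<omega>) * enn2real (future u \<omega>) powr (Re s - 1)" if u: "u \<ge> 0" for u
    using restarted_pos[OF u] AE_space
  proof eventually_elim
    case (elim \<omega>)
    define r where "r = enn2real (future u \<omega>)"
    have r: "r > 0" using elim by (simp add: r_def)
    have "ln (tail {0..} u \<omega>) = \<xi> u \<omega> + ln r"
      unfolding tail_eq[OF u B elim(2)] r_def[symmetric] using r by (simp add: ln_mult)
    then have "F u \<omega> = exp (of_real (\<xi> u \<omega>)) * exp ((s - 1) * (of_real (\<xi> u \<omega>) + of_real (ln r)))"
      using u by (simp add: F_def k_def path_eq scaleR_conv_of_real exp_of_real)
    also have "\<dots> = exp (s * of_real (\<xi> u \<omega>)) * h (future u \<omega>)"
      unfolding h_def k_def r_def[symmetric] exp_add[symmetric] by (simp add: algebra_simps)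
    finally have 1: "F u \<omega> = exp (s * of_real (\<xi> u \<omega>)) * h (future u \<omega>)" .
    moreover have "norm (F u \<omega>) = exp (Re s * \<xi> u \<omega>) * r powr (Re s - 1)"
      unfolding 1 h_def k_def r_def[symmetric] using r by (simp add: norm_mult powr_def)
    ultimately show ?case by (simp add: r_def)
  qed
  \<comment> \<open>The double integral of the norm is the real computation at Re s: it equals the
    moment of order Re s - 1 divided by - \<kappa> (Re s). That order lies between -1 and \<theta>,
    so the moment is finite.\<close>
  have int: "integrable (lborel \<Otimes>\<^sub>M M) (case_prod F)"
  proof (rule integrableI_bounded)
    have "(\<integral>\<^sup>+x. ennreal (norm (case_prod F x)) \<partial>(lborel \<Otimes>\<^sub>M M)) = (\<integral>\<^sup>+u. \<integral>\<^sup>+\<omega>. ennreal (norm (F u \<omega>)) \<partial>M \<partial>lborel)"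
      by (subst nn_integral_fst[symmetric]) auto
    also have "\<dots> = (\<integral>\<^sup>+u. moment (Re s - 1) * (ennreal (exp (- (- \<kappa> (Re s)) * u)) * indicator {0..} u) \<partial>lborel)"
    proof (rule nn_integral_cong)
      fix u :: real
      show "(\<integral>\<^sup>+\<omega>. ennreal (norm (F u \<omega>)) \<partial>M) = moment (Re s - 1) * (ennreal (exp (- (- \<kappa> (Re s)) * u)) * indicator {0..} u)"
      proof (cases "u \<ge> 0")
        case u: True
        have "(\<integral>\<^sup>+\<omega>. ennreal (norm (F u \<omega>)) \<partial>M) = (\<integral>\<^sup>+\<omega>. ennreal (exp (Re s * \<xi> u \<omega>)) * ennreal (enn2real (future u \<omega>) powr (Re s - 1)) \<partial>M)"
        proof (rule nn_integral_cong_AE)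
          show "AE \<omega> in M. ennreal (norm (F u \<omega>)) = ennreal (exp (Re s * \<xi> u \<omega>)) * ennreal (enn2real (future u \<omega>) powr (Re s - 1))"
            using AE_F[OF u]
          proof eventually_elim
            case (elim \<omega>)
            show ?case unfolding elim[THEN conjunct2] by (simp add: ennreal_mult)
          qed
        qed
        also have "\<dots> = exp_moment (Re s) u * power_moment (remaining {0..} u) (Re s - 1)"
          by (subst nn_integral_restarted[OF u remaining_props[OF B(1)], where f = "\<lambda>x. ennreal (exp (Re s * x))" and h = "\<lambda>r. ennreal (enn2real r powr (Re s - 1))"]) auto
        also have "\<dots> = ennreal (exp (u * \<kappa> (Re s))) * moment (Re s - 1)"
          using s u \<epsilon>_pos by (simp add: nn_integral_exp exp_int_remaining_halfline moment_def R_def)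
        finally show ?thesis using u by (simp add: mult_ac)
      qed (simp add: F_def)
    qed
    also have "\<dots> = moment (Re s - 1) * (\<integral>\<^sup>+u\<in>{0..}. ennreal (exp (- (- \<kappa> (Re s)) * u)) \<partial>lborel)"
      by (rule nn_integral_cmult) measurable
    also have "\<dots> < \<infinity>"
      using moment_finite[of "Re s - 1"] s \<kappa>s by (subst nn_integral_exp_halfline) (auto simp: ennreal_mult_less_top)
    finally show "(\<integral>\<^sup>+x. ennreal (norm (case_prod F x)) \<partial>(lborel \<Otimes>\<^sub>M M)) < \<infinity>" .
  qed simp
  have inth: "integrable M (\<lambda>\<omega>. exp ((s - 1) * of_real (L \<omega>)))"
    by (rule integrable_exp_between[OF measurable_L integrable_exp_L integrable_exp_L, of "Re s - 1" "Re s - 1"]) (use s in auto)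
  have "Mellin s / s = (\<integral>\<omega>. (LBINT u. F u \<omega>) \<partial>M)"
  proof -
    have "Mellin s / s = (\<integral>\<omega>. exp (s * of_real (L \<omega>)) / s \<partial>M)" by (simp add: Mellin_def)
    also have "\<dots> = (\<integral>\<omega>. (LBINT u. F u \<omega>) \<partial>M)"
    proof (rule integral_cong_AE)
      show "AE \<omega> in M. exp (s * of_real (L \<omega>)) / s = (LBINT u. F u \<omega>)"
        using A_inf_finite R_pos AE_space
      proof eventually_elim
        case (elim \<omega>)
        note [measurable] = measurable_path_at[OF elim(3)]
        have "(LBINT u. F u \<omega>) = (LBINT r:{0..R \<omega>}. k r)"
          unfolding F_def tail_def R_def exp_int_path[OF B(2)]
          by (rule integral_tail_substitution) (use elim(1) in \<open>auto simp: exp_int_path[OF B(2)]\<close>)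
        also have "\<dots> = exp (s * of_real (L \<omega>)) / s"
          unfolding k_def L_def by (rule integral_complex_power[OF s(1) elim(2)])
        finally show ?case by simp
      qed
      show "(\<lambda>\<omega>. LBINT u. F u \<omega>) \<in> borel_measurable M"
        using P.integrable_snd[OF int] by (simp add: borel_measurable_integrable)
    qed measurable
    finally show ?thesis .
  qed
  also have "\<dots> = (LBINT u. \<integral>\<omega>. F u \<omega> \<partial>M)"
    using P.Fubini_integral[OF int] by simp
  also have "\<dots> = (LBINT u. (indicator {0..} u *\<^sub>R \<phi> u s) * Mellin (s - 1))"
  proof (intro Bochner_Integration.integral_cong refl)
    fix u :: real
    show "(\<integral>\<omega>. F u \<omega> \<partial>M) = (indicator {0..} u *\<^sub>R \<phi> u s) * Mellin (s - 1)"
    proof (cases "u \<ge> 0")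
      case u: True
      note rp = remaining_props[OF B(1), of u]
      note [measurable] = measurable_restarted[OF rp u] measurable_xi[OF u]
      have meq: "h (exp_int (remaining {0..} u) \<omega>) = exp ((s - 1) * of_real (L \<omega>))" for \<omega>
        by (simp add: exp_int_remaining_halfline[OF u] h_def k_def L_def R_def)
      have Fm: "(\<lambda>\<omega>. F u \<omega>) \<in> borel_measurable M"
        using measurable_compose[OF measurable_Pair1' meas, of u] by simp
      have "(\<integral>\<omega>. F u \<omega> \<partial>M) = (\<integral>\<omega>. exp (s * of_real (\<xi> u \<omega>)) * h (future u \<omega>) \<partial>M)"
      proof (rule integral_cong_AE[OF Fm])
        show "AE \<omega> in M. F u \<omega> = exp (s * of_real (\<xi> u \<omega>)) * h (future u \<omega>)"
          using AE_F[OF u] by (rule eventually_mono) (rule conjunct1)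
      qed measurable
      also have "\<dots> = (\<integral>\<omega>. exp (s * of_real (\<xi> u \<omega>)) \<partial>M) * (\<integral>\<omega>. h (exp_int (remaining {0..} u) \<omega>) \<partial>M)"
        using s u \<epsilon>_pos inth
        by (intro integral_restarted[OF u rp, where f = "\<lambda>x. exp (s * of_real x)"]) (auto simp: meq integrable_\<phi>)
      finally show ?thesis using u by (simp add: meq \<phi>_def Mellin_def)
    qed (simp add: F_def)
  qed
  also have "\<dots> = (LBINT u:{0..}. \<phi> u s) * Mellin (s - 1)"
    unfolding set_lebesgue_integral_def by (rule integral_mult_left_zero)
  finally show ?thesis using s0 by (simp add: field_simps)
qed

abbreviation log_tail :: "real \<Rightarrow> real" where
  "log_tail x \<equiv> prob {\<omega>\<in>space M. L \<omega> > x}"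

text \<open>Fubini applied to exp (s * L) / s as the integral of exp (s * x) over x < L; the
  expectation of the indicator of x < L is the tail.\<close>

lemma tail_transform:
  assumes s: "0 < Re s" "Re s < \<theta>"
  shows "integrable lborel (\<lambda>x. exp (s * of_real x) * of_real (log_tail x))"
    and "(LBINT x. exp (s * of_real x) * of_real (log_tail x)) = Mellin s / s"
proof -
  interpret P: pair_sigma_finite lborel M by standard
  define F where "F x \<omega> = indicator {..<L \<omega>} x *\<^sub>R exp (s * of_real x)" for x \<omega>
  have [measurable]: "case_prod F \<in> borel_measurable (lborel \<Otimes>\<^sub>M M)"
  proof -
    have "case_prod F = (\<lambda>p. if fst p < L (snd p) then exp (s * complex_of_real (fst p)) else 0)"
      by (auto simp: fun_eq_iff F_def)
    also have "\<dots> \<in> borel_measurable (borel \<Otimes>\<^sub>M M)" by measurable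
    finally show ?thesis by simp
  qed
  have int: "integrable (lborel \<Otimes>\<^sub>M M) (case_prod F)"
  proof (rule integrableI_bounded)
    have "(\<integral>\<^sup>+x. ennreal (norm (case_prod F x)) \<partial>(lborel \<Otimes>\<^sub>M M)) = (\<integral>\<^sup>+\<omega>. \<integral>\<^sup>+x. ennreal (norm (F x \<omega>)) \<partial>lborel \<partial>M)"
      by (subst P.nn_integral_snd[symmetric]) auto
    also have "\<dots> = (\<integral>\<^sup>+\<omega>. ennreal (exp (Re s * L \<omega>) / Re s) \<partial>M)"
    proof (rule nn_integral_cong)
      fix \<omega>
      have "(\<integral>\<^sup>+x. ennreal (norm (F x \<omega>)) \<partial>lborel) = (\<integral>\<^sup>+x\<in>{..<L \<omega>}. ennreal (exp (Re s * x)) \<partial>lborel)"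
        by (intro nn_integral_cong) (auto simp: F_def split: split_indicator)
      then show "(\<integral>\<^sup>+x. ennreal (norm (F x \<omega>)) \<partial>lborel) = ennreal (exp (Re s * L \<omega>) / Re s)"
        using s by (simp add: nn_integral_halfline_exp)
    qed
    also have "\<dots> < \<infinity>"
    proof -
      have i: "integrable M (\<lambda>\<omega>. exp (Re s * L \<omega>) / Re s)"
        using s by (intro integrable_divide integrable_exp_L) auto
      show ?thesis using s by (subst nn_integral_eq_integral[OF i]) auto
    qed
    finally show "(\<integral>\<^sup>+x. ennreal (norm (case_prod F x)) \<partial>(lborel \<Otimes>\<^sub>M M)) < \<infinity>" .
  qed simp
  have inner: "(\<integral>\<omega>. F x \<omega> \<partial>M) = exp (s * of_real x) * of_real (log_tail x)" for x
  proof -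
    have "(\<integral>\<omega>. F x \<omega> \<partial>M) = (\<integral>\<omega>. indicator {\<omega>\<in>space M. L \<omega> > x} \<omega> *\<^sub>R exp (s * of_real x) \<partial>M)"
      by (intro Bochner_Integration.integral_cong) (auto simp: F_def indicator_def)
    also have "\<dots> = (\<integral>\<omega>. indicator {\<omega>\<in>space M. L \<omega> > x} \<omega> \<partial>M) *\<^sub>R exp (s * of_real x)"
      by (rule integral_scaleR_left) (auto simp: emeasure_eq_measure intro!: integrable_real_indicator)
    finally show ?thesis by (simp add: scaleR_conv_of_real mult.commute)
  qed
  show "integrable lborel (\<lambda>x. exp (s * of_real x) * of_real (log_tail x))"
    using P.integrable_fst'[OF int] by (simp add: inner)
  have "(LBINT x. exp (s * of_real x) * of_real (log_tail x)) = (LBINT x. \<integral>\<omega>. F x \<omega> \<partial>M)"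
    by (simp add: inner)
  also have "\<dots> = (\<integral>\<omega>. (LBINT x. F x \<omega>) \<partial>M)" using P.Fubini_integral[OF int] by simp
  also have "\<dots> = (\<integral>\<omega>. exp (s * of_real (L \<omega>)) / s \<partial>M)"
    unfolding F_def using integral_halfline_exp(2)[OF s(1)] by (simp add: set_lebesgue_integral_def)
  also have "\<dots> = Mellin s / s" by (simp add: Mellin_def)
  finally show "(LBINT x. exp (s * of_real x) * of_real (log_tail x)) = Mellin s / s" .
qed

section \<open>The tail of the exponential functional\<close>

definition \<phi>1 :: "complex \<Rightarrow> complex" where "\<phi>1 = \<phi> 1"

lemma \<phi>1_has_field_derivative:
  assumes "0 < Re s" "Re s < \<theta> + \<epsilon>"
  shows "(\<phi>1 has_field_derivative (\<integral>\<omega>. of_real (\<xi> 1 \<omega>) * exp (s * of_real (\<xi> 1 \<omega>)) \<partial>M)) (at s)"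
  unfolding \<phi>1_def \<phi>_def
  by (rule exp_transform_has_field_derivative(2)[OF measurable_xi_1 integrable_exp integrable_exp, of 0 "\<theta> + \<epsilon>"])
     (use assms \<theta>_pos \<epsilon>_pos in auto)

lemma \<phi>1_\<theta>: "\<phi>1 (of_real \<theta>) = 1"
proof -
  have "\<phi>1 (of_real \<theta>) = (\<integral>\<omega>. of_real (exp (\<theta> * \<xi> 1 \<omega>)) \<partial>M)"
    by (simp add: \<phi>1_def \<phi>_def exp_of_real[symmetric])
  also have "\<dots> = of_real (\<integral>\<omega>. exp (\<theta> * \<xi> 1 \<omega>) \<partial>M)" by (rule integral_complex_of_real)
  also have "\<dots> = 1" using \<theta>_pos \<epsilon>_pos by (simp add: integral_exp \<kappa>_\<theta>)
  finally show ?thesis .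
qed

text \<open>The slope at \<theta> of the exponential moment as a function of its order. The tangent
  at \<theta> lies below this convex function, which takes the value 1 at \<theta> and a smaller
  value at \<theta> / 2; the slope must therefore be positive.\<close>

lemma drift_pos: "(\<integral>\<omega>. \<xi> 1 \<omega> * exp (\<theta> * \<xi> 1 \<omega>) \<partial>M) > 0"
proof -
  define l where "l = \<theta> / 2"
  have l: "0 < l" "l < \<theta>" using \<theta>_pos by (auto simp: l_def)
  have i1: "integrable M (\<lambda>\<omega>. \<xi> 1 \<omega> * exp (\<theta> * \<xi> 1 \<omega>))"
  proof -
    have "integrable M (\<lambda>\<omega>. complex_of_real (\<xi> 1 \<omega>) * exp (of_real \<theta> * complex_of_real (\<xi> 1 \<omega>)))"
      by (rule exp_transform_has_field_derivative(1)[OF measurable_xi_1 integrable_exp integrable_exp, of 0 "\<theta> + \<epsilon>"])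
         (use \<theta>_pos \<epsilon>_pos in auto)
    then have "integrable M (\<lambda>\<omega>. complex_of_real (\<xi> 1 \<omega> * exp (\<theta> * \<xi> 1 \<omega>)))"
      by (simp add: exp_of_real[symmetric])
    then show ?thesis by (simp only: complex_of_real_integrable_eq)
  qed
  have "exp (\<kappa> l) - 1 = (\<integral>\<omega>. exp (l * \<xi> 1 \<omega>) - exp (\<theta> * \<xi> 1 \<omega>) \<partial>M)"
    using l \<theta>_pos \<epsilon>_pos by (subst Bochner_Integration.integral_diff) (auto simp: integral_exp integrable_exp \<kappa>_\<theta>)
  also have "\<dots> \<ge> (\<integral>\<omega>. (l - \<theta>) * (\<xi> 1 \<omega> * exp (\<theta> * \<xi> 1 \<omega>)) \<partial>M)"
  proof (rule integral_mono)
    show "integrable M (\<lambda>\<omega>. exp (l * \<xi> 1 \<omega>) - exp (\<theta> * \<xi> 1 \<omega>))"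
      using l \<theta>_pos \<epsilon>_pos by (intro Bochner_Integration.integrable_diff integrable_exp) auto
    fix \<omega>
    have "(1 + (l - \<theta>) * \<xi> 1 \<omega>) * exp (\<theta> * \<xi> 1 \<omega>) \<le> exp ((l - \<theta>) * \<xi> 1 \<omega>) * exp (\<theta> * \<xi> 1 \<omega>)"
      by (intro mult_right_mono exp_ge_add_one_self) simp
    also have "\<dots> = exp (l * \<xi> 1 \<omega>)" by (simp add: exp_add[symmetric] algebra_simps)
    finally show "(l - \<theta>) * (\<xi> 1 \<omega> * exp (\<theta> * \<xi> 1 \<omega>)) \<le> exp (l * \<xi> 1 \<omega>) - exp (\<theta> * \<xi> 1 \<omega>)"
      by (simp add: algebra_simps)
  qed (intro integrable_mult_right i1)
  finally have "(l - \<theta>) * (\<integral>\<omega>. \<xi> 1 \<omega> * exp (\<theta> * \<xi> 1 \<omega>) \<partial>M) \<le> exp (\<kappa> l) - 1" by simp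
  also have "\<dots> < 0" using \<kappa>_neg[OF l] by simp
  finally show ?thesis using l by (simp add: mult_less_0_iff)
qed

text \<open>To the left of \<theta> the modulus is below 1. At \<theta> + i * y the value 1 forces
  the expectation of exp (\<theta> * \<xi> 1) * (1 - cos (y * \<xi> 1)) to vanish, so \<xi> 1 would
  almost surely be an integer multiple of 2 * pi / y.\<close>

lemma \<phi>1_neq_1:
  assumes s: "0 < Re s" "Re s \<le> \<theta>" "s \<noteq> of_real \<theta>"
  shows "\<phi>1 s \<noteq> 1"
proof (cases "Re s < \<theta>")
  case True
  have "norm (\<phi>1 s) \<le> exp (1 * \<kappa> (Re s))"
    unfolding \<phi>1_def using s \<epsilon>_pos by (intro norm_\<phi>_le) auto
  also have "\<dots> < 1" using \<kappa>_neg[of "Re s"] s True by simp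
  finally show ?thesis by auto
next
  case False
  then have Re: "Re s = \<theta>" using s by simp
  define y where "y = Im s"
  have y: "y \<noteq> 0" using s(3) Re by (auto simp: y_def complex_eq_iff)
  show ?thesis
  proof
    assume 1: "\<phi>1 s = 1"
    have int: "integrable M (\<lambda>\<omega>. exp (s * of_real (\<xi> 1 \<omega>)))"
      using Re \<theta>_pos \<epsilon>_pos by (intro integrable_\<phi>) auto
    have re: "Re (exp (s * of_real (\<xi> 1 \<omega>))) = exp (\<theta> * \<xi> 1 \<omega>) * cos (y * \<xi> 1 \<omega>)" for \<omega>
      by (simp add: Re_exp Re y_def)
    have ic: "integrable M (\<lambda>\<omega>. exp (\<theta> * \<xi> 1 \<omega>) * cos (y * \<xi> 1 \<omega>))"
      using integrable_Re[OF int] by (simp only: re)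
    have ie: "integrable M (\<lambda>\<omega>. exp (\<theta> * \<xi> 1 \<omega>))" using \<theta>_pos \<epsilon>_pos by (intro integrable_exp) auto
    have "(\<integral>\<omega>. exp (\<theta> * \<xi> 1 \<omega>) * cos (y * \<xi> 1 \<omega>) \<partial>M) = Re (\<phi>1 s)"
      unfolding \<phi>1_def \<phi>_def by (subst integral_Re[OF int, symmetric]) (simp only: re)
    then have c: "(\<integral>\<omega>. exp (\<theta> * \<xi> 1 \<omega>) * cos (y * \<xi> 1 \<omega>) \<partial>M) = 1" using 1 by simp
    have "(\<integral>\<omega>. exp (\<theta> * \<xi> 1 \<omega>) * (1 - cos (y * \<xi> 1 \<omega>)) \<partial>M) = 0"
      using c ie ic \<theta>_pos \<epsilon>_pos by (simp add: right_diff_distrib integral_exp \<kappa>_\<theta>)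
    moreover have "integrable M (\<lambda>\<omega>. exp (\<theta> * \<xi> 1 \<omega>) * (1 - cos (y * \<xi> 1 \<omega>)))"
      using ie ic by (simp add: right_diff_distrib)
    ultimately have "AE \<omega> in M. exp (\<theta> * \<xi> 1 \<omega>) * (1 - cos (y * \<xi> 1 \<omega>)) = 0"
      by (subst (asm) integral_nonneg_eq_0_iff_AE) auto
    then have "AE \<omega> in M. \<exists>k::int. \<xi> 1 \<omega> = (2 * pi / y) * of_int k"
    proof eventually_elim
      case (elim \<omega>)
      then have "cos (y * \<xi> 1 \<omega>) = 1" by simp
      then obtain k :: int where "y * \<xi> 1 \<omega> = of_int k * 2 * pi" by (auto simp: cos_one_2pi_int)
      then have "\<xi> 1 \<omega> = (2 * pi / y) * of_int k" using y by (simp add: field_simps)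
      then show ?case by blast
    qed
    then show False by (rule not_concentrated)
  qed
qed

text \<open>The width to the right of \<theta> is limited by \<epsilon> for the transforms of \<xi>,
  and by 1 because \<open>Mellin (s - 1)\<close> is controlled only for Re s - 1 < \<theta>.\<close>

definition strip :: "complex set" where "strip = {s. 0 < Re s \<and> Re s < \<theta> + min \<epsilon> 1}"

lemma open_strip: "open strip"
proof -
  have "strip = {s. 0 < Re s} \<inter> {s. Re s < \<theta> + min \<epsilon> 1}" by (auto simp: strip_def)
  then show ?thesis by (simp add: open_halfspace_Re_gt open_halfspace_Re_lt open_Int)
qed

text \<open>The difference quotient of \<open>\<phi>1\<close> at \<theta>, with its removable
  singularity filled in. It divides out the zero of 1 - \<open>\<phi>1\<close>; its nonvanishing at
  \<theta>, which is \<open>drift_pos\<close>, says that this zero is simple.\<close>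

definition \<psi> :: "complex \<Rightarrow> complex" where
  "\<psi> s = (if s = of_real \<theta> then deriv \<phi>1 (of_real \<theta>) else (\<phi>1 s - \<phi>1 (of_real \<theta>)) / (s - of_real \<theta>))"

lemma holomorphic_\<psi>: "\<psi> holomorphic_on strip"
proof -
  have "\<phi>1 holomorphic_on strip"
    unfolding holomorphic_on_open[OF open_strip]
  proof
    fix s assume "s \<in> strip"
    then have s: "0 < Re s" "Re s < \<theta> + \<epsilon>" by (auto simp: strip_def)
    show "\<exists>f'. (\<phi>1 has_field_derivative f') (at s)"
      by (rule exI, rule \<phi>1_has_field_derivative[OF s])
  qed
  from pole_lemma_open[OF this open_strip, of "of_real \<theta>"] show ?thesis by (simp add: \<psi>_def[abs_def])
qed

lemma \<psi>_\<theta>: "\<psi> (of_real \<theta>) = of_real (\<integral>\<omega>. \<xi> 1 \<omega> * exp (\<theta> * \<xi> 1 \<omega>) \<partial>M)"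
proof -
  have "\<psi> (of_real \<theta>) = (\<integral>\<omega>. of_real (\<xi> 1 \<omega>) * exp (of_real \<theta> * of_real (\<xi> 1 \<omega>)) \<partial>M)"
    unfolding \<psi>_def using \<theta>_pos \<epsilon>_pos by (simp add: DERIV_imp_deriv[OF \<phi>1_has_field_derivative])
  also have "\<dots> = (\<integral>\<omega>. complex_of_real (\<xi> 1 \<omega> * exp (\<theta> * \<xi> 1 \<omega>)) \<partial>M)"
    by (simp add: exp_of_real[symmetric])
  finally show ?thesis by (simp only: integral_complex_of_real)
qed

lemma \<psi>_neq_0:
  assumes "0 < Re s" "Re s \<le> \<theta>"
  shows "\<psi> s \<noteq> 0"
proof (cases "s = of_real \<theta>")
  case True
  then show ?thesis using drift_pos by (simp add: \<psi>_\<theta>)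
next
  case False
  then show ?thesis using \<phi>1_neq_1[OF assms False] by (simp add: \<psi>_def \<phi>1_\<theta>)
qed

text \<open>The transform of the tail is this function divided by \<theta> - s. The factor s of the
  functional equation is absent, being cancelled by the 1 / s of
  \<open>tail_transform\<close>.\<close>

definition pole_numerator :: "complex \<Rightarrow> complex" where "pole_numerator s = Mellin (s - 1) * local_transform s / \<psi> s"

text \<open>Zeros of \<open>\<psi>\<close> to the right of \<theta> are not excluded, so they are
  removed; what is left is open and still contains all s with 0 < Re s \<le> \<theta>.\<close>

definition pole_domain :: "complex set" where "pole_domain = {s \<in> strip. \<psi> s \<noteq> 0}"

lemma open_pole_domain: "open pole_domain"
proof -
  have "pole_domain = strip \<inter> \<psi> -` (- {0})" by (auto simp: pole_domain_def)
  moreover have "open (strip \<inter> \<psi> -` (- {0}))"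
    by (intro continuous_open_preimage holomorphic_on_imp_continuous_on holomorphic_\<psi> open_strip open_Compl) simp
  ultimately show ?thesis by simp
qed

lemma holomorphic_pole_numerator: "pole_numerator holomorphic_on pole_domain"
proof -
  have "Mellin holomorphic_on {s. -1 < Re s \<and> Re s < \<theta>}"
  proof -
    have o: "open {s. -1 < Re s \<and> Re s < \<theta>}"
      by (auto intro!: open_Collect_conj open_Collect_less continuous_intros)
    have "\<exists>f'. (Mellin has_field_derivative f') (at s)" if s: "-1 < Re s" "Re s < \<theta>" for s
    proof -
      define a b where "a = (Re s - 1) / 2" and "b = (Re s + \<theta>) / 2"
      have ab: "-1 < a" "a < \<theta>" "-1 < b" "b < \<theta>" "a < Re s" "Re s < b" using s by (auto simp: a_def b_def)
      show ?thesis unfolding Mellin_def[abs_def]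
        by (rule exI, rule exp_transform_has_field_derivative(2)[OF measurable_L integrable_exp_L[OF ab(1,2)] integrable_exp_L[OF ab(3,4)] ab(5,6)])
    qed
    then show ?thesis by (subst holomorphic_on_open[OF o]) auto
  qed
  then have "(Mellin \<circ> (\<lambda>s. s - 1)) holomorphic_on pole_domain"
    by (rule holomorphic_on_compose_gen[rotated]) (auto intro!: holomorphic_intros simp: pole_domain_def strip_def)
  moreover have "local_transform holomorphic_on pole_domain"
    unfolding holomorphic_on_open[OF open_pole_domain]
  proof
    fix s assume "s \<in> pole_domain"
    then have s: "0 < Re s" "Re s < \<theta> + \<epsilon>" by (auto simp: pole_domain_def strip_def)
    have e: "(0::real) \<le> 0" "0 \<le> \<theta> + \<epsilon>" "\<theta> + \<epsilon> \<le> \<theta> + \<epsilon>" using \<theta>_pos \<epsilon>_pos by auto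
    show "\<exists>f'. (local_transform has_field_derivative f') (at s)"
      unfolding local_transform_def[abs_def]
      by (rule exI, rule exp_transform_has_field_derivative(2)[OF measurable_path_density integrable_exp_path[OF e(1,2)] integrable_exp_path[OF e(2,3)] s])
  qed
  ultimately show ?thesis unfolding pole_numerator_def
    by (intro holomorphic_intros holomorphic_on_subset[OF holomorphic_\<psi>]) (auto simp: o_def pole_domain_def)
qed

text \<open>What remains of the transform once the pole at \<theta> is subtracted. The minus sign
  reflects that the pole is written with \<theta> - s, the difference quotient with s -
  \<theta>.\<close>

definition boundary_function :: "complex \<Rightarrow> complex" where
  "boundary_function s = - (if s = of_real \<theta> then deriv pole_numerator (of_real \<theta>) else (pole_numerator s - pole_numerator (of_real \<theta>)) / (s - of_real \<theta>))"

lemma continuous_boundary_function: "continuous_on {s. 0 < Re s \<and> Re s \<le> \<theta>} boundary_function"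
proof -
  have "(\<lambda>s. if s = of_real \<theta> then deriv pole_numerator (of_real \<theta>) else (pole_numerator s - pole_numerator (of_real \<theta>)) / (s - of_real \<theta>)) holomorphic_on pole_domain"
    by (rule pole_lemma_open[OF holomorphic_pole_numerator open_pole_domain])
  then have "boundary_function holomorphic_on pole_domain" unfolding boundary_function_def[abs_def] by (rule holomorphic_on_minus)
  then have "continuous_on pole_domain boundary_function" by (rule holomorphic_on_imp_continuous_on)
  then show ?thesis
    by (rule continuous_on_subset) (use \<psi>_neq_0 \<epsilon>_pos in \<open>auto simp: pole_domain_def strip_def\<close>)
qed

text \<open>The value of \<open>pole_numerator\<close> at \<theta>: the numerator is
  \<open>Mellin (\<theta> - 1)\<close>, the denominator is \<open>\<psi>\<close> at \<theta>, and
  \<open>local_transform\<close> contributes 1 there because the moment of order \<theta> is 1 at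
  every time.\<close>

definition tail_constant :: real where
  "tail_constant = (\<integral>\<omega>. exp ((\<theta> - 1) * L \<omega>) \<partial>M) / (\<integral>\<omega>. \<xi> 1 \<omega> * exp (\<theta> * \<xi> 1 \<omega>) \<partial>M)"

lemma tail_constant_pos: "tail_constant > 0"
proof -
  have i: "integrable M (\<lambda>\<omega>. exp ((\<theta> - 1) * L \<omega>))" using \<theta>_pos by (intro integrable_exp_L) auto
  have "(\<integral>\<omega>. exp ((\<theta> - 1) * L \<omega>) \<partial>M) \<noteq> 0"
    by (subst integral_nonneg_eq_0_iff_AE[OF i]) auto
  moreover have "(\<integral>\<omega>. exp ((\<theta> - 1) * L \<omega>) \<partial>M) \<ge> 0" by (intro integral_nonneg_AE) auto
  ultimately have "(\<integral>\<omega>. exp ((\<theta> - 1) * L \<omega>) \<partial>M) > 0" by (metis less_le)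
  then show ?thesis unfolding tail_constant_def using drift_pos by (rule divide_pos_pos)
qed

lemma pole_numerator_\<theta>: "pole_numerator (of_real \<theta>) = of_real tail_constant"
proof -
  have "Mellin (of_real \<theta> - 1) = (\<integral>\<omega>. complex_of_real (exp ((\<theta> - 1) * L \<omega>)) \<partial>M)"
    by (simp add: Mellin_def exp_of_real[symmetric])
  then have 1: "Mellin (of_real \<theta> - 1) = of_real (\<integral>\<omega>. exp ((\<theta> - 1) * L \<omega>) \<partial>M)"
    by (simp only: integral_complex_of_real)
  have \<phi>u: "\<phi> u (of_real \<theta>) = 1" if "u \<ge> 0" for u
  proof -
    have "\<phi> u (of_real \<theta>) = (\<integral>\<omega>. complex_of_real (exp (\<theta> * \<xi> u \<omega>)) \<partial>M)"
      by (simp add: \<phi>_def exp_of_real[symmetric])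
    also have "\<dots> = of_real (\<integral>\<omega>. exp (\<theta> * \<xi> u \<omega>) \<partial>M)" by (rule integral_complex_of_real)
    also have "\<dots> = 1" using \<theta>_pos \<epsilon>_pos that by (simp add: integral_exp \<kappa>_\<theta>)
    finally show ?thesis .
  qed
  have "local_transform (of_real \<theta>) = (LBINT u:{0..1}. \<phi> u (of_real \<theta>))"
    using \<theta>_pos \<epsilon>_pos by (intro local_transform_eq) auto
  also have "\<dots> = (LBINT u:{0..1::real}. (1::complex))"
    by (intro set_lebesgue_integral_cong) (auto simp: \<phi>u)
  also have "\<dots> = 1" by (simp add: set_integral_const)
  finally show ?thesis by (simp add: pole_numerator_def 1 \<psi>_\<theta> tail_constant_def)
qed

lemma tail_transform_eq_pole_numerator:
  assumes s: "0 < Re s" "Re s < \<theta>"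
  shows "Mellin s / s = pole_numerator s / (of_real \<theta> - s)"
proof -
  have s0: "s \<noteq> 0" and s\<theta>: "s \<noteq> of_real \<theta>" using s by auto
  have ps: "\<psi> s \<noteq> 0" using s by (intro \<psi>_neq_0) auto
  have "1 - \<phi>1 s = (of_real \<theta> - s) * \<psi> s" using s\<theta> by (simp add: \<psi>_def \<phi>1_\<theta> field_simps)
  then have "(LBINT u:{0..}. \<phi> u s) * ((of_real \<theta> - s) * \<psi> s) = local_transform s"
    using renewal_\<phi>[OF s] by (simp add: \<phi>1_def)
  then have "(LBINT u:{0..}. \<phi> u s) = local_transform s / \<psi> s / (of_real \<theta> - s)"
    using ps s\<theta> by (simp add: field_simps)
  then show ?thesis using Mellin_functional_equation[OF s] s0 by (simp add: pole_numerator_def)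
qed

text \<open>The Wiener-Ikehara theorem for the tail of \<open>L\<close> tilted by exp (\<theta> *
  x). The tilt turns monotonicity of the tail into \<open>slow\<close>, and it moves the line Re s =
  \<theta> to Re s = 0, whence the argument \<theta> - s and the width e0 = \<theta>.\<close>

lemma tail_asymptotics: "((\<lambda>x. exp (\<theta> * x) * log_tail x) \<longlongrightarrow> tail_constant) at_top"
proof -
  define q where "q x = log_tail x" for x
  have q_antimono: "q y \<le> q x" if "x \<le> y" for x y
    unfolding q_def using that by (intro finite_measure_mono) auto
  have "(\<lambda>x. - q x) \<in> borel_measurable borel" by (intro borel_measurable_mono monoI) (simp add: q_antimono)
  then have [measurable]: "q \<in> borel_measurable borel" using borel_measurable_uminus_eq[of q] by simp
  have e: "exp (\<theta> * z) * q z * exp (- e * z) = Re (exp (of_real (\<theta> - e) * of_real z) * of_real (q z))" for e z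
    by (simp add: exp_of_real exp_add[symmetric] left_diff_distrib flip: of_real_mult of_real_diff)
  interpret W: wiener_ikehara "\<lambda>x. exp (\<theta> * x) * q x" "\<lambda>s. boundary_function (of_real \<theta> - s)" tail_constant \<theta> \<theta>
  proof
    show "(\<lambda>x. exp (\<theta> * x) * q x) \<in> borel_measurable borel" by measurable
    show "exp (\<theta> * x) * q x \<ge> 0" for x by (simp add: q_def)
    show "tail_constant > 0" "\<theta> > 0" by (rule tail_constant_pos \<theta>_pos)+
    show "exp (\<theta> * (x + h)) * q (x + h) \<le> exp (\<theta> * h) * (exp (\<theta> * x) * q x)" if "h \<ge> 0" for x h
      using q_antimono[of x "x + h"] that by (simp add: distrib_left exp_add mult_left_mono)
    show "integrable lborel (\<lambda>z. exp (\<theta> * z) * q z * exp (- e * z))" if "0 < e" "e < \<theta>" for e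
      unfolding e using that by (intro integrable_Re) (simp only: q_def, intro tail_transform(1), auto)
    show "continuous_on {s. 0 \<le> Re s \<and> Re s < \<theta>} (\<lambda>s. boundary_function (of_real \<theta> - s))"
      by (rule continuous_on_compose2[OF continuous_boundary_function]) (auto intro!: continuous_intros)
    fix s :: complex assume s: "0 < Re s" "Re s < \<theta>"
    define z where "z = of_real \<theta> - s"
    have z: "0 < Re z" "Re z < \<theta>" using s by (auto simp: z_def)
    have i1: "integrable lborel (\<lambda>x. exp (z * of_real x) * of_real (q x))"
      unfolding q_def by (rule tail_transform(1)[OF z])
    \<comment> \<open>The reflection of k is the exponential on the positive half-line, so its
      integral 1 / s, the transform of the subtracted constant part, follows from
      \<open>integral_halfline_exp\<close>.\<close>
    define k where "k x = indicator {..<0} x *\<^sub>R exp (s * complex_of_real x)" for x :: real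
    have i2: "integrable lborel k" and v2: "(LBINT x. k x) = 1 / s"
      using integral_halfline_exp[OF s(1), of 0] by (simp_all add: k_def[abs_def] set_lebesgue_integral_def)
    have i3: "integrable lborel (\<lambda>x. k (- x))" using i2 lborel_integrable_real_affine_iff[of "-1" k 0] by simp
    have v3: "(LBINT x. k (- x)) = 1 / s" using v2 lborel_integral_real_affine[of "-1" k 0] by simp
    have "(LBINT x. of_real (exp (\<theta> * x) * q x - tail_constant * indicator {0<..} x) * exp (- s * of_real x)) =
       (LBINT x. exp (z * of_real x) * of_real (q x) - of_real tail_constant * k (- x))"
    proof (intro Bochner_Integration.integral_cong refl)
      fix x
      have E: "complex_of_real (exp (\<theta> * x)) * exp (- s * of_real x) = exp (z * of_real x)"
        unfolding exp_of_real[symmetric] exp_add[symmetric] z_def by (simp add: algebra_simps)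
      have "indicator {..<0} (- x) = (indicator {0<..} x :: real)" by (auto simp: indicator_def)
      then have K: "k (- x) = indicator {0<..} x *\<^sub>R exp (- s * of_real x)" by (simp add: k_def)
      have "of_real (exp (\<theta> * x) * q x - tail_constant * indicator {0<..} x) * exp (- s * of_real x) =
          (of_real (exp (\<theta> * x)) * exp (- s * of_real x)) * of_real (q x) - of_real tail_constant * (indicator {0<..} x *\<^sub>R exp (- s * of_real x))"
        by (simp add: algebra_simps scaleR_conv_of_real)
      then show "of_real (exp (\<theta> * x) * q x - tail_constant * indicator {0<..} x) * exp (- s * of_real x) =
         exp (z * of_real x) * of_real (q x) - of_real tail_constant * k (- x)"
        unfolding E K .
    qed
    also have "\<dots> = Mellin z / z - of_real tail_constant * (1 / s)"
      unfolding v3[symmetric] tail_transform(2)[OF z, folded q_def, symmetric]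
      by (subst Bochner_Integration.integral_diff) (auto intro: i1 i3)
    also have "\<dots> = (pole_numerator z - of_real tail_constant) / s"
      using tail_transform_eq_pole_numerator[OF z] by (simp add: z_def diff_divide_distrib)
    also have "\<dots> = boundary_function (of_real \<theta> - s)"
    proof -
      have "z \<noteq> of_real \<theta>" "z - of_real \<theta> = - s" using s by (auto simp: z_def)
      then show ?thesis unfolding z_def[symmetric] by (simp add: boundary_function_def pole_numerator_\<theta>)
    qed
    finally show "(LBINT x. of_real (exp (\<theta> * x) * q x - tail_constant * indicator {0<..} x) * exp (- s * of_real x)) = boundary_function (of_real \<theta> - s)" .
  qed
  show ?thesis using W.tendsto_at_top by (simp add: q_def)
qed

lemma A_inf_tail: "((\<lambda>t. t powr \<theta> * \<P>(\<omega> in M. A_inf \<omega> > ennreal t)) \<longlongrightarrow> tail_constant) at_top"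
proof -
  have "((\<lambda>t. exp (\<theta> * ln t) * log_tail (ln t)) \<longlongrightarrow> tail_constant) at_top"
    by (rule filterlim_compose[OF tail_asymptotics ln_at_top])
  moreover have "\<forall>\<^sub>F t in at_top. exp (\<theta> * ln t) * log_tail (ln t) = t powr \<theta> * \<P>(\<omega> in M. A_inf \<omega> > ennreal t)"
    using eventually_gt_at_top[of 0]
  proof eventually_elim
    case (elim t)
    have "log_tail (ln t) = \<P>(\<omega> in M. A_inf \<omega> > ennreal t)"
    proof (rule measure_eq_AE)
      show "AE \<omega> in M. (\<omega> \<in> {\<omega>\<in>space M. L \<omega> > ln t}) = (\<omega> \<in> {\<omega>\<in>space M. A_inf \<omega> > ennreal t})"
        using R_pos A_inf_finite
      proof eventually_elim
        case (elim \<omega>)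
        then have "A_inf \<omega> = ennreal (R \<omega>)" by (simp add: R_def less_top)
        then show ?case using elim \<open>t > 0\<close> by (simp add: L_def ennreal_less_iff)
      qed
    qed measurable
    then show ?case using elim by (simp add: powr_def)
  qed
  ultimately show ?thesis by (rule Lim_transform_eventually)
qed

end

theorem theorem1p1:
  fixes M :: "'a measure" and \<xi> :: "real \<Rightarrow> 'a \<Rightarrow> real" and \<theta> :: real
  assumes "levy_process M \<xi>"
    and "\<theta> > 0" and "levy_exponent M \<xi> \<theta> = 0"
    and "\<exists>\<epsilon>>0. \<forall>l\<in>{0..\<theta> + \<epsilon>}. levy_exponent M \<xi> l > -\<infinity>"
    and "\<not> arithmetic_law (distr M borel (\<xi> 1))"
  shows "(AE \<omega> in M. exp_functional \<xi> \<omega> < \<infinity>) \<and>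
    (\<exists>C>0. (\<lambda>t::real. \<P>(\<omega> in M. exp_functional \<xi> \<omega> > ennreal t))
       \<sim>[at_top] (\<lambda>t. C * t powr (- \<theta>)))"
proof -
  from assms(4) obtain \<epsilon> where \<epsilon>: "\<epsilon> > 0" "\<And>l. l \<in> {0..\<theta> + \<epsilon>} \<Longrightarrow> levy_exponent M \<xi> l > -\<infinity>" by blast
  interpret levy_process M \<xi> by fact
  interpret cramer_process M \<xi> \<theta> \<epsilon>
    by unfold_locales (use assms \<epsilon> in auto)
  have A: "exp_functional \<xi> = A_inf" by (simp add: fun_eq_iff exp_functional_def exp_int_def)
  have "((\<lambda>t. \<P>(\<omega> in M. A_inf \<omega> > ennreal t) / (tail_constant * t powr (- \<theta>))) \<longlongrightarrow> 1) at_top"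
  proof (rule Lim_transform_eventually)
    have "((\<lambda>t. t powr \<theta> * \<P>(\<omega> in M. A_inf \<omega> > ennreal t) / tail_constant) \<longlongrightarrow> tail_constant / tail_constant) at_top"
      by (intro tendsto_divide A_inf_tail tendsto_const) (use tail_constant_pos in simp)
    then show "((\<lambda>t. t powr \<theta> * \<P>(\<omega> in M. A_inf \<omega> > ennreal t) / tail_constant) \<longlongrightarrow> 1) at_top" using tail_constant_pos by simp
    show "\<forall>\<^sub>F t in at_top. t powr \<theta> * \<P>(\<omega> in M. A_inf \<omega> > ennreal t) / tail_constant = \<P>(\<omega> in M. A_inf \<omega> > ennreal t) / (tail_constant * t powr (- \<theta>))"
      using eventually_gt_at_top[of 0] by eventually_elim (simp add: powr_minus field_simps)
  qed
  then have "(\<lambda>t. \<P>(\<omega> in M. A_inf \<omega> > ennreal t)) \<sim>[at_top] (\<lambda>t. tail_constant * t powr (- \<theta>))"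
    by (rule asymp_equivI')
  then show ?thesis unfolding A using A_inf_finite tail_constant_pos by blast
qed

end
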